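(* Let $n>2$ and let $(M,g,J)$ be a $2n$-dimensional almost Hermitian manifold whose classical Bochner curvature tensor $B$ vanishes identically on $M$. Let $p\in M$. If $M$ is not Kählerian at $p$ (that is, $(\nabla J)_p\neq 0$, where $\nabla$ is the Levi-Civita connection of $g$), then $M$ is flat in a neighbourhood of $p$, i.e. there is an open neighbourhood $U$ of $p$ on which the Riemannian curvature tensor $R$ of $g$ vanishes identically.
   Context: An almost Hermitian manifold $(M,g,J)$ is a smooth manifold with a Riemannian metric $g$ and a smooth almost complex structure $J$ (a $(1,1)$-tensor field with $J^2=-\mathrm{id}$) such that $g(Jx,Jy)=g(x,y)$ for all tangent vectors $x,y$. $J$ is not assumed integrable. Let $\nabla$ be the Levi-Civita connection of $g$. $M$ is called Kählerian at a point $p$ if $\nabla J=0$ at $p$. The Riemannian curvature tensor is $R(x,y,z,u)=g(\nabla_x\nabla_y z-\nabla_y\nabla_x z-\nabla_{[x,y]}z,\,u)$. The Ricci tensor is $\rho(x,y)=\sum_{i=1}^{2n}R(x,e_i,e_i,y)$ and the scalar curvature is $\tau=\sum_{i=1}^{2n}\rho(e_i,e_i)$, for any orthonormal basis $e_1,\dots,e_{2n}$ of the tangent space. The classical Bochner curvature tensor of the $2n$-dimensional almost Hermitian manifold $M$ is $B=R-\varphi(Q)$, where $$Q=\frac{1}{2(n+2)}\rho-\frac{\tau}{8(n+1)(n+2)}g$$ and $$\begin{aligned}\varphi(Q)(x,y,z,u)={}& g(x,u)Q(y,z)-g(x,z)Q(y,u)+g(y,z)Q(x,u)-g(y,u)Q(x,z)\\&+g(x,Ju)Q(y,Jz)-g(x,Jz)Q(y,Ju)-2g(x,Jy)Q(z,Ju)\\&+g(y,Jz)Q(x,Ju)-g(y,Ju)Q(x,Jz)-2g(z,Ju)Q(x,Jy).\end{aligned}$$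 *)

theory Defs
  imports "HOL-Analysis.Analysis" "HOL-Library.Function_Algebras"
begin

text \<open>
  Smooth manifolds are given by a topology \<open>M\<close> on an arbitrary type, together with a smooth
  atlas \<open>A\<close> of charts into a Euclidean space \<open>'e\<close>; the dimension of the manifold is \<open>DIM('e)\<close>.
\<close>

primrec Ck_on :: "nat \<Rightarrow> 'b::real_normed_vector set \<Rightarrow> ('b \<Rightarrow> 'c::real_normed_vector) \<Rightarrow> bool"
  where
    "Ck_on 0 S f \<longleftrightarrow> continuous_on S f"
  | "Ck_on (Suc k) S f \<longleftrightarrow>
       (\<forall>x\<in>S. f differentiable (at x)) \<and> (\<forall>v. Ck_on k S (\<lambda>x. frechet_derivative f (at x) v))"

text \<open>Only used for open subsets of finite-dimensional spaces.\<close>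

definition smooth_on :: "'b::real_normed_vector set \<Rightarrow> ('b \<Rightarrow> 'c::real_normed_vector) \<Rightarrow> bool"
  where "smooth_on S f \<longleftrightarrow> (\<forall>k. Ck_on k S f)"

text \<open>A chart is a domain together with a coordinate map, which is arbitrary off the domain.\<close>

type_synonym ('a, 'e) chart = "'a set \<times> ('a \<Rightarrow> 'e)"

definition is_chart :: "'a topology \<Rightarrow> ('a, 'e::euclidean_space) chart \<Rightarrow> bool"
  where "is_chart M c \<longleftrightarrow>
    openin M (fst c) \<and> open (snd c ` fst c) \<and>
    homeomorphic_map (subtopology M (fst c)) (top_of_set (snd c ` fst c)) (snd c)"

definition in_chart :: "('a, 'e) chart \<Rightarrow> ('a \<Rightarrow> 'b) \<Rightarrow> 'e \<Rightarrow> 'b"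
  where "in_chart c f = f \<circ> inv_into (fst c) (snd c)"

abbreviation transition :: "('a, 'e) chart \<Rightarrow> ('a, 'e) chart \<Rightarrow> 'e \<Rightarrow> 'e"
  where "transition c d \<equiv> in_chart c (snd d)"

definition smooth_manifold :: "'a topology \<Rightarrow> ('a, 'e::euclidean_space) chart set \<Rightarrow> bool"
  where "smooth_manifold M A \<longleftrightarrow>
    Hausdorff_space M \<and> second_countable M \<and>
    (\<forall>c\<in>A. is_chart M c) \<and> (\<Union>c\<in>A. fst c) = topspace M \<and>
    (\<forall>c\<in>A. \<forall>d\<in>A. smooth_on (snd c ` (fst c \<inter> fst d)) (transition c d))"

definition smooth_fun_on ::
  "('a, 'e::euclidean_space) chart set \<Rightarrow> 'a set \<Rightarrow> ('a \<Rightarrow> real) \<Rightarrow> bool"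
  where "smooth_fun_on A W f \<longleftrightarrow> (\<forall>c\<in>A. smooth_on (snd c ` (fst c \<inter> W)) (in_chart c f))"

text \<open>
  A tangent vector at \<open>p\<close> assigns to each chart around \<open>p\<close> its coordinate vector in that chart,
  subject to the usual transformation law. Components at all other charts are fixed to be \<open>0\<close>,
  which makes the tangent space a subspace of dimension \<open>DIM('e)\<close> of the function space.
\<close>

type_synonym ('a, 'e) tvec = "('a, 'e) chart \<Rightarrow> 'e"

instantiation "fun" :: (type, real_vector) real_vector
begin

definition scaleR_fun :: "real \<Rightarrow> ('a \<Rightarrow> 'b) \<Rightarrow> 'a \<Rightarrow> 'b"
  where "scaleR_fun r f = (\<lambda>x. r *\<^sub>R f x)"

instance
  by standard (auto simp: scaleR_fun_def fun_eq_iff scaleR_add_right scaleR_add_left)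

end

definition tangent_space :: "('a, 'e::euclidean_space) chart set \<Rightarrow> 'a \<Rightarrow> ('a, 'e) tvec set"
  where "tangent_space A p = {v.
    (\<forall>c\<in>A. \<forall>d\<in>A. p \<in> fst c \<longrightarrow> p \<in> fst d \<longrightarrow>
       v d = frechet_derivative (transition c d) (at (snd c p)) (v c)) \<and>
    (\<forall>c. \<not> (c \<in> A \<and> p \<in> fst c) \<longrightarrow> v c = 0)}"

text \<open>Smooth vector fields on the open set \<open>W\<close>; their values off \<open>W\<close> are irrelevant.\<close>

definition vector_fields ::
  "('a, 'e::euclidean_space) chart set \<Rightarrow> 'a set \<Rightarrow> ('a \<Rightarrow> ('a, 'e) tvec) set"
  where "vector_fields A W = {X.
    (\<forall>p\<in>W. X p \<in> tangent_space A p) \<and>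
    (\<forall>c\<in>A. smooth_on (snd c ` (fst c \<inter> W)) (in_chart c (\<lambda>q. X q c)))}"

text \<open>The derivative \<open>v f\<close> of a function along a tangent vector; by the transformation law any
  chart around \<open>p\<close> gives the same value.\<close>

definition deriv_along ::
  "('a, 'e::euclidean_space) chart set \<Rightarrow> 'a \<Rightarrow> ('a, 'e) tvec \<Rightarrow> ('a \<Rightarrow> real) \<Rightarrow> real"
  where "deriv_along A p v f =
    (let c = (SOME c. c \<in> A \<and> p \<in> fst c)
     in frechet_derivative (in_chart c f) (at (snd c p)) (v c))"

definition lie_bracket :: "('a, 'e::euclidean_space) chart set \<Rightarrow>
    ('a \<Rightarrow> ('a, 'e) tvec) \<Rightarrow> ('a \<Rightarrow> ('a, 'e) tvec) \<Rightarrow> 'a \<Rightarrow> ('a, 'e) tvec"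
  where "lie_bracket A X Y p = (\<lambda>c.
    if c \<in> A \<and> p \<in> fst c then
      frechet_derivative (in_chart c (\<lambda>q. Y q c)) (at (snd c p)) (X p c)
      - frechet_derivative (in_chart c (\<lambda>q. X q c)) (at (snd c p)) (Y p c)
    else 0)"

type_synonym ('a, 'e) metric = "'a \<Rightarrow> ('a, 'e) tvec \<Rightarrow> ('a, 'e) tvec \<Rightarrow> real"

definition riemannian_metric ::
  "'a topology \<Rightarrow> ('a, 'e::euclidean_space) chart set \<Rightarrow> ('a, 'e) metric \<Rightarrow> bool"
  where "riemannian_metric M A g \<longleftrightarrow>
    (\<forall>p\<in>topspace M. \<forall>x\<in>tangent_space A p. \<forall>y\<in>tangent_space A p. \<forall>z\<in>tangent_space A p. \<forall>a.
       g p (x + y) z = g p x z + g p y z \<and> g p (a *\<^sub>R x) z = a * g p x z \<and>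
       g p x y = g p y x \<and> (x \<noteq> 0 \<longrightarrow> g p x x > 0)) \<and>
    (\<forall>W. openin M W \<longrightarrow> (\<forall>X\<in>vector_fields A W. \<forall>Y\<in>vector_fields A W.
       smooth_fun_on A W (\<lambda>p. g p (X p) (Y p))))"

type_synonym ('a, 'e) endo_field = "'a \<Rightarrow> ('a, 'e) tvec \<Rightarrow> ('a, 'e) tvec"

definition almost_complex_structure ::
  "'a topology \<Rightarrow> ('a, 'e::euclidean_space) chart set \<Rightarrow> ('a, 'e) endo_field \<Rightarrow> bool"
  where "almost_complex_structure M A J \<longleftrightarrow>
    (\<forall>p\<in>topspace M. \<forall>x\<in>tangent_space A p. \<forall>y\<in>tangent_space A p. \<forall>a.
       J p x \<in> tangent_space A p \<and> J p (x + y) = J p x + J p y \<and> J p (a *\<^sub>R x) = a *\<^sub>R J p x \<and>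
       J p (J p x) = - x) \<and>
    (\<forall>W. openin M W \<longrightarrow> (\<forall>X\<in>vector_fields A W. (\<lambda>p. J p (X p)) \<in> vector_fields A W))"

definition almost_hermitian_manifold :: "'a topology \<Rightarrow> ('a, 'e::euclidean_space) chart set \<Rightarrow>
    ('a, 'e) metric \<Rightarrow> ('a, 'e) endo_field \<Rightarrow> bool"
  where "almost_hermitian_manifold M A g J \<longleftrightarrow>
    smooth_manifold M A \<and> riemannian_metric M A g \<and> almost_complex_structure M A J \<and>
    (\<forall>p\<in>topspace M. \<forall>x\<in>tangent_space A p. \<forall>y\<in>tangent_space A p.
       g p (J p x) (J p y) = g p x y)"

text \<open>
  A connection \<open>D\<close> is applied as \<open>D p v Y\<close>: the covariant derivative at \<open>p\<close> of the vector field
  \<open>Y\<close>, defined and smooth in some open neighbourhood of \<open>p\<close>, along the tangent vector \<open>v\<close> at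
  \<open>p\<close>. It only depends on the germ of \<open>Y\<close> at \<open>p\<close>.
\<close>

type_synonym ('a, 'e) connection = "'a \<Rightarrow> ('a, 'e) tvec \<Rightarrow> ('a \<Rightarrow> ('a, 'e) tvec) \<Rightarrow> ('a, 'e) tvec"

definition affine_connection ::
  "'a topology \<Rightarrow> ('a, 'e::euclidean_space) chart set \<Rightarrow> ('a, 'e) connection \<Rightarrow> bool"
  where "affine_connection M A D \<longleftrightarrow> (\<forall>W. openin M W \<longrightarrow>
    (\<forall>p\<in>W. \<forall>v\<in>tangent_space A p. \<forall>w\<in>tangent_space A p. \<forall>a.
       \<forall>Y\<in>vector_fields A W. \<forall>Z\<in>vector_fields A W.
       D p v Y \<in> tangent_space A p \<and>
       D p (v + w) Y = D p v Y + D p w Y \<and>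
       D p (a *\<^sub>R v) Y = a *\<^sub>R D p v Y \<and>
       D p v (\<lambda>q. Y q + Z q) = D p v Y + D p v Z \<and>
       (\<forall>f. smooth_fun_on A W f \<longrightarrow>
          D p v (\<lambda>q. f q *\<^sub>R Y q) = deriv_along A p v f *\<^sub>R Y p + f p *\<^sub>R D p v Y) \<and>
       ((\<forall>q\<in>W. Y q = Z q) \<longrightarrow> D p v Y = D p v Z)) \<and>
    (\<forall>X\<in>vector_fields A W. \<forall>Y\<in>vector_fields A W.
       (\<lambda>p. D p (X p) Y) \<in> vector_fields A W))"

definition levi_civita_connection :: "'a topology \<Rightarrow> ('a, 'e::euclidean_space) chart set \<Rightarrow>
    ('a, 'e) metric \<Rightarrow> ('a, 'e) connection \<Rightarrow> bool"
  where "levi_civita_connection M A g D \<longleftrightarrow>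
    affine_connection M A D \<and>
    (\<forall>W. openin M W \<longrightarrow> (\<forall>p\<in>W. \<forall>X\<in>vector_fields A W. \<forall>Y\<in>vector_fields A W.
       D p (X p) Y - D p (Y p) X = lie_bracket A X Y p)) \<and>
    (\<forall>W. openin M W \<longrightarrow> (\<forall>p\<in>W. \<forall>v\<in>tangent_space A p.
       \<forall>Y\<in>vector_fields A W. \<forall>Z\<in>vector_fields A W.
       deriv_along A p v (\<lambda>q. g q (Y q) (Z q)) = g p (D p v Y) (Z p) + g p (Y p) (D p v Z)))"

text \<open>
  Tensors defined through vector fields are evaluated on tangent vectors by extending these to
  smooth local vector fields; by tensoriality the choice of extension does not matter.
\<close>

definition field_ext :: "'a topology \<Rightarrow> ('a, 'e::euclidean_space) chart set \<Rightarrow> 'a \<Rightarrow>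
    ('a, 'e) tvec \<Rightarrow> 'a \<Rightarrow> ('a, 'e) tvec"
  where "field_ext M A p x =
    (SOME X. X p = x \<and> (\<exists>W. openin M W \<and> p \<in> W \<and> X \<in> vector_fields A W))"

definition nabla_endo :: "'a topology \<Rightarrow> ('a, 'e::euclidean_space) chart set \<Rightarrow>
    ('a, 'e) connection \<Rightarrow> ('a, 'e) endo_field \<Rightarrow> 'a \<Rightarrow>
    ('a, 'e) tvec \<Rightarrow> ('a, 'e) tvec \<Rightarrow> ('a, 'e) tvec"
  where "nabla_endo M A D J p x y =
    (let Y = field_ext M A p y in D p x (\<lambda>q. J q (Y q)) - J p (D p x Y))"

definition kaehlerian_at :: "'a topology \<Rightarrow> ('a, 'e::euclidean_space) chart set \<Rightarrow>
    ('a, 'e) connection \<Rightarrow> ('a, 'e) endo_field \<Rightarrow> 'a \<Rightarrow> bool"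
  where "kaehlerian_at M A D J p \<longleftrightarrow>
    (\<forall>x\<in>tangent_space A p. \<forall>y\<in>tangent_space A p. nabla_endo M A D J p x y = 0)"

definition curvature_op :: "('a, 'e::euclidean_space) chart set \<Rightarrow> ('a, 'e) connection \<Rightarrow>
    ('a \<Rightarrow> ('a, 'e) tvec) \<Rightarrow> ('a \<Rightarrow> ('a, 'e) tvec) \<Rightarrow> ('a \<Rightarrow> ('a, 'e) tvec) \<Rightarrow> 'a \<Rightarrow> ('a, 'e) tvec"
  where "curvature_op A D X Y Z p =
    D p (X p) (\<lambda>q. D q (Y q) Z) - D p (Y p) (\<lambda>q. D q (X q) Z) - D p (lie_bracket A X Y p) Z"

definition riemann_tensor :: "'a topology \<Rightarrow> ('a, 'e::euclidean_space) chart set \<Rightarrow>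
    ('a, 'e) metric \<Rightarrow> ('a, 'e) connection \<Rightarrow> 'a \<Rightarrow>
    ('a, 'e) tvec \<Rightarrow> ('a, 'e) tvec \<Rightarrow> ('a, 'e) tvec \<Rightarrow> ('a, 'e) tvec \<Rightarrow> real"
  where "riemann_tensor M A g D p x y z u =
    g p (curvature_op A D (field_ext M A p x) (field_ext M A p y) (field_ext M A p z) p) u"

definition orthonormal_basis :: "('a, 'e::euclidean_space) chart set \<Rightarrow> ('a, 'e) metric \<Rightarrow> 'a \<Rightarrow>
    ('a, 'e) tvec set \<Rightarrow> bool"
  where "orthonormal_basis A g p E \<longleftrightarrow>
    finite E \<and> span E = tangent_space A p \<and>
    (\<forall>e\<in>E. \<forall>f\<in>E. g p e f = (if e = f then 1 else 0))"

text \<open>The traces below are the same for every orthonormal basis.\<close>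

definition some_onb :: "('a, 'e::euclidean_space) chart set \<Rightarrow> ('a, 'e) metric \<Rightarrow> 'a \<Rightarrow>
    ('a, 'e) tvec set"
  where "some_onb A g p = (SOME E. orthonormal_basis A g p E)"

definition ricci_tensor :: "'a topology \<Rightarrow> ('a, 'e::euclidean_space) chart set \<Rightarrow>
    ('a, 'e) metric \<Rightarrow> ('a, 'e) connection \<Rightarrow> 'a \<Rightarrow> ('a, 'e) tvec \<Rightarrow> ('a, 'e) tvec \<Rightarrow> real"
  where "ricci_tensor M A g D p x y =
    (\<Sum>e\<in>some_onb A g p. riemann_tensor M A g D p x e e y)"

definition scalar_curvature :: "'a topology \<Rightarrow> ('a, 'e::euclidean_space) chart set \<Rightarrow>
    ('a, 'e) metric \<Rightarrow> ('a, 'e) connection \<Rightarrow> 'a \<Rightarrow> real"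
  where "scalar_curvature M A g D p = (\<Sum>e\<in>some_onb A g p. ricci_tensor M A g D p e e)"

text \<open>The operator \<open>\<phi>\<close> at a single point, with metric \<open>g\<close>, complex structure \<open>J\<close> and form \<open>Q\<close>
  on the tangent space.\<close>

definition bochner_phi :: "('v \<Rightarrow> 'v \<Rightarrow> real) \<Rightarrow> ('v \<Rightarrow> 'v) \<Rightarrow> ('v \<Rightarrow> 'v \<Rightarrow> real) \<Rightarrow>
    'v \<Rightarrow> 'v \<Rightarrow> 'v \<Rightarrow> 'v \<Rightarrow> real"
  where "bochner_phi g J Q x y z u =
    g x u * Q y z - g x z * Q y u + g y z * Q x u - g y u * Q x z
    + g x (J u) * Q y (J z) - g x (J z) * Q y (J u) - 2 * g x (J y) * Q z (J u)
    + g y (J z) * Q x (J u) - g y (J u) * Q x (J z) - 2 * g z (J u) * Q x (J y)"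

text \<open>Here \<open>n\<close> is half of the real dimension of the manifold.\<close>

definition bochner_Q :: "nat \<Rightarrow> 'a topology \<Rightarrow> ('a, 'e::euclidean_space) chart set \<Rightarrow>
    ('a, 'e) metric \<Rightarrow> ('a, 'e) connection \<Rightarrow> 'a \<Rightarrow> ('a, 'e) tvec \<Rightarrow> ('a, 'e) tvec \<Rightarrow> real"
  where "bochner_Q n M A g D p x y =
    1 / (2 * (real n + 2)) * ricci_tensor M A g D p x y
    - scalar_curvature M A g D p / (8 * (real n + 1) * (real n + 2)) * g p x y"

definition bochner_tensor :: "nat \<Rightarrow> 'a topology \<Rightarrow> ('a, 'e::euclidean_space) chart set \<Rightarrow>
    ('a, 'e) metric \<Rightarrow> ('a, 'e) endo_field \<Rightarrow> ('a, 'e) connection \<Rightarrow> 'a \<Rightarrow>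
    ('a, 'e) tvec \<Rightarrow> ('a, 'e) tvec \<Rightarrow> ('a, 'e) tvec \<Rightarrow> ('a, 'e) tvec \<Rightarrow> real"
  where "bochner_tensor n M A g J D p x y z u =
    riemann_tensor M A g D p x y z u
    - bochner_phi (g p) (J p) (bochner_Q n M A g D p) x y z u"

end

theory Submission
  imports Defs
begin

text \<open>The proof reduces to linear algebra at a single point. Since \<open>B = 0\<close>, the curvature is
\<open>R = \<phi>(Q)\<close>, and the antisymmetry of \<open>R\<close> in its first two arguments forces \<open>Q\<close> to be
\<open>J\<close>-invariant. Hence every curvature operator \<open>R(x,y)\<close> commutes with \<open>J\<close>. Let \<open>N = \<nabla>J\<close>
and \<open>P = \<nabla>Q\<close>. As \<open>g\<close> is parallel, \<open>\<nabla>R\<close> is an explicit expression in \<open>Q\<close>, \<open>N\<close> and \<open>P\<close>, and the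
second Bianchi identity becomes a linear relation between \<open>N\<close> and \<open>P\<close> with coefficients
depending on \<open>Q\<close>. The claim is that at each point this relation implies \<open>Q = 0\<close> or \<open>N = 0\<close>
(\<open>Q_zero_or_N_zero\<close>). Granting this, \<open>N\<close> is nonzero on a neighbourhood of \<open>p\<close> by continuity, so
\<open>Q\<close>, and with it \<open>R\<close>, vanishes there.

For the pointwise claim, the part of the Bianchi identity that anticommutes with \<open>J\<close> does not
involve \<open>P\<close>: it says that the cyclic sum of the commutators of \<open>R(x,y)\<close> with \<open>N\<^sub>w\<close> over
\<open>x, y, w\<close> is zero (\<open>bianchi_phiN\<close>). Diagonalise \<open>Q\<close> in a unitary basis. Evaluated on basis
vectors this identity splits into small linear systems for the numbers
\<open>T(w,a,b) = g (N w a) b\<close>, whose coefficients are linear in the eigenvalues. At least three complex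
dimensions are available, so each entry is controlled by a third basis vector, and the systems have
only the zero solution except in two cases: all eigenvalues vanish, or exactly one of them, that of
\<open>e\<close> say, is nonzero, and \<open>N\<^sub>w = 0\<close> for all \<open>w\<close> orthogonal to \<open>e\<close> and \<open>J e\<close>. In the second case the full
Bianchi identity, with \<open>P\<close>, first shows that the components of \<open>P\<close> that matter vanish, and then
that \<open>N = 0\<close> (\<open>kernel_rank_one\<close>).

The remaining work is the passage to coordinates. In a chart, vector fields become maps into the
model space and \<open>\<nabla>\<close> becomes the directional derivative plus Christoffel symbols
(\<open>connection_coordinates\<close>). The tensoriality of curvature and its symmetries, including both
Bianchi identities, then follow from the symmetry of the Christoffel symbols and of second
derivatives (\<open>dd_commute\<close>).\<close>

section \<open>Hermitian linear algebra\<close>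

locale hermitian_space =
  fixes g :: "'v::euclidean_space \<Rightarrow> 'v \<Rightarrow> real" and J :: "'v \<Rightarrow> 'v"
  assumes bilinear_g: "bilinear g"
    and g_sym: "g x y = g y x"
    and g_pos: "x \<noteq> 0 \<Longrightarrow> g x x > 0"
    and linear_J: "linear J"
    and JJ [simp]: "J (J x) = - x"
    and g_JJ: "g (J x) (J y) = g x y"
begin

lemmas g_linear [simp] =
  bilinear_ladd[OF bilinear_g] bilinear_radd[OF bilinear_g]
  bilinear_lneg[OF bilinear_g] bilinear_rneg[OF bilinear_g]
  bilinear_lzero[OF bilinear_g] bilinear_rzero[OF bilinear_g]
  bilinear_lsub[OF bilinear_g] bilinear_rsub[OF bilinear_g]
  bilinear_lmul[OF bilinear_g] bilinear_rmul[OF bilinear_g]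

lemmas J_linear [simp] =
  linear_add[OF linear_J] linear_neg[OF linear_J] linear_0[OF linear_J]
  linear_diff[OF linear_J] linear_scale[OF linear_J]

lemma g_J_left: "g (J x) y = - g x (J y)"
  using g_JJ[of x "J y"] by simp

lemma g_J_self [simp]: "g x (J x) = 0"
  using g_J_left[of x x] g_sym[of x "J x"] by simp

lemma g_J_flip: "g x (J y) = - g y (J x)"
  using g_J_left[of x y] g_sym[of "J x" y] by simp

text \<open>Together with its image under \<open>J\<close>, such a set is orthonormal; it is an orthonormal set for the
Hermitian form on the complex vector space defined by \<open>J\<close>.\<close>

definition unitary_frame :: "'v set \<Rightarrow> bool"
  where "unitary_frame E \<longleftrightarrow> (\<forall>e\<in>E. g e e = 1) \<and>
    (\<forall>e\<in>E. \<forall>f\<in>E. e \<noteq> f \<longrightarrow> g e f = 0 \<and> g e (J f) = 0)"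

text \<open>The eigenvector equation of the self-adjoint operator that represents the form \<open>Q\<close>.\<close>

definition eigenvector :: "('v \<Rightarrow> 'v \<Rightarrow> real) \<Rightarrow> 'v \<Rightarrow> real \<Rightarrow> bool"
  where "eigenvector Q e l \<longleftrightarrow> (\<forall>v. Q e v = l * g e v)"

lemma independent_unitary_frame:
  assumes "unitary_frame E"
  shows "independent E"
proof (rule ccontr)
  assume "\<not> independent E"
  then obtain e where e: "e \<in> E" "e \<in> span (E - {e})"
    by (auto simp: dependent_def)
  have "g e v = 0" if "v \<in> span (E - {e})" for v
    using that
    by (induction rule: span_induct_alt)
      (use assms e(1) in \<open>auto simp: unitary_frame_def\<close>)
  with e(2) have "g e e = 0" by simp
  then show False using assms e(1) by (auto simp: unitary_frame_def)
qed

lemma finite_unitary_frame: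
  assumes "unitary_frame E"
  shows "finite E" "card E \<le> DIM('v)"
  using independent_unitary_frame[OF assms] independent_bound by auto

lemma unitary_frame_orthonormal:
  assumes E: "unitary_frame E" and ef: "e \<in> E \<union> J ` E" "f \<in> E \<union> J ` E"
  shows "g e f = (if e = f then 1 else 0)"
proof -
  have delta: "g a b = (if a = b then 1 else 0)" and orth_J: "g a (J b) = 0" if "a \<in> E" "b \<in> E" for a b
    using E that by (cases "a = b"; auto simp: unitary_frame_def)+
  have distinct_J: "a \<noteq> J b" if "a \<in> E" "b \<in> E" for a b
    using delta[OF that(1,1)] orth_J[OF that] by auto
  have inj: "J a = J b \<longleftrightarrow> a = b" for a b
    using JJ[of a] JJ[of b] by (metis neg_equal_iff_equal)
  consider "e \<in> E" "f \<in> E" | b where "e \<in> E" "f = J b" "b \<in> E"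
    | a where "e = J a" "a \<in> E" "f \<in> E" | a b where "e = J a" "a \<in> E" "f = J b" "b \<in> E"
    using ef by blast
  then show ?thesis
  proof cases
    case 1
    then show ?thesis by (rule delta)
  next
    case (2 b)
    then show ?thesis using orth_J[OF 2(1,3)] distinct_J[OF 2(1,3)] by simp
  next
    case (3 a)
    then show ?thesis using orth_J[OF 3(2,3)] distinct_J[OF 3(3,2)] by (auto simp: g_J_left)
  next
    case (4 a b)
    then show ?thesis using delta[OF 4(2,4)] by (simp add: g_JJ inj)
  qed
qed

text \<open>Subtracting from \<open>v\<close> its orthogonal projection to the span leaves \<open>v'\<close>.\<close>

lemma unitary_frame_complement:
  assumes E: "unitary_frame E"
  obtains v' where "v - v' \<in> span (E \<union> J ` E)"
    "\<forall>e\<in>E. g e v' = 0 \<and> g e (J v') = 0"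
proof -
  define w where "w = (\<Sum>e\<in>E. g e v *\<^sub>R e - g e (J v) *\<^sub>R J e)"
  have fin: "finite E" using finite_unitary_frame[OF E] by simp
  have gsum: "g x (sum f E) = (\<Sum>e\<in>E. g x (f e))" for x and f :: "'v \<Rightarrow> 'v"
    using fin by (induction E) auto
  have Jsum: "J (sum f E) = (\<Sum>e\<in>E. J (f e))" for f :: "'v \<Rightarrow> 'v"
    using fin by (induction E) auto
  have orth: "g f e = (if e = f then 1 else 0)" "g f (J e) = 0" if "e \<in> E" "f \<in> E" for e f
    using E that by (cases "e = f"; auto simp: unitary_frame_def)+
  have "g f w = g f v" if "f \<in> E" for f
  proof -
    have "g f w = (\<Sum>e\<in>E. g e v * (if e = f then 1 else 0))"
      unfolding w_def gsum using that orth by (intro sum.cong refl) simp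
    also have "\<dots> = (\<Sum>e\<in>E. if f = e then g f v else 0)"
      by (intro sum.cong) auto
    finally show ?thesis using that fin by simp
  qed
  moreover have "g f (J w) = g f (J v)" if "f \<in> E" for f
  proof -
    have "g f (J w) = (\<Sum>e\<in>E. g e (J v) * (if e = f then 1 else 0))"
      unfolding w_def gsum Jsum using that orth by (intro sum.cong refl) simp
    also have "\<dots> = (\<Sum>e\<in>E. if f = e then g f (J v) else 0)"
      by (intro sum.cong) auto
    finally show ?thesis using that fin by simp
  qed
  moreover have "w \<in> span (E \<union> J ` E)"
    unfolding w_def
    by (intro span_sum span_diff span_scale span_base) auto
  ultimately show thesis
    by (intro that[of "v - w"]) simp_all
qed

lemma continuous_on_bilinear_diag:
  fixes B :: "'v \<Rightarrow> 'v \<Rightarrow> real"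
  assumes "bilinear B"
  shows "continuous_on S (\<lambda>v. B v v)"
  using bilinear_continuous_on_compose[OF continuous_on_id continuous_on_id assms, of S] by simp

text \<open>The first-order condition at a maximum of the Rayleigh quotient on \<open>W\<close> says that the maximiser is an
eigenvector of the restriction of \<open>Q\<close> to \<open>W\<close>.\<close>

lemma eigenvector_in_complement:
  fixes Q :: "'v \<Rightarrow> 'v \<Rightarrow> real"
  assumes Q: "bilinear Q" and Qsym: "\<And>x y. Q x y = Q y x"
    and W: "subspace W" and ne: "x0 \<in> W" "x0 \<noteq> 0"
  obtains v l where "v \<in> W" "g v v = 1" "\<And>h. h \<in> W \<Longrightarrow> Q v h = l * g v h"
proof -
  note Q_linear [simp] =
    bilinear_ladd[OF Q] bilinear_radd[OF Q] bilinear_lzero[OF Q] bilinear_rzero[OF Q]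
    bilinear_lmul[OF Q] bilinear_rmul[OF Q]
  define K where "K = W \<inter> sphere 0 1"
  have gnz: "g v v \<noteq> 0" if "v \<noteq> 0" for v using g_pos[OF that] by simp
  have gnzK: "\<forall>v\<in>K. g v v \<noteq> 0" 
  proof
    fix v assume "v \<in> K"
    then have "v \<noteq> 0" unfolding K_def by (metis IntD2 norm_zero mem_sphere_0 zero_neq_one)
    then show "g v v \<noteq> 0" by (rule gnz)
  qed
  have "compact K"
    unfolding K_def by (intro closed_Int_compact closed_subspace W compact_sphere)
  moreover have "(1 / norm x0) *\<^sub>R x0 \<in> K"
    using ne W by (auto simp: K_def subspace_scale)
  then have "K \<noteq> {}" by blast
  moreover have "continuous_on K (\<lambda>v. Q v v / g v v)"
    by (intro continuous_on_divide continuous_on_bilinear_diag[of Q]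
        continuous_on_bilinear_diag[of g] Q bilinear_g) (simp add: gnzK)
  ultimately obtain v where v: "v \<in> K" and max: "\<And>y. y \<in> K \<Longrightarrow> Q y y / g y y \<le> Q v v / g v v"
    using continuous_attains_sup[of K "\<lambda>v. Q v v / g v v"] by blast
  have vW: "v \<in> W" and v0: "v \<noteq> 0" using v by (auto simp: K_def)
  define l where "l = Q v v / g v v"
  have le: "Q y y \<le> l * g y y" if "y \<in> W" for y
  proof (cases "y = 0")
    case False
    then have "(1 / norm y) *\<^sub>R y \<in> K"
      using that W by (auto simp: K_def subspace_scale)
    from max[OF this] False g_pos[OF False] show ?thesis
      by (simp add: l_def field_simps)
  qed simp
  have eq: "Q v v = l * g v v" using gnz[OF v0] by (simp add: l_def)
  have eig: "Q v h = l * g v h" if h: "h \<in> W" for h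
  proof (rule ccontr)
    \<comment> \<open>If the residue \<open>b\<close> is not zero, moving from \<open>v\<close> a little in the direction \<open>h\<close> increases
      \<open>Q - l g\<close>; the step \<open>b / d\<close> is small enough for the linear term to dominate.\<close>
    define b c where "b = Q v h - l * g v h" and "c = Q h h - l * g h h"
    assume "Q v h \<noteq> l * g v h"
    then have b: "b \<noteq> 0" by (simp add: b_def)
    have ineq: "2 * t * b + t\<^sup>2 * c \<le> 0" for t
    proof -
      have "v + t *\<^sub>R h \<in> W" using vW h W by (intro subspace_add subspace_scale)
      from le[OF this] show ?thesis
        using eq Qsym[of h v] g_sym[of h v]
        by (simp add: b_def c_def algebra_simps power2_eq_square)
    qed
    define d where "d = \<bar>c\<bar> + 1"
    have d: "d > 0" "\<bar>c\<bar> < d" by (auto simp: d_def)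
    have "2 * (b / d) * b + (b / d)\<^sup>2 * c = (b\<^sup>2 / d) * (2 + c / d)"
      using d by (simp add: field_simps power2_eq_square)
    moreover have "2 + c / d > 0" using d by (simp add: field_simps abs_if split: if_splits)
    moreover have "b\<^sup>2 / d > 0" using b d by simp
    ultimately have "2 * (b / d) * b + (b / d)\<^sup>2 * c > 0" by (metis mult_pos_pos)
    then show False using ineq[of "b / d"] by simp
  qed
  define s where "s = 1 / sqrt (g v v)"
  have s: "s * s * g v v = 1" using g_pos[OF v0] by (simp add: s_def field_simps)
  show thesis
    by (rule that[of "s *\<^sub>R v" l]) (use vW W s eig in \<open>auto simp: subspace_scale algebra_simps\<close>)
qed

text \<open>A frame of eigenvectors with the largest possible number of elements spans: otherwise the
orthogonal complement of its span contains a further eigenvector of the restriction of \<open>Q\<close>, which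
is an eigenvector of \<open>Q\<close> since the span is invariant, and which enlarges the frame.\<close>

lemma exists_unitary_eigenbasis:
  fixes Q :: "'v \<Rightarrow> 'v \<Rightarrow> real"
  assumes Q: "bilinear Q" and Qsym: "\<And>x y. Q x y = Q y x" and QJ: "\<And>x y. Q (J x) (J y) = Q x y"
  obtains E where "unitary_frame E" "\<And>e. e \<in> E \<Longrightarrow> \<exists>l. eigenvector Q e l"
    "span (E \<union> J ` E) = UNIV"
proof -
  define P where "P E \<longleftrightarrow> unitary_frame E \<and> (\<forall>e\<in>E. \<exists>l. eigenvector Q e l)" for E
  have "P {}" by (simp add: P_def unitary_frame_def)
  moreover have "\<forall>E. P E \<longrightarrow> card E < Suc DIM('v)"
    using finite_unitary_frame by (auto simp: P_def less_Suc_eq_le)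
  ultimately obtain E where PE: "P E" and maxE: "\<And>F. P F \<Longrightarrow> card F \<le> card E"
    using ex_has_greatest_nat[of P "{}" card "Suc DIM('v)"] by blast
  have E: "unitary_frame E" using PE by (simp add: P_def)
  have fin: "finite E" using finite_unitary_frame[OF E] by simp
  have "v \<in> span (E \<union> J ` E)" for v
  proof (rule ccontr)
    assume v: "v \<notin> span (E \<union> J ` E)"
    define W where "W = {v. \<forall>e\<in>E. g e v = 0 \<and> g e (J v) = 0}"
    have W: "subspace W" by (auto simp: subspace_def W_def)
    obtain v' where v': "v - v' \<in> span (E \<union> J ` E)" "v' \<in> W"
      by (rule unitary_frame_complement[OF E, of v]) (simp add: W_def)
    have "v' \<noteq> 0" using v v'(1) by auto
    obtain u l where u: "u \<in> W" "g u u = 1" "\<And>h. h \<in> W \<Longrightarrow> Q u h = l * g u h"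
      by (rule eigenvector_in_complement[OF Q Qsym W v'(2) \<open>v' \<noteq> 0\<close>]) blast
    have Qu: "Q u h = l * g u h" if "h \<in> span (E \<union> J ` E)" for h
      using that
    proof (induction rule: span_induct_alt)
      case base
      then show ?case by (simp add: bilinear_rzero[OF Q])
    next
      case (step c x y)
      have "Q u x = 0 \<and> g u x = 0"
      proof (cases "x \<in> E")
        case True
        then obtain m where "eigenvector Q x m" using PE by (auto simp: P_def)
        then show ?thesis using True u(1) Qsym[of u x] g_sym[of u x]
          by (auto simp: eigenvector_def W_def)
      next
        case False
        then obtain e where e: "e \<in> E" "x = J e" using step by auto
        then obtain m where m: "eigenvector Q e m" using PE by (auto simp: P_def)
        have "Q u x = - Q e (J u)" using QJ[of "J u" e] Qsym[of "J u" e] e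
          by (simp add: bilinear_lneg[OF Q])
        moreover have "g u x = - g e (J u)" using e g_J_flip[of u e] by simp
        ultimately show ?thesis using m e u(1) by (auto simp: eigenvector_def W_def)
      qed
      then show ?case using step by (simp add: bilinear_radd[OF Q] bilinear_rmul[OF Q])
    qed
    have "eigenvector Q u l"
      unfolding eigenvector_def
    proof
      fix h
      obtain h' where h': "h - h' \<in> span (E \<union> J ` E)" "h' \<in> W"
        by (rule unitary_frame_complement[OF E, of h]) (simp add: W_def)
      show "Q u h = l * g u h"
        using Qu[OF h'(1)] u(3)[OF h'(2)] by (simp add: bilinear_rsub[OF Q] algebra_simps)
    qed
    moreover have "unitary_frame (insert u E)"
    proof -
      have "g u e = 0 \<and> g e u = 0 \<and> g e (J u) = 0 \<and> g u (J e) = 0" if "e \<in> E" for e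
        using that u(1) g_sym[of u e] g_J_flip[of u e] by (auto simp: W_def)
      then show ?thesis using E u(2) by (auto simp: unitary_frame_def)
    qed
    ultimately have "P (insert u E)" using PE by (auto simp: P_def)
    moreover have "u \<notin> E" using u by (auto simp: W_def)
    ultimately show False using maxE[of "insert u E"] fin by simp
  qed
  then show thesis using that[of E] PE by (auto simp: P_def)
qed

end

section \<open>The differentiated Bianchi identity at one point\<close>

text \<open>The part of the derivative of \<open>bochner_phi g J Q\<close> in which \<open>J\<close> is differentiated, with derivative
\<open>N\<close>.\<close>

definition phi_dot :: "('v \<Rightarrow> 'v \<Rightarrow> real) \<Rightarrow> ('v \<Rightarrow> 'v) \<Rightarrow> ('v \<Rightarrow> 'v) \<Rightarrow> ('v \<Rightarrow> 'v \<Rightarrow> real) \<Rightarrow>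
    'v \<Rightarrow> 'v \<Rightarrow> 'v \<Rightarrow> 'v \<Rightarrow> real"
  where "phi_dot g J N Q x y z u =
    g x (N u) * Q y (J z) + g x (J u) * Q y (N z)
    - g x (N z) * Q y (J u) - g x (J z) * Q y (N u)
    - 2 * g x (N y) * Q z (J u) - 2 * g x (J y) * Q z (N u)
    + g y (N z) * Q x (J u) + g y (J z) * Q x (N u)
    - g y (N u) * Q x (J z) - g y (J u) * Q x (N z)
    - 2 * g z (N u) * Q x (J y) - 2 * g z (J u) * Q x (N y)"

text \<open>The covariant derivative of \<open>bochner_phi g J Q\<close> along \<open>w\<close> when \<open>g\<close> is parallel, \<open>\<nabla>J = N\<close> and
\<open>\<nabla>Q = P\<close>.\<close>

definition nabla_phi :: "('v \<Rightarrow> 'v \<Rightarrow> real) \<Rightarrow> ('v \<Rightarrow> 'v) \<Rightarrow> ('v \<Rightarrow> 'v \<Rightarrow> real) \<Rightarrow>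
    ('v \<Rightarrow> 'v \<Rightarrow> 'v) \<Rightarrow> ('v \<Rightarrow> 'v \<Rightarrow> 'v \<Rightarrow> real) \<Rightarrow> 'v \<Rightarrow> 'v \<Rightarrow> 'v \<Rightarrow> 'v \<Rightarrow> 'v \<Rightarrow> real"
  where "nabla_phi g J Q N P w x y z u =
    bochner_phi g J (P w) x y z u + phi_dot g J (N w) Q x y z u"

text \<open>The first-order data at one point of a manifold with \<open>R = \<phi>(Q)\<close>: \<open>N\<close> and \<open>P\<close> stand for \<open>\<nabla>J\<close> and
\<open>\<nabla>Q\<close>. The assumptions on them are the derivatives of \<open>g (J x) y = - g x (J y)\<close>, of
\<open>J (J x) = - x\<close> and of the symmetry and \<open>J\<close>-invariance of \<open>Q\<close>; the last assumption is the second
Bianchi identity.\<close>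

locale bochner_jet = hermitian_space g J
  for g :: "'v::euclidean_space \<Rightarrow> 'v \<Rightarrow> real" and J :: "'v \<Rightarrow> 'v" +
  fixes Q :: "'v \<Rightarrow> 'v \<Rightarrow> real" and N :: "'v \<Rightarrow> 'v \<Rightarrow> 'v" and P :: "'v \<Rightarrow> 'v \<Rightarrow> 'v \<Rightarrow> real"
  assumes bilinear_Q: "bilinear Q"
    and Q_sym: "Q x y = Q y x"
    and Q_JJ: "Q (J x) (J y) = Q x y"
    and bilinear_N: "bilinear N"
    and N_skew: "g (N w x) y = - g (N w y) x"
    and N_J: "N w (J x) = - J (N w x)"
    and bilinear_P: "bilinear (P w)"
    and P_neg: "P (- w) x y = - P w x y"
    and P_sym: "P w x y = P w y x"
    and P_JJ: "P w (J x) (J y) + Q (N w x) (J y) + Q (J x) (N w y) = P w x y"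
    and bianchi: "nabla_phi g J Q N P w x y z u + nabla_phi g J Q N P x y w z u
      + nabla_phi g J Q N P y w x z u = 0"
begin

lemmas Q_linear [simp] =
  bilinear_ladd[OF bilinear_Q] bilinear_radd[OF bilinear_Q]
  bilinear_lneg[OF bilinear_Q] bilinear_rneg[OF bilinear_Q]
  bilinear_lzero[OF bilinear_Q] bilinear_rzero[OF bilinear_Q]
  bilinear_lsub[OF bilinear_Q] bilinear_rsub[OF bilinear_Q]
  bilinear_lmul[OF bilinear_Q] bilinear_rmul[OF bilinear_Q]

lemmas N_linear [simp] =
  bilinear_ladd[OF bilinear_N] bilinear_radd[OF bilinear_N]
  bilinear_lneg[OF bilinear_N] bilinear_rneg[OF bilinear_N]
  bilinear_lzero[OF bilinear_N] bilinear_rzero[OF bilinear_N]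
  bilinear_lmul[OF bilinear_N] bilinear_rmul[OF bilinear_N]

lemmas P_linear [simp] =
  bilinear_lneg[OF bilinear_P] bilinear_rneg[OF bilinear_P]
  bilinear_lzero[OF bilinear_P] bilinear_rzero[OF bilinear_P]

lemma Q_J_left: "Q (J x) y = - Q x (J y)"
  using Q_JJ[of x "J y"] by simp

lemma P_J_left: "P w (J x) y = - P w x (J y) - Q (N w x) y - Q x (N w y)"
  using P_JJ[of w x "J y"] by (simp add: N_J Q_J_left)

lemma g_N_right: "g a (N w b) = - g (N w a) b"
  using N_skew[of w b a] by (simp add: g_sym[of a])

lemma g_J_N_right: "g a (J (N w b)) = g (N w a) (J b)"
  using g_J_left[of a "N w b"] by (simp add: g_N_right N_J g_J_left)

lemma g_N_self [simp]: "g (N w a) a = 0" "g (N w a) (J a) = 0"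
  using N_skew[of w a a] g_J_N_right[of a w a] g_J_left[of "N w a" a] g_sym[of "J (N w a)" a]
  by simp_all

lemma N_skew_J: "g (N w a) (J b) = - g (N w b) (J a)"
  using N_skew[of w a "J b"] by (simp add: N_J g_J_left)

text \<open>This identity says that the curvature operators commute with \<open>J\<close>.\<close>

lemma phi_JJ: "bochner_phi g J Q x y (J z) (J u) = bochner_phi g J Q x y z u"
  by (simp add: bochner_phi_def g_J_left Q_J_left algebra_simps)

text \<open>The derivative of \<open>phi_JJ\<close>.\<close>

lemma nabla_phi_JJ:
  "nabla_phi g J Q N P w x y (J z) (J u) + bochner_phi g J Q x y (N w z) (J u)
     + bochner_phi g J Q x y (J z) (N w u) = nabla_phi g J Q N P w x y z u"
  by (simp add: nabla_phi_def phi_dot_def bochner_phi_def g_J_left Q_J_left P_J_left N_J g_N_right g_J_N_right algebra_simps)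

text \<open>As \<open>N w\<close> is skew, this is the value \<open>g ([R(x,y), N w] z) u\<close> of a commutator.\<close>

definition phiN :: "'v \<Rightarrow> 'v \<Rightarrow> 'v \<Rightarrow> 'v \<Rightarrow> 'v \<Rightarrow> real"
  where "phiN w x y z u = bochner_phi g J Q x y (N w z) u + bochner_phi g J Q x y z (N w u)"

text \<open>The failure of \<open>\<nabla>R\<close> to commute with \<open>J\<close> is a commutator of \<open>R\<close> with \<open>\<nabla>J\<close>. Taking cyclic sums
removes \<open>\<nabla>R\<close>, and with it the unknown \<open>P\<close>.\<close>

lemma bianchi_phiN: "phiN w x y z u + phiN x y w z u + phiN y w x z u = 0"
proof -
  have phi_minus: "bochner_phi g J Q x y (- a) b = - bochner_phi g J Q x y a b" for x y a b
    by (simp add: bochner_phi_def algebra_simps)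
  have *: "phiN w x y z u = nabla_phi g J Q N P w x y (J (J z)) (J u) - nabla_phi g J Q N P w x y (J z) u"
    for w x y
    using nabla_phi_JJ[of w x y "J z" u] phi_JJ[of x y "N w z" u]
    by (simp add: phiN_def N_J phi_minus)
  show ?thesis unfolding * using bianchi[of w x y "J z" u] bianchi[of w x y "J (J z)" "J u"]
    by linarith
qed

definition J_orthogonal :: "'v \<Rightarrow> 'v \<Rightarrow> bool"
  where "J_orthogonal x y \<longleftrightarrow> g x y = 0 \<and> g x (J y) = 0"

lemma J_orthogonal_sym: "J_orthogonal x y \<Longrightarrow> J_orthogonal y x"
  using g_sym[of x y] g_J_flip[of x y] by (simp add: J_orthogonal_def)

lemma J_orthogonal_J: "J_orthogonal x y \<Longrightarrow> J_orthogonal (J x) y"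
  by (simp add: J_orthogonal_def g_J_left)

lemma J_orthogonal_J_iff [simp]:
  "J_orthogonal (J x) y \<longleftrightarrow> J_orthogonal x y" "J_orthogonal x (J y) \<longleftrightarrow> J_orthogonal x y"
  by (auto simp: J_orthogonal_def g_J_left)

definition unit_eigenvector :: "'v \<Rightarrow> real \<Rightarrow> bool"
  where "unit_eigenvector x l \<longleftrightarrow> g x x = 1 \<and> eigenvector Q x l"

lemma unit_eigenvector_J: "unit_eigenvector x l \<Longrightarrow> unit_eigenvector (J x) l"
  by (auto simp: unit_eigenvector_def eigenvector_def g_J_left Q_J_left)

lemma unit_eigenvectorD:
  assumes "unit_eigenvector x l"
  shows "g x x = 1" "Q x v = l * g x v" "Q v x = l * g x v" "Q v (J x) = - l * g x (J v)"
  using assms Q_sym[of v x] Q_J_left[of x v] Q_sym[of v "J x"]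
  by (auto simp: unit_eigenvector_def eigenvector_def)

lemma J_orthogonalD:
  assumes "J_orthogonal x y"
  shows "g x y = 0" "g x (J y) = 0" "g y x = 0" "g y (J x) = 0"
  using assms J_orthogonal_sym[OF assms] by (auto simp: J_orthogonal_def)

lemmas expand = phiN_def bochner_phi_def g_J_left Q_J_left N_J g_N_right g_J_N_right
  minus_minus mult_zero_left mult_zero_right mult_1_left mult_1_right
  mult_minus_left mult_minus_right JJ J_linear g_linear N_linear Q_linear g_N_self g_J_self

text \<open>For eigenvectors \<open>x\<close>, \<open>w\<close>, \<open>u\<close> with eigenvalues \<open>l\<close>, \<open>m\<close>, \<open>k\<close> in different complex lines most terms
of \<open>bianchi_phiN\<close> vanish, and each choice of arguments leaves one linear equation for values of
\<open>T(w,a,b) = g (N w a) b\<close>. Since \<open>J x\<close> is an eigenvector in the same line as \<open>x\<close>, each equation may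
also be used with some of the vectors replaced by their images under \<open>J\<close>.\<close>

context
  fixes x w u l m k
  assumes x: "unit_eigenvector x l" and w: "unit_eigenvector w m" and u: "unit_eigenvector u k"
    and xw: "J_orthogonal x w" and xu: "J_orthogonal x u" and wu: "J_orthogonal w u"
begin

lemmas xwu = unit_eigenvectorD[OF x] unit_eigenvectorD[OF w] unit_eigenvectorD[OF u]
  J_orthogonalD[OF xw] J_orthogonalD[OF xu] J_orthogonalD[OF wu]

lemma kernel_aab: "(5 * l + m) * g (N w x) w = 0"
  using bianchi_phiN[of w x "J x" x "J w"] 
  by (simp only: expand xwu N_skew[of _ w x] N_skew_J[of _ w x] ) algebra

lemma kernel_exchange: "(m + k) * g (N x x) u + (k + l) * g (N w w) u = 0"
  using bianchi_phiN[of u x w x w] 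
  by (simp only: expand xwu N_skew[of _ u x] N_skew_J[of _ u x] N_skew[of _ u w] N_skew_J[of _ u w]
      N_skew[of _ w x] N_skew_J[of _ w x] ) algebra

lemma kernel_trace:
  "2 * (m + k + 2 * l) * g (N w w) u = (l + m) * (g (N x x) u + g (N (J x) (J x)) u)"
  using bianchi_phiN[of w x "J x" "J w" u] 
  by (simp only: expand xwu N_skew[of _ u x] N_skew_J[of _ u x] N_skew[of _ u w] N_skew_J[of _ u w]
      N_skew[of _ w x] N_skew_J[of _ w x] ) algebra

lemma kernel_mixed:
  "(10 * l + 2 * k) * g (N w x) (J u) = (l + m) * (g (N x w) (J u) + g (N (J x) w) u)"
  using bianchi_phiN[of w x "J x" x u] 
  by (simp only: expand xwu N_skew[of _ u x] N_skew_J[of _ u x] N_skew[of _ u w] N_skew_J[of _ u w]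
      N_skew[of _ w x] N_skew_J[of _ w x] ) algebra

lemma kernel_fourth:
  assumes z: "unit_eigenvector z j" and "J_orthogonal x z" "J_orthogonal w z" "J_orthogonal u z"
  shows "(j + k + 2 * l) * g (N w z) u = 0"
  using bianchi_phiN[of w x "J x" "J z" u] 
  by (simp only: expand xwu unit_eigenvectorD[OF z] assms(2-4)[THEN J_orthogonalD(1)]
     assms(2-4)[THEN J_orthogonalD(2)] assms(2-4)[THEN J_orthogonalD(3)] assms(2-4)[THEN J_orthogonalD(4)]
     N_skew[of _ u z] N_skew_J[of _ u z] ) algebra

end

text \<open>A nonzero entry of \<open>N\<close> with two arguments in the same line forces \<open>m = - 5 * k\<close>; the entry of the
third line with the same last argument then obeys two incompatible equations unless the
eigenvalues vanish.\<close>

lemma kernel_aab_zero: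
  assumes x: "unit_eigenvector x l" and w: "unit_eigenvector w m" and u: "unit_eigenvector u k"
    and xw: "J_orthogonal x w" and xu: "J_orthogonal x u" and wu: "J_orthogonal w u"
    and nz: "g (N w w) u \<noteq> 0"
  shows "l = 0 \<and> m = 0 \<and> k = 0"
proof -
  define a s s' where "a = g (N w w) u" and "s = g (N x x) u" and "s' = g (N (J x) (J x)) u"
  note sym = J_orthogonal_sym
  have a: "a \<noteq> 0" using nz by (simp add: a_def)
  have "(5 * k + m) * a = 0"
    using kernel_aab[OF u w x] sym xw xu wu N_skew[of w u w] by (simp add: a_def)
  then have m: "m = - 5 * k" using a by simp
  have s: "(5 * k + l) * s = 0"
    using kernel_aab[OF u x w] sym xw xu wu N_skew[of x u x] by (simp add: s_def)
  have e1: "(m + k) * s + (k + l) * a = 0"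
    using kernel_exchange[OF x w u xw xu wu] by (simp add: a_def s_def)
  have e2: "(m + k) * s' + (k + l) * a = 0"
    using kernel_exchange[OF unit_eigenvector_J[OF x] w u _ _ wu] J_orthogonal_J xw xu
    by (simp add: a_def s'_def)
  have e3: "2 * (m + k + 2 * l) * a = (l + m) * (s + s')"
    using kernel_trace[OF x w u xw xu wu] by (simp add: a_def s_def s'_def)
  have k0: "k = 0"
  proof (rule ccontr)
    assume k: "k \<noteq> 0"
    have "(m + k) * s = (m + k) * s'" using e1 e2 by linarith
    then have ss: "s' = s" using m k by simp
    show False
    proof (cases "s = 0")
      case True
      then have "l = - k" using e1 a by simp
      then have "k * a = 0" using e3 True ss m by algebra
      then show False using k a by simp
    next
      case False
      then have l: "l = - 5 * k" using s by simp
      then have "k * (s + a) = 0" using e1 m by algebra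
      then have "s = - a" using k by simp
      then have "k * a = 0" using e3 ss l m by algebra
      then show False using k a by simp
    qed
  qed
  with m have m0: "m = 0" by simp
  with k0 e1 a have "l = 0" by simp
  with k0 m0 show ?thesis by simp
qed

text \<open>For three different lines, \<open>T(w,x,J u)\<close> and \<open>T(J w,x,u)\<close> satisfy \<open>kernel_mixed\<close> with the same right
hand side. Their difference therefore decouples, while their sum is tied to the sums in which the
three lines are permuted.\<close>

lemma kernel_mixed_split:
  assumes x: "unit_eigenvector x l" and w: "unit_eigenvector w m" and u: "unit_eigenvector u k"
    and xw: "J_orthogonal x w" and xu: "J_orthogonal x u" and wu: "J_orthogonal w u"
  shows "(5 * l + k) * (g (N w x) (J u) - g (N (J w) x) u) = 0"
    and "(5 * l + k) * (g (N w x) (J u) + g (N (J w) x) u)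
      = (l + m) * (g (N x w) (J u) + g (N (J x) w) u)"
proof -
  note o = J_orthogonal_sym J_orthogonal_J
  have 1: "(10 * l + 2 * k) * g (N w x) (J u) = (l + m) * (g (N x w) (J u) + g (N (J x) w) u)"
    by (rule kernel_mixed[OF assms])
  have xw': "J_orthogonal x (J w)" and xu': "J_orthogonal x (J u)" and wu': "J_orthogonal (J w) (J u)"
    using o xw xu wu by blast+
  have 2: "(10 * l + 2 * k) * g (N (J w) x) u = (l + m) * (g (N x w) (J u) + g (N (J x) w) u)"
    using kernel_mixed[OF x unit_eigenvector_J[OF w] unit_eigenvector_J[OF u] xw' xu' wu']
    by (simp add: N_J g_J_left) (simp add: algebra_simps)
  show "(5 * l + k) * (g (N w x) (J u) - g (N (J w) x) u) = 0"
    and "(5 * l + k) * (g (N w x) (J u) + g (N (J w) x) u)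
      = (l + m) * (g (N x w) (J u) + g (N (J x) w) u)"
    using 1 2 by algebra+
qed

end

text \<open>If one unknown vanishes, the relations determine the ratios of the eigenvalues and then contradict
each other. If none does, multiplying the relations in pairs eliminates the unknowns and leaves
three quadratic equations for the eigenvalues; their differences factor into linear forms.\<close>

lemma six_relations:
  fixes l m k a b c :: real
  assumes r: "(5 * l + k) * b = - (l + m) * a" "(5 * l + m) * c = - (l + k) * a"
    "(5 * m + k) * a = - (l + m) * b" "(5 * m + l) * c = - (m + k) * b"
    "(5 * k + m) * a = - (l + k) * c" "(5 * k + l) * b = - (m + k) * c"
    and a: "a \<noteq> 0"
  shows "l = 0 \<and> m = 0 \<and> k = 0"
proof -
  consider "b = 0" | "c = 0" | "b \<noteq> 0" "c \<noteq> 0" by blast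
  then show ?thesis
  proof cases
    case 1
    then have l: "l = - m" and k: "k = - 5 * m" using r(1,3) a by auto
    show ?thesis
    proof (cases "m = 0")
      case False
      then have "c = 0" using r(4) 1 l by simp
      then show ?thesis using r(5) a k False by simp
    qed (use l k in auto)
  next
    case 2
    then have l: "l = - k" and m: "m = - 5 * k" using r(2,5) a by auto
    show ?thesis
    proof (cases "k = 0")
      case False
      then have "b = 0" using r(6) 2 l by simp
      then show ?thesis using r(3) a m False by simp
    qed (use l m in auto)
  next
    case 3
    have "((5 * l + k) * (5 * m + k) - (l + m)\<^sup>2) * (a * b) = 0"
      "((5 * l + m) * (5 * k + m) - (l + k)\<^sup>2) * (a * c) = 0"
      "((5 * m + l) * (5 * k + l) - (m + k)\<^sup>2) * (b * c) = 0"
      using r by algebra+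
    then have p: "(5 * l + k) * (5 * m + k) = (l + m)\<^sup>2" "(5 * l + m) * (5 * k + m) = (l + k)\<^sup>2"
      "(5 * m + l) * (5 * k + l) = (m + k)\<^sup>2"
      using a 3 by auto
    have d: "(m - k) * (9 * l - m - k) = 0" "(l - k) * (9 * m - l - k) = 0"
      using p by algebra+
    consider "m = k" "l = k" | "m = k" "l = 8 * k" | "l = k" "m = 8 * k" | "l = m" "k = 8 * m"
      using d by fastforce
    then show ?thesis
    proof cases
      case 1
      then show ?thesis using p(1) by (simp add: power2_eq_square)
    next
      case 2
      then show ?thesis using p(1) by (simp add: power2_eq_square)
    next
      case 3
      then show ?thesis using p(2) by (simp add: power2_eq_square)
    next
      case 4
      then show ?thesis using p(2) by (simp add: power2_eq_square)
    qed
  qed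
qed

context bochner_jet
begin

text \<open>The six permutations of the three lines give exactly the six relations above.\<close>

lemma kernel_mixed_sum_zero:
  assumes x: "unit_eigenvector x l" and w: "unit_eigenvector w m" and u: "unit_eigenvector u k"
    and xw: "J_orthogonal x w" and xu: "J_orthogonal x u" and wu: "J_orthogonal w u"
    and nz: "g (N x w) (J u) + g (N (J x) w) u \<noteq> 0"
  shows "l = 0 \<and> m = 0 \<and> k = 0"
proof (rule six_relations[where a = "g (N x w) (J u) + g (N (J x) w) u"
      and b = "g (N w u) (J x) + g (N (J w) u) x" and c = "g (N u x) (J w) + g (N (J u) x) w"])
  have flip: "g (N v y) (J z) + g (N (J v) y) z = - (g (N v z) (J y) + g (N (J v) z) y)" for v y z
    using N_skew_J[of v y z] N_skew[of "J v" y z] by simp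
  note sym = J_orthogonal_sym
  note k1 = kernel_mixed_split(2)[OF x w u xw xu wu] and k2 = kernel_mixed_split(2)[OF x u w xu xw sym[OF wu]]
    and k3 = kernel_mixed_split(2)[OF w x u sym[OF xw] wu xu]
    and k4 = kernel_mixed_split(2)[OF w u x wu sym[OF xw] sym[OF xu]]
    and k5 = kernel_mixed_split(2)[OF u x w sym[OF xu] sym[OF wu] xw]
    and k6 = kernel_mixed_split(2)[OF u w x sym[OF wu] sym[OF xu] sym[OF xw]]
  show "(5 * l + k) * (g (N w u) (J x) + g (N (J w) u) x) = - (l + m) * (g (N x w) (J u) + g (N (J x) w) u)"
    using k1 flip[of w x u] by algebra
  show "(5 * l + m) * (g (N u x) (J w) + g (N (J u) x) w) = - (l + k) * (g (N x w) (J u) + g (N (J x) w) u)"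
    using k2 flip[of x w u] by algebra
  show "(5 * m + k) * (g (N x w) (J u) + g (N (J x) w) u) = - (l + m) * (g (N w u) (J x) + g (N (J w) u) x)"
    using k3 flip[of w x u] by algebra
  show "(5 * m + l) * (g (N u x) (J w) + g (N (J u) x) w) = - (m + k) * (g (N w u) (J x) + g (N (J w) u) x)"
    using k4 flip[of u x w] by algebra
  show "(5 * k + m) * (g (N x w) (J u) + g (N (J x) w) u) = - (l + k) * (g (N u x) (J w) + g (N (J u) x) w)"
    using k5 flip[of x w u] by algebra
  show "(5 * k + l) * (g (N w u) (J x) + g (N (J w) u) x) = - (m + k) * (g (N u x) (J w) + g (N (J u) x) w)"
    using k6 flip[of u x w] by algebra
qed (use nz in simp)

text \<open>The sum of \<open>T(w,x,J u)\<close> and \<open>T(J w,x,u)\<close> is governed by \<open>kernel_mixed_sum_zero\<close>. If it is zero, the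
difference is not, so \<open>5 * l + k = 0\<close>, and by symmetry \<open>5 * k + l = 0\<close>.\<close>

lemma kernel_distinct:
  assumes x: "unit_eigenvector x l" and w: "unit_eigenvector w m" and u: "unit_eigenvector u k"
    and xw: "J_orthogonal x w" and xu: "J_orthogonal x u" and wu: "J_orthogonal w u"
    and nz: "g (N w x) (J u) \<noteq> 0"
  shows "l = 0 \<and> k = 0"
proof (cases "g (N w x) (J u) + g (N (J w) x) u = 0")
  case True
  note sym = J_orthogonal_sym
  from True nz have d: "g (N w x) (J u) - g (N (J w) x) u \<noteq> 0" by simp
  with kernel_mixed_split(1)[OF x w u xw xu wu] have 1: "5 * l + k = 0" by simp
  have "(5 * k + l) * (g (N w x) (J u) - g (N (J w) x) u) = 0"
    using kernel_mixed_split(1)[OF u w x sym[OF wu] sym[OF xu] sym[OF xw]]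
      N_skew_J[of w x u] N_skew[of "J w" x u] by algebra
  with d have "5 * k + l = 0" by simp
  with 1 show ?thesis by linarith
next
  case False
  then show ?thesis
    using kernel_mixed_sum_zero[OF w x u J_orthogonal_sym[OF xw] wu xu] by blast
qed

text \<open>It remains to treat a form \<open>Q\<close> of complex rank one, for which \<open>bianchi_phiN\<close> has nontrivial
solutions. Here \<open>e\<close> spans the only line with a nonzero eigenvalue, and \<open>N\<close> vanishes in the directions
of the kernel of \<open>Q\<close>. The full Bianchi identity is needed.\<close>

context
  fixes e x w l
  assumes e: "unit_eigenvector e l" and x: "unit_eigenvector x 0" and w: "unit_eigenvector w 0"
    and ex: "J_orthogonal e x" and ew: "J_orthogonal e w" and xw: "J_orthogonal x w"
    and Nx: "N x = (\<lambda>_. 0)" "N (J x) = (\<lambda>_. 0)" and Nw: "N w = (\<lambda>_. 0)" "N (J w) = (\<lambda>_. 0)"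
begin

lemmas exw = unit_eigenvectorD[OF e] unit_eigenvectorD[OF x] unit_eigenvectorD[OF w]
  J_orthogonalD[OF ex] J_orthogonalD[OF ew] J_orthogonalD[OF xw] Nx Nw

lemma P_J_kernel:
  "P x (J a) b = - P x a (J b)" "P w (J a) b = - P w a (J b)"
  "P (J x) (J a) b = - P (J x) a (J b)" "P (J w) (J a) b = - P (J w) a (J b)"
  by (simp_all add: P_J_left Nx Nw)

lemma P_J_swap:
  "P x e (J a) = - P x a (J e)" "P w e (J a) = - P w a (J e)"
  "P (J x) e (J a) = - P (J x) a (J e)" "P (J w) e (J a) = - P (J w) a (J e)"
  using P_sym[of _ e "J a"] by (simp_all add: P_J_kernel)

lemma P_offdiagonal_aux: "4 * P w x (J e) = P x w (J e) - P (J x) w e"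
  using bianchi[of w x "J x" e x]
  by (simp only: nabla_phi_def phi_dot_def exw expand P_linear P_J_kernel P_J_swap P_sym[of _ e x]
    P_sym[of _ e w])

end

text \<open>The relation \<open>P_offdiagonal_aux\<close> and its three variants, obtained by exchanging \<open>x\<close> and \<open>w\<close> and by
applying \<open>J\<close> to both, form a regular linear system for the off-diagonal entries of \<open>P\<close>.\<close>

lemma P_offdiagonal:
  assumes e: "unit_eigenvector e l" and x: "unit_eigenvector x 0" and w: "unit_eigenvector w 0"
    and ex: "J_orthogonal e x" and ew: "J_orthogonal e w" and xw: "J_orthogonal x w"
    and Nx: "N x = (\<lambda>_. 0)" "N (J x) = (\<lambda>_. 0)" and Nw: "N w = (\<lambda>_. 0)" "N (J w) = (\<lambda>_. 0)"
  shows "P w x (J e) = 0" "P w x e = 0"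
proof -
  have main: "P b a (J e) = 0 \<and> P (J b) a e = 0"
    if a: "unit_eigenvector a 0" and b: "unit_eigenvector b 0"
      and ea: "J_orthogonal e a" and eb: "J_orthogonal e b" and ab: "J_orthogonal a b"
      and Na: "N a = (\<lambda>_. 0)" "N (J a) = (\<lambda>_. 0)" and Nb: "N b = (\<lambda>_. 0)" "N (J b) = (\<lambda>_. 0)"
    for a b
  proof -
    have Na': "N (J (J a)) = (\<lambda>_. 0)" and Nb': "N (J (J b)) = (\<lambda>_. 0)" using Na Nb by (simp_all add: fun_eq_iff)
    have ea': "J_orthogonal e (J a)" and eb': "J_orthogonal e (J b)" and ab': "J_orthogonal (J a) (J b)"
      using ea eb ab by simp_all
    have ba: "J_orthogonal b a" and ba': "J_orthogonal (J b) (J a)"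
      using J_orthogonal_sym[OF ab] by simp_all
    have N0: "N a v = 0" "N b v = 0" "N (J a) v = 0" "N (J b) v = 0" for v
      by (simp_all add: Na Nb)
    have "4 * P b a (J e) = P a b (J e) - P (J a) b e"
      by (rule P_offdiagonal_aux[OF e a b ea eb ab Na Nb])
    moreover have "4 * P a b (J e) = P b a (J e) - P (J b) a e"
      by (rule P_offdiagonal_aux[OF e b a eb ea ba Nb Na])
    moreover have "4 * P (J b) a e = P (J a) b e - P a b (J e)"
      using P_offdiagonal_aux[OF e unit_eigenvector_J[OF a] unit_eigenvector_J[OF b] ea' eb' ab'
          Na(2) Na' Nb(2) Nb']
      by (simp only: P_J_left N_linear N0 P_neg JJ P_linear Q_linear minus_minus diff_0_right minus_diff_minus)
    moreover have "4 * P (J a) b e = P (J b) a e - P b a (J e)"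
      using P_offdiagonal_aux[OF e unit_eigenvector_J[OF b] unit_eigenvector_J[OF a] eb' ea' ba'
          Nb(2) Nb' Na(2) Na']
      by (simp only: P_J_left N_linear N0 P_neg JJ P_linear Q_linear minus_minus diff_0_right minus_diff_minus)
    ultimately show ?thesis by linarith
  qed
  show "P w x (J e) = 0" using main[OF x w ex ew xw Nx Nw] by simp
  have ew': "J_orthogonal e (J w)" and xw': "J_orthogonal x (J w)" using ew xw by simp_all
  have Nw': "N (J (J w)) = (\<lambda>_. 0)" using Nw by (simp add: fun_eq_iff)
  have "P (J (J w)) x e = 0"
    using main[OF x unit_eigenvector_J[OF w] ex ew' xw' Nx Nw(2) Nw'] by blast
  then show "P w x e = 0" by (simp add: P_neg)
qed

text \<open>The Bianchi identity in the directions \<open>e\<close>, \<open>x\<close>, \<open>w\<close> is used twice: its values on the pair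
\<open>(w, J w)\<close> kill the remaining component of \<open>P\<close>, and its values on \<open>(e, J e)\<close> then contain only the
entry of \<open>N\<close>.\<close>

lemma kernel_rank_one:
  assumes e: "unit_eigenvector e l" and x: "unit_eigenvector x 0" and w: "unit_eigenvector w 0"
    and ex: "J_orthogonal e x" and ew: "J_orthogonal e w" and xw: "J_orthogonal x w"
    and Nx: "N x = (\<lambda>_. 0)" "N (J x) = (\<lambda>_. 0)" and Nw: "N w = (\<lambda>_. 0)" "N (J w) = (\<lambda>_. 0)"
  shows "l * g (N e x) w = 0"
proof -
  have ker: "Q x v = 0" "Q v x = 0" "Q w v = 0" "Q v w = 0" for v
    using unit_eigenvectorD[OF x] unit_eigenvectorD[OF w] by simp_all
  have wx: "J_orthogonal w x" using J_orthogonal_sym[OF xw] .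
  note off = P_offdiagonal[OF e x w ex ew xw Nx Nw] P_offdiagonal[OF e w x ew ex wx Nw Nx]
  note kern = P_J_kernel[OF e x w ex ew xw Nx Nw] P_J_swap[OF e x w ex ew xw Nx Nw, of x]
    P_J_swap[OF e x w ex ew xw Nx Nw, of w]
  have Pe: "P e (J x) v = - P e x (J v) - Q (N e x) v" "P e (J w) v = - P e w (J v) - Q (N e w) v" for v
    using P_J_left[of e x v] P_J_left[of e w v] by (simp_all add: ker)
  note facts = unit_eigenvectorD[OF e] unit_eigenvectorD[OF x] unit_eigenvectorD[OF w]
    J_orthogonalD[OF ex] J_orthogonalD[OF ew] J_orthogonalD[OF xw] Nx Nw
  have Pxw: "P e x (J w) = 0"
    using bianchi[of e x w w "J w"]
    by (simp only: nabla_phi_def phi_dot_def facts expand P_linear kern off Pe 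
        P_sym[of _ e x] P_sym[of _ e w] P_sym[of _ w x])
  show ?thesis
    using bianchi[of e x w e "J e"]
    by (simp only: nabla_phi_def phi_dot_def facts expand P_linear kern off Pe Pxw
        P_sym[of _ e x] P_sym[of _ e w] P_sym[of _ w x] N_skew[of _ w x]) algebra
qed

lemma linear_zero_on_frame:
  assumes "span (E \<union> J ` E) = UNIV" "linear F" "\<And>e. e \<in> E \<Longrightarrow> F e = 0 \<and> F (J e) = 0"
  shows "F v = 0"
proof (rule linear_eq_0_on_span[OF assms(2)])
  show "v \<in> span (E \<union> J ` E)" using assms(1) by simp
  show "\<And>x. x \<in> E \<union> J ` E \<Longrightarrow> F x = 0" using assms(3) by blast
qed

text \<open>If \<open>Q\<close> is not zero, entries of \<open>N\<close> with two arguments in one line vanish by \<open>kernel_aab_zero\<close>, as a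
third line exists for dimension reasons. A nonzero entry \<open>T(y,a,b)\<close> with \<open>y\<close> in the line of \<open>f\<close>
annihilates all eigenvalues except that of \<open>f\<close>: those of \<open>a\<close> and \<open>b\<close> by \<open>kernel_distinct\<close>, the
others by \<open>kernel_fourth\<close>. So \<open>Q\<close> has rank one, and no other line can carry a nonzero component of
\<open>N\<close>, which is the situation excluded by \<open>kernel_rank_one\<close>.\<close>

theorem Q_zero_or_N_zero:
  assumes dim: "DIM('v) > 4"
  shows "(\<forall>x y. Q x y = 0) \<or> (\<forall>w x. N w x = 0)"
proof (rule disjCI)
  assume N_nz: "\<not> (\<forall>w x. N w x = 0)"
  obtain E where E: "unitary_frame E" and eig: "\<And>e. e \<in> E \<Longrightarrow> \<exists>l. eigenvector Q e l"
    and span: "span (E \<union> J ` E) = UNIV"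
    using exists_unitary_eigenbasis[OF bilinear_Q Q_sym Q_JJ] by blast
  have fin: "finite E" using finite_unitary_frame[OF E] by simp
  have "DIM('v) \<le> card (E \<union> J ` E)"
    using dim_le_card[of "UNIV :: 'v set" "E \<union> J ` E"] span fin by simp
  also have "\<dots> \<le> card E + card E"
    using card_Un_le[of E "J ` E"] card_image_le[OF fin, of J] by linarith
  finally have card: "card E > 2" using dim by simp
  have third: "\<exists>h\<in>E. h \<noteq> a \<and> h \<noteq> b" for a b
  proof (rule ccontr)
    assume "\<not> (\<exists>h\<in>E. h \<noteq> a \<and> h \<noteq> b)"
    then have "E \<subseteq> {a, b}" by blast
    then have "card E \<le> card {a, b}" by (intro card_mono) auto
    also have "\<dots> \<le> 2" by (simp add: card_insert_if)
    finally show False using card by simp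
  qed
  from eig obtain l where "\<forall>e\<in>E. eigenvector Q e (l e)" by metis
  with E have eig: "unit_eigenvector e (l e)" if "e \<in> E" for e
    using that by (auto simp: unit_eigenvector_def unitary_frame_def)
  have orth: "J_orthogonal e f" if "e \<in> E" "f \<in> E" "e \<noteq> f" for e f
    using that E by (auto simp: J_orthogonal_def unitary_frame_def)
  note span_zero = linear_zero_on_frame[OF span]
  have N_y_zero: "N y = (\<lambda>_. 0)"
    if T: "\<And>a b. a \<in> E \<Longrightarrow> b \<in> E \<Longrightarrow> g (N y a) b = 0 \<and> g (N y a) (J b) = 0" for y
  proof -
    have lin: "linear (g v)" "linear (N v)" for v
      using bilinear_g bilinear_N by (simp_all add: bilinear_def)
    have Na: "N y a = 0" if a: "a \<in> E" for a
    proof (rule ccontr)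
      assume "N y a \<noteq> 0"
      moreover have "g (N y a) (N y a) = 0"
        by (rule span_zero[OF lin(1) T[OF a]])
      ultimately show False using g_pos[of "N y a"] by simp
    qed
    have "N y v = 0" for v
      by (rule span_zero[OF lin(2)]) (simp add: N_J Na)
    then show ?thesis by (simp add: fun_eq_iff)
  qed
  show "\<forall>x y. Q x y = 0"
  proof (rule ccontr)
    assume "\<not> (\<forall>x y. Q x y = 0)"
    then obtain x0 y0 where Q0: "Q x0 y0 \<noteq> 0" by blast
    have "\<exists>e\<in>E. l e \<noteq> 0"
    proof (rule ccontr)
      assume "\<not> (\<exists>e\<in>E. l e \<noteq> 0)"
      then have "Q e v = 0" if "e \<in> E" for e v
        using unit_eigenvectorD(2)[OF eig[OF that], of v] that by simp
      then have "Q x0 y0 = 0"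
        by (intro span_zero[of "\<lambda>v. Q v y0"]) (use bilinear_Q in \<open>simp_all add: bilinear_def Q_J_left\<close>)
      with Q0 show False by simp
    qed
    then obtain e0 where e0: "e0 \<in> E" "l e0 \<noteq> 0" by blast
    have aab: "g (N y w) u = 0 \<and> g (N y w) (J u) = 0"
      if wu: "w \<in> E" "u \<in> E" "w \<noteq> u" and y: "y = w \<or> y = J w" for y w u
    proof -
      have zero: "g (N w' w') u' = 0" if w': "w' = w \<or> w' = J w" and u': "u' = u \<or> u' = J u" for w' u'
      proof (rule ccontr)
        assume nz: "g (N w' w') u' \<noteq> 0"
        have w'_eig: "unit_eigenvector w' (l w)" and u'_eig: "unit_eigenvector u' (l u)"
          using eig[OF wu(1)] eig[OF wu(2)] w' u' unit_eigenvector_J by auto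
        have zero: "l h = 0 \<and> l w = 0 \<and> l u = 0" if h: "h \<in> E" "h \<noteq> w" "h \<noteq> u" for h
          by (rule kernel_aab_zero[OF eig[OF h(1)] w'_eig u'_eig _ _ _ nz]) (use h wu orth w' u' in auto)
        obtain h where "h \<in> E" "h \<noteq> w" "h \<noteq> u" using third by blast
        with zero[of h] zero[of e0] e0 show False by auto
      qed
      from zero[of w u] zero[of w "J u"] zero[of "J w" u] zero[of "J w" "J u"] y
      show ?thesis by (auto simp: N_J g_J_left)
    qed
    have distinct: "l h = 0"
      if f: "f \<in> E" and y: "y = f \<or> y = J f" and a: "a \<in> E" "a \<noteq> f" and b: "b \<in> E" "b \<noteq> f" "a \<noteq> b"
        and nz: "g (N y a) b \<noteq> 0 \<or> g (N y a) (J b) \<noteq> 0" and h: "h \<in> E" "h \<noteq> f" for f y a b h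
    proof -
      obtain b' where b': "b' = b \<or> b' = J b" and nz': "g (N y a) (J b') \<noteq> 0"
        using nz by fastforce
      have y_eig: "unit_eigenvector y (l f)" and b'_eig: "unit_eigenvector b' (l b)"
        using eig[OF f] eig[OF b(1)] y b' unit_eigenvector_J by auto
      have yv: "J_orthogonal v y" if "v \<in> E" "v \<noteq> f" for v
        using that f y orth[of v f] by auto
      have b'v: "J_orthogonal v b'" if "v \<in> E" "v \<noteq> b" for v
        using that b b' orth[of v b] by auto
      have yb: "J_orthogonal y b'" using yv[OF b(1,2)] b' J_orthogonal_sym by auto
      have ab0: "l a = 0 \<and> l b = 0"
        by (rule kernel_distinct[OF eig[OF a(1)] y_eig b'_eig yv[OF a] b'v[OF a(1) b(3)] yb nz'])
      show ?thesis
      proof (cases "h = a \<or> h = b")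
        case True
        then show ?thesis using ab0 by blast
      next
        case False
        have "(l a + l b + 2 * l h) * g (N y a) (J b') = 0"
          using kernel_fourth[OF eig[OF h(1)] y_eig unit_eigenvector_J[OF b'_eig] yv[OF h] _ _ eig[OF a(1)]]
            b'v[OF h(1)] yb orth[OF h(1) a(1)] J_orthogonal_sym[OF yv[OF a]] J_orthogonal_sym[OF b'v[OF a(1) b(3)]] False
          by simp
        then show ?thesis using nz' ab0 by simp
      qed
    qed
    have nonzero: "\<exists>a b. a \<in> E \<and> a \<noteq> f \<and> b \<in> E \<and> b \<noteq> f \<and> a \<noteq> b \<and>
        (g (N y a) b \<noteq> 0 \<or> g (N y a) (J b) \<noteq> 0)"
      if f: "f \<in> E" and y: "y = f \<or> y = J f" and Ny: "N y \<noteq> (\<lambda>_. 0)" for f y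
    proof -
      obtain a b where ab: "a \<in> E" "b \<in> E" "g (N y a) b \<noteq> 0 \<or> g (N y a) (J b) \<noteq> 0"
        using N_y_zero[of y] Ny by blast
      have ne: "a \<noteq> b" using ab by auto
      have "a \<noteq> f" using aab[OF f ab(2) _ y] ab ne by auto
      moreover have "b \<noteq> f"
      proof
        assume "b = f"
        with aab[OF f ab(1) _ y] ne ab show False using N_skew[of y a b] N_skew_J[of y a b] by simp
      qed
      ultimately show ?thesis using ab ne by blast
    qed
    have "\<exists>f\<in>E. N f \<noteq> (\<lambda>_. 0) \<or> N (J f) \<noteq> (\<lambda>_. 0)"
    proof (rule ccontr)
      assume *: "\<not> (\<exists>f\<in>E. N f \<noteq> (\<lambda>_. 0) \<or> N (J f) \<noteq> (\<lambda>_. 0))"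
      have "N w x = 0" for w x
        by (rule span_zero[of "\<lambda>w. N w x"]) (use bilinear_N * in \<open>auto simp: bilinear_def\<close>)
      with N_nz show False by blast
    qed
    then obtain f y where f: "f \<in> E" and y: "y = f \<or> y = J f" and Ny: "N y \<noteq> (\<lambda>_. 0)" by blast
    from nonzero[OF this] obtain a b where ab: "a \<in> E" "a \<noteq> f" "b \<in> E" "b \<noteq> f" "a \<noteq> b"
      and nz: "g (N y a) b \<noteq> 0 \<or> g (N y a) (J b) \<noteq> 0" by blast
    have l0: "l h = 0" if "h \<in> E" "h \<noteq> f" for h
      by (rule distinct[OF f y ab nz that])
    then have lf: "l f \<noteq> 0" using e0 by blast
    have Nh: "N y' = (\<lambda>_. 0)" if "h \<in> E" "h \<noteq> f" "y' = h \<or> y' = J h" for h y'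
    proof (rule ccontr)
      assume "N y' \<noteq> (\<lambda>_. 0)"
      from nonzero[OF that(1,3) this] distinct[OF that(1,3), of _ _ f] that f lf show False by blast
    qed
    have y_eig: "unit_eigenvector y (l f)" using eig[OF f] y unit_eigenvector_J by auto
    have yv: "J_orthogonal y v" if "v \<in> E" "v \<noteq> f" for v
      using that f y orth[of f v] by auto
    have eig0: "unit_eigenvector a 0" "unit_eigenvector b 0" "unit_eigenvector (J b) 0"
      using eig[OF ab(1)] eig[OF ab(3)] unit_eigenvector_J[OF eig[OF ab(3)]] l0 ab by simp_all
    have o: "J_orthogonal y (J b)" "J_orthogonal a (J b)" "J_orthogonal a b"
      using yv[OF ab(3,4)] orth[OF ab(1,3,5)] by simp_all
    have NJJ: "N (J (J b)) = (\<lambda>_. 0)" using Nh[OF ab(3,4)] by (simp add: fun_eq_iff)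
    have "l f * g (N y a) b = 0"
      by (rule kernel_rank_one[OF y_eig eig0(1,2) yv[OF ab(1,2)] yv[OF ab(3,4)] o(3)])
        (use Nh ab in blast)+
    moreover have "l f * g (N y a) (J b) = 0"
      by (rule kernel_rank_one[OF y_eig eig0(1,3) yv[OF ab(1,2)] o(1,2) _ _ _ NJJ])
        (use Nh ab in blast)+
    ultimately show False using lf nz by auto
  qed
qed

end

section \<open>Calculus of smooth maps\<close>

abbreviation dd :: "'b \<Rightarrow> ('b::real_normed_vector \<Rightarrow> 'c::real_normed_vector) \<Rightarrow> 'b \<Rightarrow> 'c"
  where "dd v f \<equiv> \<lambda>x. frechet_derivative f (at x) v"

lemma dd_eqI: "(f has_derivative f') (at x) \<Longrightarrow> dd v f x = f' v"
  by (metis frechet_derivative_at)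

lemma dd_cong:
  assumes "open S" "x \<in> S" "\<And>y. y \<in> S \<Longrightarrow> f y = h y"
  shows "dd v f x = dd v h x"
proof (cases "f differentiable at x")
  case True
  from frechet_derivative_transform_within_open[OF this assms] show ?thesis by simp
next
  case False
  have "(f has_derivative D) (at x) \<longleftrightarrow> (h has_derivative D) (at x)" for D
    using has_derivative_transform_within_open[OF _ assms(1,2), where f = f and f' = D and g = h]
      has_derivative_transform_within_open[OF _ assms(1,2), where f = h and f' = D and g = f] assms(3) by auto
  then show ?thesis by (simp add: frechet_derivative_def)
qed

lemma differentiable_cong:
  assumes "open S" "x \<in> S" "\<And>y. y \<in> S \<Longrightarrow> f y = h y" "f differentiable at x"
  shows "h differentiable at x"
proof -
  from assms(4) obtain D where "(f has_derivative D) (at x)" unfolding differentiable_def by blast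
  from has_derivative_transform_within_open[OF this assms(1-3)] show ?thesis
    unfolding differentiable_def by blast
qed

lemma Ck_on_cong:
  assumes "open S" "\<And>x. x \<in> S \<Longrightarrow> f x = h x" "Ck_on k S f"
  shows "Ck_on k S h"
  using assms(2,3)
proof (induction k arbitrary: f h)
  case 0
  then show ?case using continuous_on_cong[of S S f h] by simp
next
  case (Suc k)
  have "h differentiable at x" if "x \<in> S" for x
    using differentiable_cong[OF assms(1) that, of f h] Suc.prems that by simp
  moreover have "Ck_on k S (dd v h)" for v
    by (rule Suc.IH[of "dd v f"]) (use Suc.prems dd_cong[OF assms(1), of _ f h] in auto)
  ultimately show ?case by simp
qed

lemma Ck_on_subset: "Ck_on k S f \<Longrightarrow> T \<subseteq> S \<Longrightarrow> Ck_on k T f"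
  by (induction k arbitrary: f) (auto intro: continuous_on_subset)

lemma Ck_on_SucD: "Ck_on (Suc k) S f \<Longrightarrow> Ck_on k S f"
proof (induction k arbitrary: f)
  case 0
  then show ?case
    by (auto intro!: differentiable_imp_continuous_on simp: differentiable_on_def differentiable_at_withinI)
next
  case (Suc k)
  then show ?case by auto
qed

lemma Ck_on_const: "Ck_on k S (\<lambda>x. c)"
  by (induction k arbitrary: c) auto

lemma Ck_on_add:
  assumes "open S"
  shows "Ck_on k S f \<Longrightarrow> Ck_on k S h \<Longrightarrow> Ck_on k S (\<lambda>x. f x + h x)"
proof (induction k arbitrary: f h)
  case 0
  then show ?case by (simp add: continuous_on_add)
next
  case (Suc k)
  have d: "dd v (\<lambda>x. f x + h x) x = dd v f x + dd v h x" if "x \<in> S" for v x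
    by (rule dd_eqI) (use Suc.prems that in \<open>auto intro!: has_derivative_add simp: frechet_derivative_works\<close>)
  have "Ck_on k S (dd v (\<lambda>x. f x + h x))" for v
    by (rule Ck_on_cong[OF assms, of "\<lambda>x. dd v f x + dd v h x"]) (use Suc d in auto)
  then show ?case using Suc.prems by auto
qed

lemma Ck_on_sum:
  assumes "open S" "\<And>i. i \<in> I \<Longrightarrow> Ck_on k S (f i)"
  shows "Ck_on k S (\<lambda>x. \<Sum>i\<in>I. f i x)"
  using assms(2)
proof (induction I rule: infinite_finite_induct)
  case (insert i I)
  then have "Ck_on k S (\<lambda>x. f i x + (\<Sum>i\<in>I. f i x))" by (intro Ck_on_add[OF assms(1)]) simp_all
  then show ?case using insert by simp
qed (simp_all add: Ck_on_const)

lemma Ck_on_bilinear: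
  assumes "open S" and B: "bounded_bilinear B"
  shows "Ck_on k S f \<Longrightarrow> Ck_on k S h \<Longrightarrow> Ck_on k S (\<lambda>x. B (f x) (h x))"
proof (induction k arbitrary: f h)
  case 0
  then show ?case using bounded_bilinear.continuous_on[OF B] by simp
next
  case (Suc k)
  have D: "((\<lambda>x. B (f x) (h x)) has_derivative (\<lambda>v. B (f x) (dd v h x) + B (dd v f x) (h x))) (at x)"
    if "x \<in> S" for x
    using Suc.prems that
    by (intro bounded_bilinear.FDERIV[OF B]) (auto simp: frechet_derivative_works)
  have fh: "Ck_on k S f" "Ck_on k S h"
    using Suc.prems by (auto intro: Ck_on_SucD)
  have "Ck_on k S (\<lambda>x. B (f x) (dd v h x) + B (dd v f x) (h x))" for v
    by (rule Ck_on_add[OF assms(1)]; rule Suc.IH) (use fh Suc.prems in simp_all)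
  then have "Ck_on k S (dd v (\<lambda>x. B (f x) (h x)))" for v
    by (rule Ck_on_cong[OF assms(1), rotated]) (use dd_eqI[OF D] in simp)
  moreover have "(\<lambda>x. B (f x) (h x)) differentiable at x" if "x \<in> S" for x
    using D[OF that] unfolding differentiable_def by blast
  ultimately show ?case by simp
qed

lemma linear_basis_expansion:
  fixes F :: "'b::euclidean_space \<Rightarrow> 'c::real_vector"
  assumes "linear F"
  shows "F v = (\<Sum>b\<in>Basis. (v \<bullet> b) *\<^sub>R F b)"
proof -
  have "F v = F (\<Sum>b\<in>Basis. (v \<bullet> b) *\<^sub>R b)" by (simp add: euclidean_representation)
  also have "\<dots> = (\<Sum>b\<in>Basis. (v \<bullet> b) *\<^sub>R F b)"
    by (simp add: linear_sum[OF assms] linear_scale[OF assms])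
  finally show ?thesis .
qed

text \<open>Expanding the inner derivative in a basis turns the chain rule into a sum of products of functions
to which the induction hypothesis applies.\<close>

lemma Ck_on_compose:
  fixes h :: "'c::euclidean_space \<Rightarrow> 'd::real_normed_vector"
  assumes S: "open S" and T: "open T" and ST: "\<And>x. x \<in> S \<Longrightarrow> f x \<in> T"
  shows "Ck_on k S f \<Longrightarrow> Ck_on k T h \<Longrightarrow> Ck_on k S (\<lambda>x. h (f x))"
proof (induction k arbitrary: h)
  case 0
  then show ?case using continuous_on_compose2[of T h S f] ST by auto
next
  case (Suc k)
  have D: "((\<lambda>x. h (f x)) has_derivative (\<lambda>v. dd (dd v f x) h (f x))) (at x)" if "x \<in> S" for x
    using Suc.prems ST[OF that] that
    by (intro has_derivative_compose[of f "\<lambda>v. dd v f x" x UNIV h "\<lambda>v. dd v h (f x)"])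
      (auto simp: frechet_derivative_works)
  have eq: "dd v (\<lambda>x. h (f x)) x = (\<Sum>b\<in>Basis. (dd v f x \<bullet> b) *\<^sub>R dd b h (f x))" if "x \<in> S" for x v
  proof -
    have "linear (\<lambda>v. dd v h (f x))"
      using Suc.prems ST[OF that] by (auto intro: linear_frechet_derivative)
    from linear_basis_expansion[OF this, of "dd v f x"] dd_eqI[OF D[OF that], of v]
    show ?thesis by metis
  qed
  have f: "Ck_on k S f" and df: "Ck_on k S (dd v f)" and dh: "Ck_on k T (dd b h)" for v b
    using Suc.prems by (auto intro: Ck_on_SucD)
  have "Ck_on k S (\<lambda>x. \<Sum>b\<in>Basis. (dd v f x \<bullet> b) *\<^sub>R dd b h (f x))" for v
  proof (rule Ck_on_sum[OF S])
    fix b :: 'c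
    have "Ck_on k S (\<lambda>x. dd v f x \<bullet> b)"
      by (rule Ck_on_bilinear[OF S bounded_bilinear_inner df Ck_on_const])
    then show "Ck_on k S (\<lambda>x. (dd v f x \<bullet> b) *\<^sub>R dd b h (f x))"
      by (rule Ck_on_bilinear[OF S bounded_bilinear_scaleR _ Suc.IH[OF f dh]])
  qed
  then have "Ck_on k S (dd v (\<lambda>x. h (f x)))" for v
    by (rule Ck_on_cong[OF S, rotated]) (use eq in auto)
  moreover have "(\<lambda>x. h (f x)) differentiable at x" if "x \<in> S" for x
    using D[OF that] unfolding differentiable_def by blast
  ultimately show ?case by simp
qed

lemma smooth_on_cong: "open S \<Longrightarrow> (\<And>x. x \<in> S \<Longrightarrow> f x = h x) \<Longrightarrow> smooth_on S f \<Longrightarrow> smooth_on S h"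
  unfolding smooth_on_def using Ck_on_cong by blast

lemma smooth_on_subset: "smooth_on S f \<Longrightarrow> T \<subseteq> S \<Longrightarrow> smooth_on T f"
  unfolding smooth_on_def using Ck_on_subset by blast

lemma smooth_on_const: "smooth_on S (\<lambda>x. c)"
  by (simp add: smooth_on_def Ck_on_const)

lemma smooth_on_sum:
  "open S \<Longrightarrow> (\<And>i. i \<in> I \<Longrightarrow> smooth_on S (f i)) \<Longrightarrow> smooth_on S (\<lambda>x. \<Sum>i\<in>I. f i x)"
  by (simp add: smooth_on_def Ck_on_sum)

lemma smooth_on_scaleR:
  "open S \<Longrightarrow> smooth_on S f \<Longrightarrow> smooth_on S h \<Longrightarrow> smooth_on S (\<lambda>x. f x *\<^sub>R h x)"
  by (simp add: smooth_on_def Ck_on_bilinear[OF _ bounded_bilinear_scaleR])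

lemma smooth_on_inner:
  "open S \<Longrightarrow> smooth_on S f \<Longrightarrow> smooth_on S h \<Longrightarrow> smooth_on S (\<lambda>x. f x \<bullet> h x)"
  by (simp add: smooth_on_def Ck_on_bilinear[OF _ bounded_bilinear_inner])

lemma smooth_on_compose:
  fixes h :: "'c::euclidean_space \<Rightarrow> 'd::real_normed_vector"
  assumes "open S" "open T" "\<And>x. x \<in> S \<Longrightarrow> f x \<in> T" "smooth_on S f" "smooth_on T h"
  shows "smooth_on S (\<lambda>x. h (f x))"
  using assms(4,5) Ck_on_compose[of S T f _ h, OF assms(1-3)] unfolding smooth_on_def by blast

lemma smooth_on_differentiable:
  assumes "smooth_on S f" "x \<in> S"
  shows "f differentiable at x"
proof -
  have "Ck_on (Suc 0) S f" using assms(1) by (simp only: smooth_on_def)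
  then show ?thesis using assms(2) by simp
qed

lemma smooth_on_dd:
  assumes "smooth_on S f"
  shows "smooth_on S (dd v f)"
  unfolding smooth_on_def
proof
  fix k
  have "Ck_on (Suc k) S f" using assms by (simp only: smooth_on_def)
  then show "Ck_on k S (dd v f)" by simp
qed

lemma smooth_on_continuous:
  assumes "smooth_on S f"
  shows "continuous_on S f"
proof -
  have "Ck_on 0 S f" using assms by (simp only: smooth_on_def)
  then show ?thesis by simp
qed

lemma has_derivative_dd: "f differentiable at x \<Longrightarrow> (f has_derivative (\<lambda>v. dd v f x)) (at x)"
  by (simp add: frechet_derivative_works)

lemma linear_dd: "f differentiable at x \<Longrightarrow> linear (\<lambda>v. dd v f x)"
  using linear_frechet_derivative[of f "at x"] by simp

lemma dd_const [simp]: "dd v (\<lambda>x. c) x = 0"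
  by simp

lemma dd_add:
  "f differentiable at x \<Longrightarrow> h differentiable at x \<Longrightarrow> dd v (\<lambda>x. f x + h x) x = dd v f x + dd v h x"
  by (rule dd_eqI) (auto intro!: has_derivative_add has_derivative_dd)

lemma dd_diff:
  "f differentiable at x \<Longrightarrow> h differentiable at x \<Longrightarrow> dd v (\<lambda>x. f x - h x) x = dd v f x - dd v h x"
  by (rule dd_eqI) (auto intro!: has_derivative_diff has_derivative_dd)

lemma dd_inner_left:
  "f differentiable at x \<Longrightarrow> dd v (\<lambda>x. f x \<bullet> b) x = dd v f x \<bullet> b"
  by (rule dd_eqI) (auto intro!: has_derivative_inner_left has_derivative_dd)

text \<open>The product rule for a family \<open>B\<close> of linear maps depending on the base point. Only the functions
\<open>\<lambda>y. B y w\<close> with a constant vector \<open>w\<close> have to be differentiable; expansion in a basis reduces the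
general case to this one. Tensor fields in coordinates are of this form.\<close>

lemma has_derivative_apply:
  fixes B :: "'b::real_normed_vector \<Rightarrow> 'c::euclidean_space \<Rightarrow> 'd::real_normed_vector"
  assumes S: "open S" "x \<in> S" and lin: "\<And>y. y \<in> S \<Longrightarrow> linear (B y)"
    and B: "\<And>w. (\<lambda>y. B y w) differentiable at x" and V: "V differentiable at x"
  shows "((\<lambda>y. B y (V y)) has_derivative (\<lambda>h. dd h (\<lambda>y. B y (V x)) x + B x (dd h V x))) (at x)"
proof -
  have D: "((\<lambda>y. \<Sum>b\<in>Basis. (V y \<bullet> b) *\<^sub>R B y b) has_derivative
      (\<lambda>h. \<Sum>b\<in>Basis. (V x \<bullet> b) *\<^sub>R dd h (\<lambda>y. B y b) x + (dd h V x \<bullet> b) *\<^sub>R B x b)) (at x)"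
    by (intro has_derivative_sum has_derivative_scaleR has_derivative_inner_left has_derivative_dd B V)
  have E: "((\<lambda>y. \<Sum>b\<in>Basis. (V x \<bullet> b) *\<^sub>R B y b) has_derivative
      (\<lambda>h. \<Sum>b\<in>Basis. (V x \<bullet> b) *\<^sub>R dd h (\<lambda>y. B y b) x)) (at x)"
    by (intro has_derivative_sum has_derivative_scaleR_right has_derivative_dd B)
  have "dd h (\<lambda>y. B y (V x)) x = (\<Sum>b\<in>Basis. (V x \<bullet> b) *\<^sub>R dd h (\<lambda>y. B y b) x)" for h
    by (rule dd_eqI, rule has_derivative_transform_within_open[OF E S])
      (rule linear_basis_expansion[OF lin, symmetric])
  moreover have "B x (dd h V x) = (\<Sum>b\<in>Basis. (dd h V x \<bullet> b) *\<^sub>R B x b)" for h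
    by (rule linear_basis_expansion[OF lin[OF S(2)]])
  ultimately have "(\<lambda>h. dd h (\<lambda>y. B y (V x)) x + B x (dd h V x)) =
      (\<lambda>h. \<Sum>b\<in>Basis. (V x \<bullet> b) *\<^sub>R dd h (\<lambda>y. B y b) x + (dd h V x \<bullet> b) *\<^sub>R B x b)"
    by (simp add: sum.distrib)
  then show ?thesis
    using has_derivative_transform_within_open[OF D S, of "\<lambda>y. B y (V y)"]
      linear_basis_expansion[OF lin, symmetric] by metis
qed

lemmas dd_apply = has_derivative_apply[THEN dd_eqI]

lemma differentiable_apply:
  fixes B :: "'b::real_normed_vector \<Rightarrow> 'c::euclidean_space \<Rightarrow> 'd::real_normed_vector"
  assumes "open S" "x \<in> S" "\<And>y. y \<in> S \<Longrightarrow> linear (B y)"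
    "\<And>w. (\<lambda>y. B y w) differentiable at x" "V differentiable at x"
  shows "(\<lambda>y. B y (V y)) differentiable at x"
  using has_derivative_apply[OF assms] unfolding differentiable_def by blast

lemma smooth_on_apply:
  fixes B :: "'b::real_normed_vector \<Rightarrow> 'c::euclidean_space \<Rightarrow> 'd::real_normed_vector"
  assumes S: "open S" and lin: "\<And>y. y \<in> S \<Longrightarrow> linear (B y)"
    and B: "\<And>w. smooth_on S (\<lambda>y. B y w)" and V: "smooth_on S V"
  shows "smooth_on S (\<lambda>y. B y (V y))"
proof (rule smooth_on_cong[OF S])
  show "smooth_on S (\<lambda>y. \<Sum>b\<in>Basis. (V y \<bullet> b) *\<^sub>R B y b)"
    by (intro smooth_on_sum smooth_on_scaleR smooth_on_inner smooth_on_const S V B)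
  show "(\<Sum>b\<in>Basis. (V y \<bullet> b) *\<^sub>R B y b) = B y (V y)" if "y \<in> S" for y
    using linear_basis_expansion[OF lin[OF that], of "V y"] by (rule sym)
qed

text \<open>Two applications of the mean value theorem to the second difference of \<open>f\<close>, in either order,
  produce values of both mixed derivatives arbitrarily close to the base point.\<close>

lemma second_difference:
  fixes f :: "'b::real_normed_vector \<Rightarrow> real"
  assumes f: "\<And>s t. 0 \<le> s \<Longrightarrow> s \<le> h \<Longrightarrow> 0 \<le> t \<Longrightarrow> t \<le> h \<Longrightarrow> f differentiable at (x + s *\<^sub>R v + t *\<^sub>R w)"
    and df: "\<And>s t. 0 \<le> s \<Longrightarrow> s \<le> h \<Longrightarrow> 0 \<le> t \<Longrightarrow> t \<le> h \<Longrightarrow> dd v f differentiable at (x + s *\<^sub>R v + t *\<^sub>R w)"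
    and h: "h > 0"
  obtains s t where "0 < s" "s < h" "0 < t" "t < h"
    "f (x + h *\<^sub>R v + h *\<^sub>R w) - f (x + h *\<^sub>R v) - f (x + h *\<^sub>R w) + f x
      = h * h * dd w (dd v f) (x + s *\<^sub>R v + t *\<^sub>R w)"
proof -
  have c: "((\<lambda>s. f (x + s *\<^sub>R v + t *\<^sub>R w)) has_derivative (\<lambda>a. a * dd v f (x + s *\<^sub>R v + t *\<^sub>R w))) (at s)"
    if "0 \<le> s" "s \<le> h" "0 \<le> t" "t \<le> h" for s t
  proof -
    have "((\<lambda>s. x + s *\<^sub>R v + t *\<^sub>R w) has_derivative (\<lambda>a. a *\<^sub>R v)) (at s)"
      by (auto intro!: derivative_eq_intros)
    from has_derivative_compose[OF this has_derivative_dd[OF f[OF that]]]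
    show ?thesis by (simp only: linear_scale[OF linear_dd[OF f[OF that]]] real_scaleR_def)
  qed
  have c2: "((\<lambda>t. dd v f (x + s *\<^sub>R v + t *\<^sub>R w)) has_derivative
      (\<lambda>a. a * dd w (dd v f) (x + s *\<^sub>R v + t *\<^sub>R w))) (at t)"
    if "0 \<le> s" "s \<le> h" "0 \<le> t" "t \<le> h" for s t
  proof -
    have "((\<lambda>t. x + s *\<^sub>R v + t *\<^sub>R w) has_derivative (\<lambda>a. a *\<^sub>R w)) (at t)"
      by (auto intro!: derivative_eq_intros)
    from has_derivative_compose[OF this has_derivative_dd[OF df[OF that]]]
    show ?thesis by (simp only: linear_scale[OF linear_dd[OF df[OF that]]] real_scaleR_def)
  qed
  define \<phi> where "\<phi> s = f (x + s *\<^sub>R v + h *\<^sub>R w) - f (x + s *\<^sub>R v + 0 *\<^sub>R w)" for s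
  have "(\<phi> has_derivative (\<lambda>a. a * dd v f (x + s *\<^sub>R v + h *\<^sub>R w) - a * dd v f (x + s *\<^sub>R v + 0 *\<^sub>R w)))
      (at s within {0..h})" if "0 \<le> s" "s \<le> h" for s
    unfolding \<phi>_def
    by (rule has_derivative_diff; rule has_derivative_at_withinI, rule c) (use that h in simp_all)
  then have "\<exists>s\<in>{0<..<h}. \<phi> h - \<phi> 0 = (h - 0) * dd v f (x + s *\<^sub>R v + h *\<^sub>R w)
      - (h - 0) * dd v f (x + s *\<^sub>R v + 0 *\<^sub>R w)"
    by (rule mvt_simple[OF h, where f = \<phi> and f' = "\<lambda>s a. a * dd v f (x + s *\<^sub>R v + h *\<^sub>R w)
          - a * dd v f (x + s *\<^sub>R v + 0 *\<^sub>R w)"])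
  then obtain s where s: "s \<in> {0<..<h}"
    and e1: "\<phi> h - \<phi> 0 = (h - 0) * dd v f (x + s *\<^sub>R v + h *\<^sub>R w) - (h - 0) * dd v f (x + s *\<^sub>R v + 0 *\<^sub>R w)"
    by blast
  have "((\<lambda>t. dd v f (x + s *\<^sub>R v + t *\<^sub>R w)) has_derivative
      (\<lambda>a. a * dd w (dd v f) (x + s *\<^sub>R v + t *\<^sub>R w))) (at t within {0..h})" if "0 \<le> t" "t \<le> h" for t
    by (rule has_derivative_at_withinI, rule c2) (use that s h in simp_all)
  then have "\<exists>t\<in>{0<..<h}. dd v f (x + s *\<^sub>R v + h *\<^sub>R w) - dd v f (x + s *\<^sub>R v + 0 *\<^sub>R w)
      = (h - 0) * dd w (dd v f) (x + s *\<^sub>R v + t *\<^sub>R w)"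
    by (rule mvt_simple[OF h, where f = "\<lambda>t. dd v f (x + s *\<^sub>R v + t *\<^sub>R w)"
          and f' = "\<lambda>t a. a * dd w (dd v f) (x + s *\<^sub>R v + t *\<^sub>R w)"])
  then obtain t where t: "t \<in> {0<..<h}"
    and e2: "dd v f (x + s *\<^sub>R v + h *\<^sub>R w) - dd v f (x + s *\<^sub>R v + 0 *\<^sub>R w)
      = (h - 0) * dd w (dd v f) (x + s *\<^sub>R v + t *\<^sub>R w)"
    by blast
  have e3: "\<phi> h - \<phi> 0 = h * h * dd w (dd v f) (x + s *\<^sub>R v + t *\<^sub>R w)"
    using e1 e2 by (simp add: right_diff_distrib[symmetric])
  show thesis
    by (rule that[of s t]) (use s t e3 in \<open>simp_all add: \<phi>_def\<close>)
qed

lemma dd_commute_real: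
  fixes f :: "'b::real_normed_vector \<Rightarrow> real"
  assumes S: "open S" "x \<in> S" and f: "smooth_on S f"
  shows "dd w (dd v f) x = dd v (dd w f) x"
proof (rule ccontr)
  define p q where "p = dd w (dd v f)" and "q = dd v (dd w f)"
  assume "dd w (dd v f) x \<noteq> dd v (dd w f) x"
  then have ne: "0 < dist (p x) (q x) / 2" by (simp add: p_def q_def)
  have sm: "smooth_on S (dd v f)" "smooth_on S (dd w f)" by (simp_all add: smooth_on_dd f)
  have "isCont p x" "isCont q x"
    using smooth_on_continuous[OF smooth_on_dd[OF sm(1)]] smooth_on_continuous[OF smooth_on_dd[OF sm(2)]]
      continuous_on_eq_continuous_at[OF S(1)] S(2) by (auto simp: p_def q_def)
  then obtain d1 d2 where d1: "d1 > 0" "\<And>y. dist y x < d1 \<Longrightarrow> dist (p y) (p x) < dist (p x) (q x) / 2"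
    and d2: "d2 > 0" "\<And>y. dist y x < d2 \<Longrightarrow> dist (q y) (q x) < dist (p x) (q x) / 2"
    using ne unfolding continuous_at_eps_delta by blast
  obtain d3 where d3: "d3 > 0" "ball x d3 \<subseteq> S" using S open_contains_ball by blast
  define d where "d = min d1 (min d2 d3)"
  have d: "d > 0" "d \<le> d1" "d \<le> d2" "d \<le> d3" using d1 d2 d3 by (auto simp: d_def)
  define n where "n = norm v + norm w + 1"
  have n: "n > 0" unfolding n_def by (simp add: add_nonneg_pos)
  define h where "h = d / (2 * n)"
  have h: "h > 0" using d n by (simp add: h_def)
  have hn: "h * n < d" using d n by (simp add: h_def field_simps)
  have near: "dist (x + (s *\<^sub>R v + t *\<^sub>R w)) x < d" if "0 \<le> s" "s \<le> h" "0 \<le> t" "t \<le> h" for s t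
  proof -
    have "norm (s *\<^sub>R v + t *\<^sub>R w) \<le> s * norm v + t * norm w"
      using norm_triangle_ineq[of "s *\<^sub>R v" "t *\<^sub>R w"] that by simp
    also have "\<dots> \<le> h * norm v + h * norm w"
      by (intro add_mono mult_right_mono) (use that in auto)
    also have "\<dots> \<le> h * n" using h by (simp add: n_def algebra_simps)
    finally show ?thesis using hn by (simp add: dist_norm)
  qed
  have inS: "x + (s *\<^sub>R v + t *\<^sub>R w) \<in> S" if "0 \<le> s" "s \<le> h" "0 \<le> t" "t \<le> h" for s t
    using near[OF that] d d3 by (auto simp: dist_commute subset_iff)
  obtain s t where st: "0 < s" "s < h" "0 < t" "t < h"
    "f (x + h *\<^sub>R v + h *\<^sub>R w) - f (x + h *\<^sub>R v) - f (x + h *\<^sub>R w) + f x = h * h * p (x + s *\<^sub>R v + t *\<^sub>R w)"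
    unfolding p_def
    by (rule second_difference[of h f x v w])
      (use h inS f sm in \<open>auto intro!: smooth_on_differentiable[of S] simp: add.assoc\<close>)
  obtain s' t' where st': "0 < s'" "s' < h" "0 < t'" "t' < h"
    "f (x + h *\<^sub>R w + h *\<^sub>R v) - f (x + h *\<^sub>R w) - f (x + h *\<^sub>R v) + f x = h * h * q (x + s' *\<^sub>R w + t' *\<^sub>R v)"
    unfolding q_def
    by (rule second_difference[of h f x w v])
      (use h inS f sm in \<open>auto intro!: smooth_on_differentiable[of S] simp: add.assoc add.commute[of "_ *\<^sub>R w"]\<close>)
  have "f (x + h *\<^sub>R w + h *\<^sub>R v) = f (x + h *\<^sub>R v + h *\<^sub>R w)" by (simp add: add.assoc add.commute[of "_ *\<^sub>R w"])
  then have "h * h * p (x + s *\<^sub>R v + t *\<^sub>R w) = h * h * q (x + s' *\<^sub>R w + t' *\<^sub>R v)"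
    using st(5) st'(5) by linarith
  then have "p (x + s *\<^sub>R v + t *\<^sub>R w) = q (x + s' *\<^sub>R w + t' *\<^sub>R v)" using h by simp
  moreover have "dist (p (x + s *\<^sub>R v + t *\<^sub>R w)) (p x) < dist (p x) (q x) / 2"
    by (rule d1(2)) (use near[of s t] st d in \<open>simp add: add.assoc\<close>)
  moreover have "dist (q (x + s' *\<^sub>R w + t' *\<^sub>R v)) (q x) < dist (p x) (q x) / 2"
    by (rule d2(2)) (use near[of t' s'] st' d in \<open>simp add: add.assoc add.commute[of "_ *\<^sub>R w"]\<close>)
  ultimately show False
    using dist_triangle_half_l[of "p x" "p (x + s *\<^sub>R v + t *\<^sub>R w)" "dist (p x) (q x)" "q x"]
    by (simp add: dist_commute)
qed

lemma dd_commute: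
  fixes f :: "'b::real_normed_vector \<Rightarrow> 'c::euclidean_space"
  assumes S: "open S" "x \<in> S" and f: "smooth_on S f"
  shows "dd w (dd v f) x = dd v (dd w f) x"
proof (rule euclidean_eqI)
  fix b :: 'c assume "b \<in> Basis"
  have comp: "dd v (dd w (\<lambda>x. f x \<bullet> b)) x = dd v (dd w f) x \<bullet> b" for v w
  proof -
    have "dd v (dd w (\<lambda>x. f x \<bullet> b)) x = dd v (\<lambda>x. dd w f x \<bullet> b) x"
      by (rule dd_cong[OF S]) (use smooth_on_differentiable[OF f] in \<open>simp add: dd_inner_left\<close>)
    also have "\<dots> = dd v (dd w f) x \<bullet> b"
      by (rule dd_inner_left) (rule smooth_on_differentiable[OF smooth_on_dd[OF f] S(2)])
    finally show ?thesis .
  qed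
  have "smooth_on S (\<lambda>x. f x \<bullet> b)" by (intro smooth_on_inner S f smooth_on_const)
  from dd_commute_real[OF S this] show "dd w (dd v f) x \<bullet> b = dd v (dd w f) x \<bullet> b"
    by (simp only: comp)
qed

lemma bilinear_linear: "bilinear B \<Longrightarrow> linear (B a)" "bilinear B \<Longrightarrow> linear (\<lambda>a. B a b)"
  by (simp_all add: bilinear_def)

lemma differentiable_apply2:
  fixes B :: "'b::real_normed_vector \<Rightarrow> 'c::euclidean_space \<Rightarrow> 'c \<Rightarrow> 'd::real_normed_vector"
  assumes S: "open S" "x \<in> S" and lin: "\<And>y. y \<in> S \<Longrightarrow> bilinear (B y)"
    and B: "\<And>a b. (\<lambda>y. B y a b) differentiable at x"
    and V: "V differentiable at x" and W: "W differentiable at x"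
  shows "(\<lambda>y. B y (V y) (W y)) differentiable at x"
proof (rule differentiable_apply[OF S _ _ W, of "\<lambda>y. B y (V y)"])
  show "linear (B y (V y))" if "y \<in> S" for y using lin[OF that] by (rule bilinear_linear)
  show "(\<lambda>y. B y (V y) w) differentiable at x" for w
    by (rule differentiable_apply[OF S _ B V]) (use lin in \<open>simp add: bilinear_def\<close>)
qed

lemma dd_apply2:
  fixes B :: "'b::real_normed_vector \<Rightarrow> 'c::euclidean_space \<Rightarrow> 'c \<Rightarrow> 'd::real_normed_vector"
  assumes S: "open S" "x \<in> S" and lin: "\<And>y. y \<in> S \<Longrightarrow> bilinear (B y)"
    and B: "\<And>a b. (\<lambda>y. B y a b) differentiable at x"
    and V: "V differentiable at x" and W: "W differentiable at x"
  shows "dd v (\<lambda>y. B y (V y) (W y)) x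
    = dd v (\<lambda>y. B y (V x) (W x)) x + B x (dd v V x) (W x) + B x (V x) (dd v W x)"
proof -
  have 1: "dd v (\<lambda>y. B y (V y) w) x = dd v (\<lambda>y. B y (V x) w) x + B x (dd v V x) w" for w
    by (rule dd_apply[OF S _ B V]) (use lin in \<open>simp add: bilinear_def\<close>)
  have "dd v (\<lambda>y. B y (V y) (W y)) x = dd v (\<lambda>y. B y (V y) (W x)) x + B x (V x) (dd v W x)"
  proof (rule dd_apply[OF S _ _ W, of "\<lambda>y. B y (V y)"])
    show "linear (B y (V y))" if "y \<in> S" for y using lin[OF that] by (rule bilinear_linear)
    show "(\<lambda>y. B y (V y) w) differentiable at x" for w
      by (rule differentiable_apply[OF S _ B V]) (use lin in \<open>simp add: bilinear_def\<close>)
  qed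
  then show ?thesis by (simp only: 1)
qed

lemma linear_parametric_dd:
  assumes S: "open S" "x \<in> S" and lin: "\<And>y. y \<in> S \<Longrightarrow> linear (B y)"
    and B: "\<And>a. (\<lambda>y. B y a) differentiable at x"
  shows "linear (\<lambda>a. dd v (\<lambda>y. B y a) x)"
proof (rule linearI)
  fix a b r
  have "dd v (\<lambda>y. B y (a + b)) x = dd v (\<lambda>y. B y a + B y b) x"
    by (rule dd_cong[OF S]) (simp add: linear_add[OF lin])
  then show "dd v (\<lambda>y. B y (a + b)) x = dd v (\<lambda>y. B y a) x + dd v (\<lambda>y. B y b) x"
    by (simp only: dd_add[OF B B])
  have "dd v (\<lambda>y. B y (r *\<^sub>R a)) x = dd v (\<lambda>y. r *\<^sub>R B y a) x"
    by (rule dd_cong[OF S]) (simp add: linear_scale[OF lin])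
  also have "\<dots> = r *\<^sub>R dd v (\<lambda>y. B y a) x"
    by (rule dd_eqI) (intro has_derivative_scaleR_right has_derivative_dd B)
  finally show "dd v (\<lambda>y. B y (r *\<^sub>R a)) x = r *\<^sub>R dd v (\<lambda>y. B y a) x" .
qed

section \<open>Curvature in a coordinate chart\<close>

text \<open>The coordinate expressions of an almost Hermitian metric and of a torsion-free connection with
Christoffel symbols \<open>C\<close> that preserves the metric.\<close>

locale hermitian_chart =
  fixes S :: "'e::euclidean_space set" and G :: "'e \<Rightarrow> 'e \<Rightarrow> 'e \<Rightarrow> real"
    and J :: "'e \<Rightarrow> 'e \<Rightarrow> 'e" and C :: "'e \<Rightarrow> 'e \<Rightarrow> 'e \<Rightarrow> 'e"
  assumes open_S: "open S"
    and hermitian: "x \<in> S \<Longrightarrow> hermitian_space (G x) (J x)"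
    and bilinear_C: "x \<in> S \<Longrightarrow> bilinear (C x)"
    and C_sym: "x \<in> S \<Longrightarrow> C x a b = C x b a"
    and smooth_G: "smooth_on S (\<lambda>y. G y a b)"
    and smooth_J: "smooth_on S (\<lambda>y. J y a)"
    and smooth_C: "smooth_on S (\<lambda>y. C y a b)"
    and compatible: "x \<in> S \<Longrightarrow> dd v (\<lambda>y. G y a b) x = G x (C x v a) b + G x a (C x v b)"
begin

definition curv :: "'e \<Rightarrow> 'e \<Rightarrow> 'e \<Rightarrow> 'e \<Rightarrow> 'e"
  where "curv x a b w = dd a (\<lambda>y. C y b w) x - dd b (\<lambda>y. C y a w) x
    + C x a (C x b w) - C x b (C x a w)"

definition nabla_J :: "'e \<Rightarrow> 'e \<Rightarrow> 'e \<Rightarrow> 'e"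
  where "nabla_J x v a = dd v (\<lambda>y. J y a) x + C x v (J x a) - J x (C x v a)"

definition nabla_R :: "'e \<Rightarrow> 'e \<Rightarrow> 'e \<Rightarrow> 'e \<Rightarrow> 'e \<Rightarrow> 'e \<Rightarrow> real"
  where "nabla_R x v a b w u = dd v (\<lambda>y. G y (curv y a b w) u) x
    - G x (curv x (C x v a) b w) u - G x (curv x a (C x v b) w) u
    - G x (curv x a b (C x v w)) u - G x (curv x a b w) (C x v u)"

lemma bilinear_G: "x \<in> S \<Longrightarrow> bilinear (G x)"
  using hermitian by (simp add: hermitian_space_def)

lemma linear_J: "x \<in> S \<Longrightarrow> linear (J x)"
  using hermitian by (simp add: hermitian_space_def)

lemma G_sym: "x \<in> S \<Longrightarrow> G x a b = G x b a"
  using hermitian by (simp add: hermitian_space_def)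

lemma JJ: "x \<in> S \<Longrightarrow> J x (J x a) = - a"
  using hermitian by (simp add: hermitian_space_def)

lemma diff_G: "x \<in> S \<Longrightarrow> (\<lambda>y. G y a b) differentiable at x"
  by (rule smooth_on_differentiable[OF smooth_G])

lemma diff_J: "x \<in> S \<Longrightarrow> (\<lambda>y. J y a) differentiable at x"
  by (rule smooth_on_differentiable[OF smooth_J])

lemma diff_C: "x \<in> S \<Longrightarrow> (\<lambda>y. C y a b) differentiable at x"
  by (rule smooth_on_differentiable[OF smooth_C])

lemma diff_dC: "x \<in> S \<Longrightarrow> (\<lambda>y. dd v (\<lambda>y. C y a b) y) differentiable at x"
  by (rule smooth_on_differentiable[OF smooth_on_dd[OF smooth_C]])

lemmas diff_G2 = differentiable_apply2[OF open_S _ bilinear_G diff_G]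
lemmas diff_C2 = differentiable_apply2[OF open_S _ bilinear_C diff_C]

lemma continuous_nabla_J: "continuous_on S (\<lambda>x. nabla_J x v a)"
  unfolding nabla_J_def
  by (intro continuous_on_diff continuous_on_add smooth_on_continuous[OF smooth_on_dd[OF smooth_J]]
      smooth_on_continuous[OF smooth_on_apply[OF open_S bilinear_linear(1)[OF bilinear_C] smooth_C smooth_J]]
      smooth_on_continuous[OF smooth_on_apply[OF open_S linear_J smooth_J smooth_C]])

lemma dd_G:
  assumes "x \<in> S" "V differentiable at x" "W differentiable at x"
  shows "dd v (\<lambda>y. G y (V y) (W y)) x = G x (C x v (V x)) (W x) + G x (V x) (C x v (W x))
    + G x (dd v V x) (W x) + G x (V x) (dd v W x)"
  using dd_apply2[OF open_S assms(1) bilinear_G diff_G[OF assms(1)] assms(2,3)]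
  by (simp add: compatible[OF assms(1)])

context
  fixes x assumes x: "x \<in> S"
begin

lemmas G_linear = bilinear_ladd[OF bilinear_G[OF x]] bilinear_radd[OF bilinear_G[OF x]]
  bilinear_lneg[OF bilinear_G[OF x]] bilinear_rneg[OF bilinear_G[OF x]]
  bilinear_lzero[OF bilinear_G[OF x]] bilinear_rzero[OF bilinear_G[OF x]]
  bilinear_lsub[OF bilinear_G[OF x]] bilinear_rsub[OF bilinear_G[OF x]]
  bilinear_lmul[OF bilinear_G[OF x]] bilinear_rmul[OF bilinear_G[OF x]]

lemmas C_linear = bilinear_ladd[OF bilinear_C[OF x]] bilinear_radd[OF bilinear_C[OF x]]
  bilinear_lneg[OF bilinear_C[OF x]] bilinear_rneg[OF bilinear_C[OF x]]
  bilinear_lzero[OF bilinear_C[OF x]] bilinear_rzero[OF bilinear_C[OF x]]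
  bilinear_lsub[OF bilinear_C[OF x]] bilinear_rsub[OF bilinear_C[OF x]]
  bilinear_lmul[OF bilinear_C[OF x]] bilinear_rmul[OF bilinear_C[OF x]]

lemmas J_linear = linear_add[OF linear_J[OF x]] linear_neg[OF linear_J[OF x]]
  linear_diff[OF linear_J[OF x]] linear_scale[OF linear_J[OF x]]

lemma dC_linear:
  "linear (\<lambda>v. dd v (\<lambda>y. C y a b) x)" "linear (\<lambda>a. dd v (\<lambda>y. C y a b) x)"
  "linear (\<lambda>b. dd v (\<lambda>y. C y a b) x)"
proof -
  show "linear (\<lambda>v. dd v (\<lambda>y. C y a b) x)" by (rule linear_dd[OF diff_C[OF x]])
  show "linear (\<lambda>a. dd v (\<lambda>y. C y a b) x)"
    by (rule linear_parametric_dd[OF open_S x _ diff_C[OF x]]) (rule bilinear_linear[OF bilinear_C])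
  show "linear (\<lambda>b. dd v (\<lambda>y. C y a b) x)"
    by (rule linear_parametric_dd[OF open_S x _ diff_C[OF x]]) (rule bilinear_linear[OF bilinear_C])
qed

lemmas dC_simps = dC_linear[THEN linear_add] dC_linear[THEN linear_scale]

lemma dC_sym: "dd v (\<lambda>y. C y a b) x = dd v (\<lambda>y. C y b a) x"
  by (rule dd_cong[OF open_S x]) (rule C_sym)

lemma curv_linear: "linear (\<lambda>a. curv x a b w)" "linear (\<lambda>b. curv x a b w)" "linear (\<lambda>w. curv x a b w)"
  by (rule linearI; simp add: curv_def C_linear dC_simps algebra_simps)+

lemma curv_antisym: "curv x a b w = - curv x b a w"
  by (simp add: curv_def)

lemma first_bianchi: "curv x a b w + curv x b w a + curv x w a b = 0"
  unfolding curv_def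
  by (simp only: dC_sym[of a w b] dC_sym[of b a w] dC_sym[of w b a] C_sym[OF x, of a w] C_sym[OF x, of b a] C_sym[OF x, of w b]) simp

text \<open>The curvature measures the commutator of second covariant derivatives, and the metric is parallel;
so the identity is the symmetry of the second derivatives of \<open>G\<close>.\<close>

lemma G_curv_skew: "G x (curv x a b w) u = - G x (curv x a b u) w"
proof -
  have second: "dd a (dd b (\<lambda>y. G y w u)) x =
      G x (C x a (C x b w)) u + G x (C x b w) (C x a u) + G x (dd a (\<lambda>y. C y b w) x) u
      + (G x (C x a w) (C x b u) + G x w (C x a (C x b u)) + G x w (dd a (\<lambda>y. C y b u) x))" for a b
  proof -
    have "dd a (dd b (\<lambda>y. G y w u)) x = dd a (\<lambda>y. G y (C y b w) u + G y w (C y b u)) x"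
      by (rule dd_cong[OF open_S x]) (rule compatible)
    also have "\<dots> = dd a (\<lambda>y. G y (C y b w) u) x + dd a (\<lambda>y. G y w (C y b u)) x"
      by (intro dd_add diff_G2 diff_C x differentiable_const)
    also have "\<dots> = G x (C x a (C x b w)) u + G x (C x b w) (C x a u) + G x (dd a (\<lambda>y. C y b w) x) u
      + (G x (C x a w) (C x b u) + G x w (C x a (C x b u)) + G x w (dd a (\<lambda>y. C y b u) x))"
      by (simp add: dd_G[OF x] diff_C[OF x] G_linear)
    finally show ?thesis .
  qed
  have "dd a (dd b (\<lambda>y. G y w u)) x = dd b (dd a (\<lambda>y. G y w u)) x"
    by (rule dd_commute[OF open_S x smooth_G])
  then show ?thesis
    unfolding second by (simp add: curv_def G_linear G_sym[OF x, of _ w] algebra_simps)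
qed

lemma G_curv_pair: "G x (curv x a b w) u = G x (curv x w u a) b"
proof -
  define R where "R a b w u = G x (curv x a b w) u" for a b w u
  have R1: "R a b w u = - R b a w u" for a b w u
    by (simp add: R_def curv_antisym[of a b] G_linear)
  have R2: "R a b w u = - R a b u w" for a b w u
    unfolding R_def by (rule G_curv_skew)
  have R3: "R a b w u + R b w a u + R w a b u = 0" for a b w u
    using arg_cong[OF first_bianchi[of a b w], of "\<lambda>v. G x v u"] by (simp add: R_def G_linear)
  have "2 * R a b w u = 2 * R w u a b"
    using R3[of a b w u] R3[of b w u a] R3[of w u a b] R3[of u a b w]
      R1[of a b w u] R1[of b w u a] R1[of w u a b] R1[of u a b w] R1[of a w b u] R1[of u b w a]
      R2[of a b w u] R2[of b w u a] R2[of w u a b] R2[of u a b w] R2[of a w b u] R2[of u b w a]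
      R1[of b w a u] R1[of w a b u] R1[of w u b a] R1[of u b a w] R1[of u a w b] R1[of a b u w] R1[of b u w a]
      R2[of b w a u] R2[of w a b u] R2[of w u b a] R2[of b u w a]
    by linarith
  then show ?thesis by (simp add: R_def)
qed

lemma dd_curv:
  "dd v (\<lambda>y. curv y a b w) x = dd v (dd a (\<lambda>y. C y b w)) x - dd v (dd b (\<lambda>y. C y a w)) x
    + (dd v (\<lambda>y. C y a (C x b w)) x + C x a (dd v (\<lambda>y. C y b w) x))
    - (dd v (\<lambda>y. C y b (C x a w)) x + C x b (dd v (\<lambda>y. C y a w) x))"
proof -
  have 1: "dd v (\<lambda>y. C y a (C y b w)) x = dd v (\<lambda>y. C y a (C x b w)) x + C x a (dd v (\<lambda>y. C y b w) x)" for a b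
    by (rule dd_apply[OF open_S x bilinear_linear(1)[OF bilinear_C] diff_C[OF x] diff_C[OF x]])
  have 2: "(\<lambda>y. C y a (C y b w)) differentiable at x" for a b
    by (intro diff_C2 diff_C x differentiable_const)
  have "dd v (\<lambda>y. curv y a b w) x = dd v (\<lambda>y. dd a (\<lambda>y. C y b w) y - dd b (\<lambda>y. C y a w) y + C y a (C y b w)) x
      - dd v (\<lambda>y. C y b (C y a w)) x"
    unfolding curv_def by (intro dd_diff differentiable_diff differentiable_add diff_dC x 2)
  also have "\<dots> = dd v (dd a (\<lambda>y. C y b w)) x - dd v (dd b (\<lambda>y. C y a w)) x + dd v (\<lambda>y. C y a (C y b w)) x
      - dd v (\<lambda>y. C y b (C y a w)) x"
    by (subst dd_add, intro differentiable_diff diff_dC x, rule 2, subst dd_diff) (rule diff_dC[OF x] refl)+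
  finally show ?thesis by (simp only: 1)
qed

lemma diff_curv: "(\<lambda>y. curv y a b w) differentiable at x"
  unfolding curv_def
  by (intro differentiable_diff differentiable_add diff_dC diff_C2 diff_C x differentiable_const)

text \<open>Written with covariant derivatives, the identity is the Jacobi identity for the operators
\<open>\<nabla>\<^sub>v, \<nabla>\<^sub>a, \<nabla>\<^sub>b\<close>; in coordinates the second derivatives of the Christoffel symbols cancel by
Schwarz' theorem, and the Christoffel terms in the first two slots cancel by their symmetry.\<close>

lemma second_bianchi: "nabla_R x v a b w u + nabla_R x a b v w u + nabla_R x b v a w u = 0"
proof -
  have op: "nabla_R x v a b w u = G x (dd v (\<lambda>y. curv y a b w) x + C x v (curv x a b w)
    - curv x a b (C x v w) - curv x (C x v a) b w - curv x a (C x v b) w) u" for v a b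
  proof -
    have "dd v (\<lambda>y. G y (curv y a b w) u) x = G x (C x v (curv x a b w)) u + G x (curv x a b w) (C x v u)
        + G x (dd v (\<lambda>y. curv y a b w) x) u"
      by (simp only: dd_G[OF x diff_curv differentiable_const] dd_const G_linear add_0_right)
    then show ?thesis unfolding nabla_R_def by (simp only: G_linear)
  qed
  have cancel: "curv x a (C x v b) w = - curv x (C x b v) a w" for a v b
    using curv_antisym[of a "C x v b"] C_sym[OF x, of v b] by simp
  have Schwarz: "dd v (dd a (\<lambda>y. C y b w)) x = dd a (dd v (\<lambda>y. C y b w)) x" for v a b
    by (rule dd_commute[OF open_S x smooth_C])
  have main: "(dd v (\<lambda>y. curv y a b w) x + C x v (curv x a b w) - curv x a b (C x v w))
    + (dd a (\<lambda>y. curv y b v w) x + C x a (curv x b v w) - curv x b v (C x a w))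
    + (dd b (\<lambda>y. curv y v a w) x + C x b (curv x v a w) - curv x v a (C x b w)) = 0"
    unfolding dd_curv Schwarz[where v = a and a = v] Schwarz[where v = b and a = v] Schwarz[where v = b and a = a]
    by (rule euclidean_eqI)
      (simp only: curv_def C_linear inner_add_left inner_diff_left inner_zero_left)
  have "nabla_R x v a b w u + nabla_R x a b v w u + nabla_R x b v a w u =
    G x ((dd v (\<lambda>y. curv y a b w) x + C x v (curv x a b w) - curv x a b (C x v w))
    + (dd a (\<lambda>y. curv y b v w) x + C x a (curv x b v w) - curv x b v (C x a w))
    + (dd b (\<lambda>y. curv y v a w) x + C x b (curv x v a w) - curv x v a (C x b w))) u"
    unfolding op cancel by (simp add: G_linear)
  then show ?thesis unfolding main by (simp add: G_linear)
qed

end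

end

text \<open>The assumption \<open>curv_eq\<close> is the vanishing of the Bochner tensor.\<close>

locale bochner_flat_chart = hermitian_chart S G J C
  for S :: "'e::euclidean_space set" and G J C +
  fixes Q :: "'e \<Rightarrow> 'e \<Rightarrow> 'e \<Rightarrow> real"
  assumes bilinear_Q: "x \<in> S \<Longrightarrow> bilinear (Q x)"
    and Q_sym: "x \<in> S \<Longrightarrow> Q x a b = Q x b a"
    and curv_eq: "x \<in> S \<Longrightarrow> G x (curv x a b w) u = bochner_phi (G x) (J x) (Q x) a b w u"
    and dim: "DIM('e) > 4"
begin

context
  fixes x assumes x: "x \<in> S"
begin

interpretation H: hermitian_space "G x" "J x"
  by (rule hermitian[OF x])

lemmas Q_linear = bilinear_ladd[OF bilinear_Q[OF x]] bilinear_radd[OF bilinear_Q[OF x]]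
  bilinear_lneg[OF bilinear_Q[OF x]] bilinear_rneg[OF bilinear_Q[OF x]]
  bilinear_lzero[OF bilinear_Q[OF x]] bilinear_rzero[OF bilinear_Q[OF x]]
  bilinear_lsub[OF bilinear_Q[OF x]] bilinear_rsub[OF bilinear_Q[OF x]]
  bilinear_lmul[OF bilinear_Q[OF x]] bilinear_rmul[OF bilinear_Q[OF x]]

text \<open>Apart from the term \<open>2 * g z (J u) * Q x (J y)\<close>, the sum in \<open>bochner_phi\<close> is antisymmetric in
the first two arguments for every symmetric \<open>Q\<close>. Since the curvature is antisymmetric in them, so
is this term.\<close>

lemma Q_JJ: "Q x (J x a) (J x b) = Q x a b"
proof -
  have skew: "Q x a (J x b) = - Q x b (J x a)" for a b
  proof -
    obtain w :: 'e where w: "w \<noteq> 0" using nonempty_Basis nonzero_Basis by blast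
    have "bochner_phi (G x) (J x) (Q x) a b w (J x w) + bochner_phi (G x) (J x) (Q x) b a w (J x w) = 0"
      using curv_antisym[OF x, of a b w] by (simp add: curv_eq[OF x, symmetric])
    then have "G x w w * (Q x a (J x b) + Q x b (J x a)) = 0"
      using H.g_J_flip[of a b] by (simp add: bochner_phi_def Q_linear algebra_simps)
    moreover have "G x w w \<noteq> 0" using H.g_pos[OF w] by simp
    ultimately show ?thesis by simp
  qed
  from skew[of "J x a" b] show ?thesis by (simp add: Q_linear Q_sym[OF x, of b])
qed

end

text \<open>The holomorphic sectional curvatures determine \<open>Q\<close> by polarisation. So the differentiability of
\<open>Q\<close> is a consequence of that of the curvature.\<close>

lemma holomorphic_curvature:
  assumes x: "x \<in> S"
  shows "G x (curv x a (J x a) (J x a)) a = 8 * G x a a * Q x a a"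
proof -
  interpret hermitian_space "G x" "J x" by (rule hermitian[OF x])
  have "Q x a (J x a) = 0"
    using Q_JJ[OF x, of a "J x a"] Q_sym[OF x, of a "J x a"] by (simp add: Q_linear[OF x])
  then show ?thesis
    using Q_sym[OF x, of a "J x a"]
    by (simp add: curv_eq[OF x] bochner_phi_def g_J_left Q_linear[OF x] Q_JJ[OF x])
qed

lemma differentiable_Q:
  assumes x: "x \<in> S"
  shows "(\<lambda>y. Q y a b) differentiable at x"
proof -
  have curv: "(\<lambda>y. curv y a (J y a) (J y a)) differentiable at x" for a
    by (rule differentiable_apply2[where B = "\<lambda>y. curv y a", OF open_S x _ diff_curv[OF x] diff_J[OF x] diff_J[OF x]])
      (simp add: bilinear_def curv_linear)
  have diag: "(\<lambda>y. Q y a a) differentiable at x" for a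
  proof (cases "a = 0")
    case True
    show ?thesis
      by (rule differentiable_cong[OF open_S x, of "\<lambda>_. 0"])
        (simp_all add: True bilinear_lzero[OF bilinear_Q])
  next
    case False
    have pos: "G y a a \<noteq> 0" if "y \<in> S" for y
      using hermitian_space.g_pos[OF hermitian[OF that] False] by simp
    show ?thesis
    proof (rule differentiable_cong[OF open_S x])
      show "(\<lambda>y. G y (curv y a (J y a) (J y a)) a / (8 * G y a a)) differentiable at x"
        using pos[OF x]
        by (intro differentiable_divide diff_G2 curv differentiable_mult diff_G x differentiable_const) simp_all
      show "G y (curv y a (J y a) (J y a)) a / (8 * G y a a) = Q y a a" if "y \<in> S" for y
        using pos[OF that] by (simp add: holomorphic_curvature[OF that])
    qed
  qed
  show ?thesis
  proof (rule differentiable_cong[OF open_S x])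
    show "(\<lambda>y. (Q y (a + b) (a + b) - Q y a a - Q y b b) * (1 / 2)) differentiable at x"
      by (intro differentiable_mult differentiable_diff diag differentiable_const)
    show "(Q y (a + b) (a + b) - Q y a a - Q y b b) * (1 / 2) = Q y a b" if "y \<in> S" for y
      using Q_sym[OF that, of a b] by (simp add: Q_linear[OF that])
  qed
qed

definition nabla_Q :: "'e \<Rightarrow> 'e \<Rightarrow> 'e \<Rightarrow> 'e \<Rightarrow> real"
  where "nabla_Q x v a b = dd v (\<lambda>y. Q y a b) x - Q x (C x v a) b - Q x a (C x v b)"

lemmas diff_Q2 = differentiable_apply2[OF open_S _ bilinear_Q differentiable_Q]

context
  fixes x assumes x: "x \<in> S"
begin

interpretation H: hermitian_space "G x" "J x"
  by (rule hermitian[OF x])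

lemma dd_J: "dd v (\<lambda>y. J y a) x = nabla_J x v a - C x v (J x a) + J x (C x v a)"
  by (simp add: nabla_J_def)

lemma dd_Q:
  assumes "V differentiable at x" "W differentiable at x"
  shows "dd v (\<lambda>y. Q y (V y) (W y)) x = nabla_Q x v (V x) (W x)
    + Q x (C x v (V x)) (W x) + Q x (V x) (C x v (W x))
    + Q x (dd v V x) (W x) + Q x (V x) (dd v W x)"
  using dd_apply2[OF open_S x bilinear_Q differentiable_Q[OF x] assms] by (simp add: nabla_Q_def)

lemmas linear_simps = G_linear[OF x] C_linear[OF x] J_linear[OF x] Q_linear[OF x]

lemma bilinear_nabla_J: "bilinear (nabla_J x)"
proof -
  have "linear (\<lambda>v. dd v (\<lambda>y. J y a) x)" "linear (\<lambda>a. dd v (\<lambda>y. J y a) x)" for a v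
    by (rule linear_dd[OF diff_J[OF x]]) (rule linear_parametric_dd[OF open_S x linear_J diff_J[OF x]])
  note lin = this this[THEN linear_add] this[THEN linear_scale]
  show ?thesis
    unfolding bilinear_def nabla_J_def
    by (auto intro!: linearI simp: lin linear_simps algebra_simps)
qed

lemma nabla_J_skew: "G x (nabla_J x v a) b = - G x (nabla_J x v b) a"
proof -
  have "dd v (\<lambda>y. G y (J y a) b) x = dd v (\<lambda>y. - G y (J y b) a) x"
    by (rule dd_cong[OF open_S x])
      (metis G_sym hermitian hermitian_space.g_J_left)
  also have "\<dots> = - dd v (\<lambda>y. G y (J y b) a) x"
    by (rule dd_eqI) (intro has_derivative_minus has_derivative_dd diff_G2 diff_J x differentiable_const)
  finally show ?thesis
    by (simp add: dd_G[OF x] diff_J[OF x] dd_J linear_simps H.g_J_left H.g_sym[of a] H.g_J_flip[of b])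
qed

lemma nabla_J_J: "nabla_J x v (J x a) = - J x (nabla_J x v a)"
proof -
  have "dd v (\<lambda>y. J y (J y a)) x = dd v (\<lambda>y. J y (J x a)) x + J x (dd v (\<lambda>y. J y a) x)"
    by (rule dd_apply[OF open_S x linear_J diff_J[OF x] diff_J[OF x]])
  moreover have "dd v (\<lambda>y. J y (J y a)) x = dd v (\<lambda>y. - a) x"
    by (rule dd_cong[OF open_S x]) (rule JJ)
  ultimately show ?thesis by (simp add: dd_J linear_simps JJ[OF x] eq_neg_iff_add_eq_0)
qed

lemma bilinear_nabla_Q: "bilinear (nabla_Q x v)"
proof -
  have lin_a: "linear (\<lambda>a. dd v (\<lambda>y. Q y a b) x)" for b
    by (rule linear_parametric_dd[OF open_S x bilinear_linear(2)[OF bilinear_Q] differentiable_Q[OF x]])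
  have lin_b: "linear (\<lambda>b. dd v (\<lambda>y. Q y a b) x)" for a
    by (rule linear_parametric_dd[OF open_S x bilinear_linear(1)[OF bilinear_Q] differentiable_Q[OF x]])
  note lin = lin_a[THEN linear_add] lin_a[THEN linear_scale] lin_b[THEN linear_add] lin_b[THEN linear_scale]
  show ?thesis
    unfolding bilinear_def nabla_Q_def
    by (auto intro!: linearI simp: lin linear_simps algebra_simps)
qed

lemma nabla_Q_JJ:
  "nabla_Q x v (J x a) (J x b) + Q x (nabla_J x v a) (J x b) + Q x (J x a) (nabla_J x v b) = nabla_Q x v a b"
proof -
  have "dd v (\<lambda>y. Q y (J y a) (J y b)) x = dd v (\<lambda>y. Q y a b) x"
    by (rule dd_cong[OF open_S x]) (rule Q_JJ)
  then show ?thesis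
    by (simp add: dd_Q diff_J[OF x] dd_J linear_simps Q_JJ[OF x])
qed

text \<open>Differentiating the products in \<open>bochner_phi\<close> produces \<open>nabla_phi\<close> and the four terms in which a
Christoffel symbol is applied to one of the arguments. The latter are removed by the definition of
\<open>nabla_R\<close>.\<close>

lemma nabla_R_eq: "nabla_R x v a b w u = nabla_phi (G x) (J x) (Q x) (nabla_J x) (nabla_Q x) v a b w u"
proof -
  have "dd v (\<lambda>y. G y (curv y a b w) u) x = dd v (\<lambda>y. bochner_phi (G y) (J y) (Q y) a b w u) x"
    by (rule dd_cong[OF open_S x]) (rule curv_eq)
  also have "\<dots> = nabla_phi (G x) (J x) (Q x) (nabla_J x) (nabla_Q x) v a b w u
    + bochner_phi (G x) (J x) (Q x) (C x v a) b w u + bochner_phi (G x) (J x) (Q x) a (C x v b) w u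
    + bochner_phi (G x) (J x) (Q x) a b (C x v w) u + bochner_phi (G x) (J x) (Q x) a b w (C x v u)"
  proof -
    have dG: "dd v (\<lambda>y. G y a b) x = G x (C x v a) b + G x a (C x v b)" for a b
      by (rule compatible[OF x])
    have dGJ: "dd v (\<lambda>y. G y a (J y b)) x = G x (C x v a) (J x b) + G x a (nabla_J x v b) + G x a (J x (C x v b))" for a b
      by (simp add: dd_G[OF x] diff_J[OF x] dd_J linear_simps)
    have dQ: "dd v (\<lambda>y. Q y a b) x = nabla_Q x v a b + Q x (C x v a) b + Q x a (C x v b)" for a b
      by (simp add: nabla_Q_def)
    have dQJ: "dd v (\<lambda>y. Q y a (J y b)) x = nabla_Q x v a (J x b) + Q x (C x v a) (J x b)
        + Q x a (nabla_J x v b) + Q x a (J x (C x v b))" for a b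
      by (simp add: dd_Q diff_J[OF x] dd_J linear_simps)
    have hG: "((\<lambda>y. G y a b) has_derivative (\<lambda>v. dd v (\<lambda>y. G y a b) x)) (at x)" for a b
      by (intro has_derivative_dd diff_G x)
    have hGJ: "((\<lambda>y. G y a (J y b)) has_derivative (\<lambda>v. dd v (\<lambda>y. G y a (J y b)) x)) (at x)" for a b
      by (intro has_derivative_dd diff_G2 diff_J x differentiable_const)
    have hQ: "((\<lambda>y. Q y a b) has_derivative (\<lambda>v. dd v (\<lambda>y. Q y a b) x)) (at x)" for a b
      by (intro has_derivative_dd differentiable_Q x)
    have hQJ: "((\<lambda>y. Q y a (J y b)) has_derivative (\<lambda>v. dd v (\<lambda>y. Q y a (J y b)) x)) (at x)" for a b
      by (intro has_derivative_dd diff_Q2 diff_J x differentiable_const)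
    show ?thesis
      unfolding bochner_phi_def
      by (rule dd_eqI[THEN trans],
          (rule has_derivative_add has_derivative_diff has_derivative_mult has_derivative_const hG hGJ hQ hQJ)+)
        (simp only: dG dGJ dQ dQJ nabla_phi_def phi_dot_def bochner_phi_def, simp add: algebra_simps)
  qed
  finally show ?thesis
    unfolding nabla_R_def by (simp add: curv_eq[OF x])
qed

lemma jet: "bochner_jet (G x) (J x) (Q x) (nabla_J x) (nabla_Q x)"
proof
  show "nabla_Q x v a b = nabla_Q x v b a" for v a b
  proof -
    have "dd v (\<lambda>y. Q y a b) x = dd v (\<lambda>y. Q y b a) x" by (rule dd_cong[OF open_S x]) (rule Q_sym)
    then show ?thesis
      unfolding nabla_Q_def using Q_sym[OF x, of "C x v a" b] Q_sym[OF x, of a "C x v b"] by simp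
  qed
  show "nabla_Q x (- v) a b = - nabla_Q x v a b" for v a b
    unfolding nabla_Q_def
    by (simp add: linear_simps linear_neg[OF linear_dd[OF differentiable_Q[OF x]]])
  show "nabla_phi (G x) (J x) (Q x) (nabla_J x) (nabla_Q x) w a b z u
    + nabla_phi (G x) (J x) (Q x) (nabla_J x) (nabla_Q x) a b w z u
    + nabla_phi (G x) (J x) (Q x) (nabla_J x) (nabla_Q x) b w a z u = 0" for w a b z u
    using second_bianchi[OF x, of w a b z u] by (simp only: nabla_R_eq)
qed (use bilinear_Q[OF x] Q_sym[OF x] Q_JJ[OF x] bilinear_nabla_J nabla_J_skew nabla_J_J bilinear_nabla_Q nabla_Q_JJ in blast)+

theorem flat_or_kaehler_point: "(\<forall>a b w. curv x a b w = 0) \<or> (\<forall>v a. nabla_J x v a = 0)"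
proof -
  interpret bochner_jet "G x" "J x" "Q x" "nabla_J x" "nabla_Q x" by (rule jet)
  consider "\<forall>a b. Q x a b = 0" | "\<forall>v a. nabla_J x v a = 0"
    using Q_zero_or_N_zero[OF dim] by blast
  then show ?thesis
  proof cases
    case 1
    have "curv x a b w = 0" for a b w
    proof (rule ccontr)
      assume "curv x a b w \<noteq> 0"
      then have "G x (curv x a b w) (curv x a b w) > 0" by (rule H.g_pos)
      then show False using 1 by (simp add: curv_eq[OF x] bochner_phi_def)
    qed
    then show ?thesis by blast
  qed blast
qed

end

end

section \<open>Charts and coordinate vector fields\<close>

lemma is_chart_inj:
  assumes "is_chart M d"
  shows "inj_on (snd d) (fst d)"
proof -
  have "topspace (subtopology M (fst d)) = fst d"
    using assms openin_subset by (fastforce simp: is_chart_def)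
  then show ?thesis
    using assms homeomorphic_eq_everything_map[of "subtopology M (fst d)"] by (auto simp: is_chart_def)
qed

lemma is_chart_open_image:
  assumes d: "is_chart M d" and W: "openin M W"
  shows "open (snd d ` (fst d \<inter> W))"
proof -
  have "openin (subtopology M (fst d)) (fst d \<inter> W)"
    using W by (auto simp: openin_subtopology)
  then have "openin (top_of_set (snd d ` fst d)) (snd d ` (fst d \<inter> W))"
    using d homeomorphic_imp_open_map[of "subtopology M (fst d)"] unfolding is_chart_def open_map_def by blast
  then show ?thesis
    using d openin_open_trans[of "snd d ` fst d"] by (auto simp: is_chart_def openin_open)
qed

lemma is_chart_open_preimage:
  assumes d: "is_chart M d" and V: "open V"
  shows "openin M {q \<in> fst d. snd d q \<in> V}"
proof -
  have U: "openin M (fst d)" using d by (simp add: is_chart_def)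
  have top: "topspace (subtopology M (fst d)) = fst d" using openin_subset[OF U] by auto
  have "continuous_map (subtopology M (fst d)) (top_of_set (snd d ` fst d)) (snd d)"
    using d homeomorphic_imp_continuous_map by (auto simp: is_chart_def)
  moreover have "openin (top_of_set (snd d ` fst d)) (snd d ` fst d \<inter> V)"
    using V by (auto simp: openin_open)
  ultimately have "openin (subtopology M (fst d))
      {q \<in> topspace (subtopology M (fst d)). snd d q \<in> snd d ` fst d \<inter> V}"
    by (rule openin_continuous_map_preimage)
  moreover have "{q \<in> topspace (subtopology M (fst d)). snd d q \<in> snd d ` fst d \<inter> V} = {q \<in> fst d. snd d q \<in> V}"
    unfolding top by auto
  ultimately show ?thesis using U openin_trans_full by fastforce
qed

locale atlas =
  fixes M :: "'a topology" and A :: "('a, 'e::euclidean_space) chart set"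
  assumes smooth: "smooth_manifold M A"
begin

lemma is_chart: "d \<in> A \<Longrightarrow> is_chart M d"
  using smooth by (simp add: smooth_manifold_def)

lemma openin_chart: "d \<in> A \<Longrightarrow> openin M (fst d)"
  using is_chart by (simp add: is_chart_def)

lemma in_chart_at: "d \<in> A \<Longrightarrow> q \<in> fst d \<Longrightarrow> in_chart d f (snd d q) = f q"
  using is_chart_inj[OF is_chart] by (simp add: in_chart_def)

lemma open_chart_image: "d \<in> A \<Longrightarrow> openin M W \<Longrightarrow> open (snd d ` (fst d \<inter> W))"
  by (rule is_chart_open_image[OF is_chart])

lemma smooth_transition: "c \<in> A \<Longrightarrow> d \<in> A \<Longrightarrow> smooth_on (snd c ` (fst c \<inter> fst d)) (transition c d)"
  using smooth by (simp add: smooth_manifold_def)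

lemma differentiable_transition:
  "c \<in> A \<Longrightarrow> d \<in> A \<Longrightarrow> q \<in> fst c \<Longrightarrow> q \<in> fst d \<Longrightarrow> transition c d differentiable at (snd c q)"
  using smooth_on_differentiable[OF smooth_transition] by blast

lemma in_chart_transition:
  assumes "c \<in> A" "d \<in> A" "y \<in> snd d ` (fst d \<inter> fst c)"
  shows "in_chart d f y = in_chart c f (transition d c y)"
proof -
  from assms(3) obtain q where q: "y = snd d q" "q \<in> fst d" "q \<in> fst c" by blast
  then show ?thesis by (simp add: in_chart_at[OF assms(2)] in_chart_at[OF assms(1)])
qed

text \<open>Changes of charts are smooth, so smoothness in one chart carries over to all others.\<close>

lemma smooth_in_chart:
  fixes f :: "'a \<Rightarrow> 'f::real_normed_vector"
  assumes c: "c \<in> A" and d: "d \<in> A" and W: "openin M W" "W \<subseteq> fst c"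
    and f: "smooth_on (snd c ` W) (in_chart c f)"
  shows "smooth_on (snd d ` (fst d \<inter> W)) (in_chart d f)"
proof (rule smooth_on_cong)
  show op: "open (snd d ` (fst d \<inter> W))" by (rule open_chart_image[OF d W(1)])
  have opc: "open (snd c ` W)"
    using open_chart_image[OF c W(1)] W(2) by (simp add: inf.absorb2)
  show "smooth_on (snd d ` (fst d \<inter> W)) (\<lambda>y. in_chart c f (transition d c y))"
  proof (rule smooth_on_compose[OF op opc _ _ f])
    show "transition d c y \<in> snd c ` W" if "y \<in> snd d ` (fst d \<inter> W)" for y
      using that in_chart_at[OF d] by auto
    show "smooth_on (snd d ` (fst d \<inter> W)) (transition d c)"
      by (rule smooth_on_subset[OF smooth_transition[OF d c]]) (use W in auto)
  qed
  show "in_chart c f (transition d c y) = in_chart d f y" if "y \<in> snd d ` (fst d \<inter> W)" for y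
    using that in_chart_transition[OF c d, of y f] W(2) by auto
qed

lemma dd_in_chart:
  fixes f :: "'a \<Rightarrow> 'f::real_normed_vector"
  assumes c: "c \<in> A" and d: "d \<in> A" and q: "q \<in> fst c" "q \<in> fst d"
    and f: "in_chart c f differentiable at (snd c q)"
  shows "dd v (in_chart d f) (snd d q) = dd (dd v (transition d c) (snd d q)) (in_chart c f) (snd c q)"
proof -
  have "dd v (in_chart d f) (snd d q) = dd v (\<lambda>y. in_chart c f (transition d c y)) (snd d q)"
    by (rule dd_cong[OF open_chart_image[OF d openin_chart[OF c]]])
      (use q in_chart_transition[OF c d] in auto)
  also have "\<dots> = dd (dd v (transition d c) (snd d q)) (in_chart c f) (snd c q)"
    by (rule dd_eqI, rule has_derivative_compose[OF has_derivative_dd[OF differentiable_transition[OF d c q(2,1)]]])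
      (simp add: in_chart_at[OF d q(2)] has_derivative_dd[OF f])
  finally show ?thesis .
qed

lemma dd_transition_self:
  assumes "c \<in> A" "q \<in> fst c"
  shows "dd v (transition c c) (snd c q) = v"
proof -
  have "dd v (transition c c) (snd c q) = dd v (\<lambda>x. x) (snd c q)"
    by (rule dd_cong[OF open_chart_image[OF assms(1) openin_chart[OF assms(1)]]])
      (use assms in_chart_at[OF assms(1)] in auto)
  then show ?thesis by simp
qed

lemma tangent_spaceD:
  assumes "v \<in> tangent_space A p" "c \<in> A" "d \<in> A" "p \<in> fst c" "p \<in> fst d"
  shows "v d = dd (v c) (transition c d) (snd c p)"
  using assms unfolding tangent_space_def by blast

text \<open>The definition of \<open>deriv_along\<close> uses an arbitrarily chosen chart; by the chain rule, every chart
gives the same value.\<close>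

lemma deriv_along_chart:
  assumes c: "c \<in> A" "p \<in> fst c" and v: "v \<in> tangent_space A p"
    and f: "in_chart c f differentiable at (snd c p)"
  shows "deriv_along A p v f = dd (v c) (in_chart c f) (snd c p)"
proof -
  define d where "d = (SOME d. d \<in> A \<and> p \<in> fst d)"
  have d: "d \<in> A" "p \<in> fst d" using someI[of "\<lambda>d. d \<in> A \<and> p \<in> fst d" c] c by (auto simp: d_def)
  have "v c = dd (v d) (transition d c) (snd d p)"
    by (rule tangent_spaceD[OF v d(1) c(1) d(2) c(2)])
  then show ?thesis
    using dd_in_chart[OF c(1) d(1) c(2) d(2) f, of "v d"] by (simp add: deriv_along_def Let_def d_def)
qed

lemma vector_fields_subset:
  "X \<in> vector_fields A W \<Longrightarrow> W' \<subseteq> W \<Longrightarrow> X \<in> vector_fields A W'"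
  unfolding vector_fields_def by (auto intro: smooth_on_subset)

text \<open>The inverse of the map that takes a tangent vector at a point of the domain of \<open>c\<close> to its
  components in \<open>c\<close>.\<close>

definition tvec :: "('a, 'e) chart \<Rightarrow> 'a \<Rightarrow> 'e \<Rightarrow> ('a, 'e) tvec"
  where "tvec c q v = (\<lambda>d. if d \<in> A \<and> q \<in> fst d then dd v (transition c d) (snd c q) else 0)"

context
  fixes c assumes c: "c \<in> A"
begin

lemma tvec_in:
  assumes q: "q \<in> fst c"
  shows "tvec c q v \<in> tangent_space A q"
proof -
  have tv: "tvec c q v d = dd v (transition c d) (snd c q)" if "d \<in> A" "q \<in> fst d" for d
    using that by (simp add: tvec_def)
  show ?thesis
    unfolding tangent_space_def mem_Collect_eq
  proof (intro conjI ballI allI impI)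
    fix e d assume ed: "e \<in> A" "d \<in> A" "q \<in> fst e" "q \<in> fst d"
    show "tvec c q v d = dd (tvec c q v e) (transition e d) (snd e q)"
      unfolding tv[OF ed(1,3)] tv[OF ed(2,4)]
      by (rule dd_in_chart[OF ed(1) c ed(3) q differentiable_transition[OF ed]])
  qed (auto simp: tvec_def)
qed

lemma tvec_component: "q \<in> fst c \<Longrightarrow> tvec c q v c = v"
  by (simp add: tvec_def c dd_transition_self[OF c])

lemma tvec_eq:
  assumes q: "q \<in> fst c" and t: "t \<in> tangent_space A q"
  shows "tvec c q (t c) = t"
proof
  fix d
  show "tvec c q (t c) d = t d"
  proof (cases "d \<in> A \<and> q \<in> fst d")
    case True
    then show ?thesis using tangent_spaceD[OF t c, of d] q by (simp add: tvec_def)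
  next
    case False
    then have "t d = 0" using t unfolding tangent_space_def by blast
    then show ?thesis using False unfolding tvec_def by auto
  qed
qed

lemma tangent_eqI:
  "q \<in> fst c \<Longrightarrow> t \<in> tangent_space A q \<Longrightarrow> s \<in> tangent_space A q \<Longrightarrow> t c = s c \<Longrightarrow> t = s"
  by (metis tvec_eq)

lemma linear_tvec:
  assumes q: "q \<in> fst c"
  shows "linear (tvec c q)"
proof -
  have lin: "linear (\<lambda>v. dd v (transition c d) (snd c q))" if "d \<in> A" "q \<in> fst d" for d
    by (rule linear_dd[OF differentiable_transition[OF c that(1) q that(2)]])
  show ?thesis
  proof (rule linearI)
    show "tvec c q (v + w) = tvec c q v + tvec c q w" for v w
      using linear_add[OF lin, of _ v w] by (auto simp add: tvec_def fun_eq_iff)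
    show "tvec c q (r *\<^sub>R v) = r *\<^sub>R tvec c q v" for r v
      using linear_scale[OF lin, of _ r v] by (auto simp add: tvec_def fun_eq_iff scaleR_fun_def)
  qed
qed

lemma tangent_space_eq:
  assumes q: "q \<in> fst c"
  shows "tangent_space A q = range (tvec c q)"
proof
  show "tangent_space A q \<subseteq> range (tvec c q)"
    using tvec_eq[OF q] by (metis rangeI subsetI)
  show "range (tvec c q) \<subseteq> tangent_space A q"
    using tvec_in[OF q] by blast
qed

lemma tangent_space_subspace: "q \<in> fst c \<Longrightarrow> subspace (tangent_space A q)"
  using linear_subspace_image[OF linear_tvec subspace_UNIV] by (simp add: tangent_space_eq)

text \<open>A smooth map of the coordinates is the coordinate expression of a smooth vector field: in
  another chart the field is obtained by applying the derivative of the change of charts.\<close>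

lemma tvec_field:
  assumes W: "openin M W" "W \<subseteq> fst c" and F: "smooth_on (snd c ` W) F"
  shows "(\<lambda>q. tvec c q (F (snd c q))) \<in> vector_fields A W"
proof -
  have "smooth_on (snd d ` (fst d \<inter> W)) (in_chart d (\<lambda>q. tvec c q (F (snd c q)) d))" if d: "d \<in> A" for d
  proof -
    define W' where "W' = W \<inter> fst d"
    have W': "openin M W'" "W' \<subseteq> fst c" "W' \<subseteq> W" "W' \<subseteq> fst d"
      using W openin_chart[OF d] by (auto simp: W'_def)
    have op: "open (snd c ` W')" using open_chart_image[OF c W'(1)] W'(2) by (simp add: inf.absorb2)
    have sub: "smooth_on (snd c ` W') (transition c d)"
      by (rule smooth_on_subset[OF smooth_transition[OF c d]]) (use W' in auto)
    have "smooth_on (snd c ` W') (\<lambda>y. dd (F y) (transition c d) y)"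
    proof (rule smooth_on_apply[OF op, of "\<lambda>y v. dd v (transition c d) y"])
      show "linear (\<lambda>v. dd v (transition c d) y)" if "y \<in> snd c ` W'" for y
        by (rule linear_dd[OF smooth_on_differentiable[OF sub that]])
      show "smooth_on (snd c ` W') (dd v (transition c d))" for v by (rule smooth_on_dd[OF sub])
      show "smooth_on (snd c ` W') F" by (rule smooth_on_subset[OF F]) (use W' in auto)
    qed
    then have "smooth_on (snd c ` W') (in_chart c (\<lambda>q. tvec c q (F (snd c q)) d))"
    proof (rule smooth_on_cong[OF op, rotated])
      fix y assume "y \<in> snd c ` W'"
      then obtain q where q: "y = snd c q" "q \<in> W'" by auto
      have "q \<in> fst c" "q \<in> fst d" using q(2) W' by blast+
      then show "dd (F y) (transition c d) y = in_chart c (\<lambda>q. tvec c q (F (snd c q)) d) y"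
        unfolding q(1) in_chart_at[OF c \<open>q \<in> fst c\<close>] using d by (simp add: tvec_def)
    qed
    from smooth_in_chart[OF c d W'(1,2) this] show ?thesis
      by (rule smooth_on_subset) (auto simp: W'_def)
  qed
  then show ?thesis using tvec_in W by (auto simp: vector_fields_def)
qed

lemma const_field: "openin M W \<Longrightarrow> W \<subseteq> fst c \<Longrightarrow> (\<lambda>q. tvec c q v) \<in> vector_fields A W"
  using tvec_field[of W "\<lambda>_. v"] by (simp add: smooth_on_const)

lemma smooth_component:
  assumes "Y \<in> vector_fields A W" "openin M W" "W \<subseteq> fst c"
  shows "smooth_on (snd c ` W) (in_chart c (\<lambda>q. Y q c))"
  using assms c by (auto simp: vector_fields_def inf.absorb2)

end

end

section \<open>The Levi-Civita connection in a chart\<close>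

text \<open>One chart \<open>c\<close> is fixed from here on. Coordinate vector fields \<open>\<lambda>q. tvec c q v\<close> are defined on all
of its domain, and the given connection, metric and almost complex structure are described by their
action on them.\<close>

locale almost_hermitian_chart = atlas M A
  for M :: "'a topology" and A :: "('a, 'e::euclidean_space) chart set" +
  fixes g :: "('a, 'e) metric" and J :: "('a, 'e) endo_field" and D :: "('a, 'e) connection"
    and c :: "('a, 'e) chart"
  assumes hermitian_manifold: "almost_hermitian_manifold M A g J"
    and levi_civita: "levi_civita_connection M A g D"
    and c: "c \<in> A"
begin

abbreviation "U \<equiv> fst c"
abbreviation "\<kappa> \<equiv> snd c"
abbreviation "S \<equiv> \<kappa> ` U"
abbreviation "\<psi> \<equiv> inv_into U \<kappa>"
abbreviation "L \<equiv> tvec c"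

definition coord_g :: "'e \<Rightarrow> 'e \<Rightarrow> 'e \<Rightarrow> real"
  where "coord_g x a b = g (\<psi> x) (L (\<psi> x) a) (L (\<psi> x) b)"

definition coord_J :: "'e \<Rightarrow> 'e \<Rightarrow> 'e"
  where "coord_J x a = J (\<psi> x) (L (\<psi> x) a) c"

definition christoffel :: "'e \<Rightarrow> 'e \<Rightarrow> 'e \<Rightarrow> 'e"
  where "christoffel x a b = D (\<psi> x) (L (\<psi> x) a) (\<lambda>q. L q b) c"

lemma psi [simp]: "q \<in> U \<Longrightarrow> \<psi> (\<kappa> q) = q"
  using is_chart_inj[OF is_chart[OF c]] by simp

lemma psi_in: "x \<in> S \<Longrightarrow> \<psi> x \<in> U"
  by (rule inv_into_into)

lemma kappa_psi [simp]: "x \<in> S \<Longrightarrow> \<kappa> (\<psi> x) = x"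
  by (rule f_inv_into_f)

lemma openin_U: "openin M U"
  by (rule openin_chart[OF c])

lemma U_subset: "q \<in> U \<Longrightarrow> q \<in> topspace M"
  using openin_subset[OF openin_U] by blast

lemma open_kappa: "openin M W \<Longrightarrow> W \<subseteq> U \<Longrightarrow> open (\<kappa> ` W)"
  using open_chart_image[OF c] by (metis inf.absorb2)

lemma open_S: "open S"
  by (rule open_kappa[OF openin_U]) simp

lemma metric_rules:
  assumes "p \<in> topspace M" "x \<in> tangent_space A p" "y \<in> tangent_space A p" "z \<in> tangent_space A p"
  shows "g p (x + y) z = g p x z + g p y z" "g p (r *\<^sub>R x) z = r * g p x z" "g p x y = g p y x"
    "x \<noteq> 0 \<Longrightarrow> g p x x > 0"
proof -
  have "\<forall>p\<in>topspace M. \<forall>x\<in>tangent_space A p. \<forall>y\<in>tangent_space A p. \<forall>z\<in>tangent_space A p. \<forall>a.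
       g p (x + y) z = g p x z + g p y z \<and> g p (a *\<^sub>R x) z = a * g p x z \<and>
       g p x y = g p y x \<and> (x \<noteq> 0 \<longrightarrow> g p x x > 0)"
    using hermitian_manifold unfolding almost_hermitian_manifold_def riemannian_metric_def by (elim conjE)
  note * = this[rule_format, OF assms, of r]
  show "g p (x + y) z = g p x z + g p y z" "g p (r *\<^sub>R x) z = r * g p x z" "g p x y = g p y x"
    "x \<noteq> 0 \<Longrightarrow> g p x x > 0"
    using * by simp_all
qed

lemma metric_smooth:
  assumes "openin M W" "X \<in> vector_fields A W" "Y \<in> vector_fields A W"
  shows "smooth_fun_on A W (\<lambda>p. g p (X p) (Y p))"
proof -
  have "\<forall>W. openin M W \<longrightarrow> (\<forall>X\<in>vector_fields A W. \<forall>Y\<in>vector_fields A W.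
       smooth_fun_on A W (\<lambda>p. g p (X p) (Y p)))"
    using hermitian_manifold unfolding almost_hermitian_manifold_def riemannian_metric_def by (elim conjE)
  then show ?thesis using assms by blast
qed

lemma J_rules:
  assumes "p \<in> topspace M" "x \<in> tangent_space A p" "y \<in> tangent_space A p"
  shows "J p x \<in> tangent_space A p" "J p (x + y) = J p x + J p y" "J p (r *\<^sub>R x) = r *\<^sub>R J p x"
    "J p (J p x) = - x" "g p (J p x) (J p y) = g p x y"
proof -
  have "\<forall>p\<in>topspace M. \<forall>x\<in>tangent_space A p. \<forall>y\<in>tangent_space A p. \<forall>a.
       J p x \<in> tangent_space A p \<and> J p (x + y) = J p x + J p y \<and> J p (a *\<^sub>R x) = a *\<^sub>R J p x \<and>
       J p (J p x) = - x"
    using hermitian_manifold unfolding almost_hermitian_manifold_def almost_complex_structure_def by (elim conjE)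
  note * = this[rule_format, OF assms, of r]
  show "J p x \<in> tangent_space A p" "J p (x + y) = J p x + J p y" "J p (r *\<^sub>R x) = r *\<^sub>R J p x"
    "J p (J p x) = - x"
    using * by simp_all
  show "g p (J p x) (J p y) = g p x y"
    using hermitian_manifold assms unfolding almost_hermitian_manifold_def by blast
qed

lemma J_field:
  assumes "openin M W" "X \<in> vector_fields A W"
  shows "(\<lambda>p. J p (X p)) \<in> vector_fields A W"
proof -
  have "\<forall>W. openin M W \<longrightarrow> (\<forall>X\<in>vector_fields A W. (\<lambda>p. J p (X p)) \<in> vector_fields A W)"
    using hermitian_manifold unfolding almost_hermitian_manifold_def almost_complex_structure_def by (elim conjE)
  then show ?thesis using assms by blast
qed

lemma connection_rules:
  assumes "openin M W" "p \<in> W" "v \<in> tangent_space A p" "w \<in> tangent_space A p"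
    "Y \<in> vector_fields A W" "Z \<in> vector_fields A W"
  shows "D p v Y \<in> tangent_space A p" "D p (v + w) Y = D p v Y + D p w Y" "D p (r *\<^sub>R v) Y = r *\<^sub>R D p v Y"
    "D p v (\<lambda>q. Y q + Z q) = D p v Y + D p v Z"
    "smooth_fun_on A W f \<Longrightarrow> D p v (\<lambda>q. f q *\<^sub>R Y q) = deriv_along A p v f *\<^sub>R Y p + f p *\<^sub>R D p v Y"
    "(\<forall>q\<in>W. Y q = Z q) \<Longrightarrow> D p v Y = D p v Z"
proof -
  have aff: "affine_connection M A D"
    using levi_civita unfolding levi_civita_connection_def by (elim conjE)
  have "\<forall>p\<in>W. \<forall>v\<in>tangent_space A p. \<forall>w\<in>tangent_space A p. \<forall>a.
       \<forall>Y\<in>vector_fields A W. \<forall>Z\<in>vector_fields A W.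
       D p v Y \<in> tangent_space A p \<and>
       D p (v + w) Y = D p v Y + D p w Y \<and>
       D p (a *\<^sub>R v) Y = a *\<^sub>R D p v Y \<and>
       D p v (\<lambda>q. Y q + Z q) = D p v Y + D p v Z \<and>
       (\<forall>f. smooth_fun_on A W f \<longrightarrow>
          D p v (\<lambda>q. f q *\<^sub>R Y q) = deriv_along A p v f *\<^sub>R Y p + f p *\<^sub>R D p v Y) \<and>
       ((\<forall>q\<in>W. Y q = Z q) \<longrightarrow> D p v Y = D p v Z)"
    by (rule mp[OF spec[OF aff[unfolded affine_connection_def]] assms(1), THEN conjunct1])
  note * = this[rule_format, OF assms(2-6)]
  show "D p v Y \<in> tangent_space A p" "D p (v + w) Y = D p v Y + D p w Y" "D p (r *\<^sub>R v) Y = r *\<^sub>R D p v Y"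
    "D p v (\<lambda>q. Y q + Z q) = D p v Y + D p v Z"
    "smooth_fun_on A W f \<Longrightarrow> D p v (\<lambda>q. f q *\<^sub>R Y q) = deriv_along A p v f *\<^sub>R Y p + f p *\<^sub>R D p v Y"
    "(\<forall>q\<in>W. Y q = Z q) \<Longrightarrow> D p v Y = D p v Z"
    using *[of r] by blast+
qed

lemma connection_field:
  assumes "openin M W" "X \<in> vector_fields A W" "Y \<in> vector_fields A W"
  shows "(\<lambda>p. D p (X p) Y) \<in> vector_fields A W"
proof -
  have aff: "affine_connection M A D"
    using levi_civita unfolding levi_civita_connection_def by (elim conjE)
  have "\<forall>X\<in>vector_fields A W. \<forall>Y\<in>vector_fields A W. (\<lambda>p. D p (X p) Y) \<in> vector_fields A W"
    by (rule mp[OF spec[OF aff[unfolded affine_connection_def]] assms(1), THEN conjunct2])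
  then show ?thesis using assms(2,3) by blast
qed

lemma torsion_free:
  assumes "openin M W" "p \<in> W" "X \<in> vector_fields A W" "Y \<in> vector_fields A W"
  shows "D p (X p) Y - D p (Y p) X = lie_bracket A X Y p"
proof -
  have "\<forall>W. openin M W \<longrightarrow> (\<forall>p\<in>W. \<forall>X\<in>vector_fields A W. \<forall>Y\<in>vector_fields A W.
       D p (X p) Y - D p (Y p) X = lie_bracket A X Y p)"
    using levi_civita unfolding levi_civita_connection_def by (elim conjE)
  from this[rule_format, OF assms] show ?thesis .
qed

lemma metric_connection:
  assumes "openin M W" "p \<in> W" "v \<in> tangent_space A p" "Y \<in> vector_fields A W" "Z \<in> vector_fields A W"
  shows "deriv_along A p v (\<lambda>q. g q (Y q) (Z q)) = g p (D p v Y) (Z p) + g p (Y p) (D p v Z)"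
proof -
  have "\<forall>W. openin M W \<longrightarrow> (\<forall>p\<in>W. \<forall>v\<in>tangent_space A p.
       \<forall>Y\<in>vector_fields A W. \<forall>Z\<in>vector_fields A W.
       deriv_along A p v (\<lambda>q. g q (Y q) (Z q)) = g p (D p v Y) (Z p) + g p (Y p) (D p v Z))"
    using levi_civita unfolding levi_civita_connection_def by (elim conjE)
  from this[rule_format, OF assms] show ?thesis .
qed

lemma vector_field_tangent: "X \<in> vector_fields A W \<Longrightarrow> p \<in> W \<Longrightarrow> X p \<in> tangent_space A p"
  by (simp add: vector_fields_def)

lemma L_in [simp]: "q \<in> U \<Longrightarrow> L q v \<in> tangent_space A q"
  by (rule tvec_in[OF c])

lemma L_component [simp]: "q \<in> U \<Longrightarrow> L q v c = v"
  by (rule tvec_component[OF c])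

lemma L_eq: "q \<in> U \<Longrightarrow> t \<in> tangent_space A q \<Longrightarrow> L q (t c) = t"
  by (rule tvec_eq[OF c])

lemma L_linear:
  assumes "q \<in> U"
  shows "L q (a + b) = L q a + L q b" "L q (r *\<^sub>R a) = r *\<^sub>R L q a" "L q 0 = 0" "L q (- a) = - L q a"
  using linear_tvec[OF c assms] by (simp_all add: linear_add linear_scale linear_0 linear_neg)

lemma L_field: "openin M W \<Longrightarrow> W \<subseteq> U \<Longrightarrow> (\<lambda>q. L q v) \<in> vector_fields A W"
  by (rule const_field[OF c])

lemma component_rules: "(s + t) c = s c + t c" "(s - t) c = s c - t c" "(- s) c = - s c" "(r *\<^sub>R s) c = r *\<^sub>R s c"
  for s t :: "('a, 'e) tvec"
  by (simp_all add: scaleR_fun_def)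

lemma smooth_fun:
  fixes f :: "'a \<Rightarrow> real"
  assumes "openin M W" "W \<subseteq> U" "smooth_on (\<kappa> ` W) (in_chart c f)"
  shows "smooth_fun_on A W f"
  unfolding smooth_fun_on_def using smooth_in_chart[OF c _ assms] by blast

lemma christoffel_at: "p \<in> U \<Longrightarrow> christoffel (\<kappa> p) a b = D p (L p a) (\<lambda>q. L q b) c"
  by (simp add: christoffel_def)

lemma christoffel_linear_left: "x \<in> S \<Longrightarrow> linear (\<lambda>a. christoffel x a b)"
  using connection_rules(2,3)[OF openin_U psi_in L_in L_in L_field[OF openin_U] L_field[OF openin_U]] 
  by (intro linearI) (simp_all add: christoffel_def L_linear[OF psi_in] component_rules psi_in)

lemma vector_fields_cong:
  assumes X: "X \<in> vector_fields A W" and W: "openin M W" and eq: "\<And>q. q \<in> W \<Longrightarrow> X q = Y q"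
  shows "Y \<in> vector_fields A W"
proof -
  have "smooth_on (snd d ` (fst d \<inter> W)) (in_chart d (\<lambda>q. Y q d))" if d: "d \<in> A" for d
  proof (rule smooth_on_cong[OF open_chart_image[OF d W]])
    show "smooth_on (snd d ` (fst d \<inter> W)) (in_chart d (\<lambda>q. X q d))"
      using X d by (simp add: vector_fields_def)
    show "in_chart d (\<lambda>q. X q d) y = in_chart d (\<lambda>q. Y q d) y" if "y \<in> snd d ` (fst d \<inter> W)" for y
    proof -
      from that obtain q where q: "y = snd d q" "q \<in> fst d" "q \<in> W" by blast
      then show ?thesis by (simp add: in_chart_at[OF d] eq)
    qed
  qed
  then show ?thesis using X eq by (auto simp: vector_fields_def)
qed

text \<open>Fields that agree on \<open>W\<close> are interchangeable, although their values off \<open>W\<close>, where \<open>tvec\<close> is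
unspecified, may differ.\<close>

lemma connection_cong:
  assumes "openin M W" "p \<in> W" "v \<in> tangent_space A p" "Y \<in> vector_fields A W" "\<And>q. q \<in> W \<Longrightarrow> Y q = Z q"
  shows "D p v Y = D p v Z"
  using connection_rules(6)[OF assms(1-3) assms(3) assms(4) vector_fields_cong[OF assms(4,1,5)]] assms(5) by blast

text \<open>A vector field is the sum of its components times coordinate fields, so the Leibniz rule
  expresses the connection through the Christoffel symbols.\<close>

lemma connection_lift:
  assumes W: "openin M W" "W \<subseteq> U" and p: "p \<in> W" and v: "v \<in> tangent_space A p"
    and F: "smooth_on (\<kappa> ` W) F" and B: "finite B"
  shows "D p v (\<lambda>q. L q (\<Sum>b\<in>B. (F (\<kappa> q) \<bullet> b) *\<^sub>R b)) c
    = (\<Sum>b\<in>B. (dd (v c) F (\<kappa> p) \<bullet> b) *\<^sub>R b + (F (\<kappa> p) \<bullet> b) *\<^sub>R christoffel (\<kappa> p) (v c) b)"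
  using B
proof (induction B rule: finite_induct)
  case empty
  let ?Z = "\<lambda>q. L q 0"
  have Z: "?Z \<in> vector_fields A W" by (rule L_field[OF W])
  have "D p v ?Z = D p v (\<lambda>q. ?Z q + ?Z q)"
    by (rule connection_cong[OF W(1) p v Z]) (use W L_linear(3) in auto)
  also have "\<dots> = D p v ?Z + D p v ?Z"
    by (rule connection_rules(4)[OF W(1) p v v Z Z])
  finally have "D p v ?Z = 0" by simp
  then show ?case by simp
next
  case (insert b B)
  have opW: "open (\<kappa> ` W)" by (rule open_kappa[OF W])
  have pU: "p \<in> U" using p W by blast
  define f where "f q = F (\<kappa> q) \<bullet> b" for q
  have f_smooth: "smooth_on (\<kappa> ` W) (in_chart c f)"
  proof (rule smooth_on_cong[OF opW])
    show "smooth_on (\<kappa> ` W) (\<lambda>x. F x \<bullet> b)" by (intro smooth_on_inner opW F smooth_on_const)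
    show "F x \<bullet> b = in_chart c f x" if "x \<in> \<kappa> ` W" for x
      using that W by (auto simp: in_chart_def f_def)
  qed
  have f_deriv: "deriv_along A p v f = dd (v c) F (\<kappa> p) \<bullet> b"
  proof -
    have "deriv_along A p v f = dd (v c) (in_chart c f) (\<kappa> p)"
      by (rule deriv_along_chart[OF c pU v smooth_on_differentiable[OF f_smooth]]) (use p in blast)
    also have "\<dots> = dd (v c) (\<lambda>x. F x \<bullet> b) (\<kappa> p)"
      by (rule dd_cong[OF opW]) (use p W in \<open>auto simp: in_chart_def f_def\<close>)
    also have "\<dots> = dd (v c) F (\<kappa> p) \<bullet> b"
      by (rule dd_inner_left[OF smooth_on_differentiable[OF F]]) (use p in blast)
    finally show ?thesis .
  qed
  let ?X = "\<lambda>q. L q (\<Sum>b\<in>B. (F (\<kappa> q) \<bullet> b) *\<^sub>R b)"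
  have X: "?X \<in> vector_fields A W"
    using tvec_field[OF c W, of "\<lambda>x. \<Sum>b\<in>B. (F x \<bullet> b) *\<^sub>R b"]
    by (simp add: smooth_on_sum smooth_on_scaleR smooth_on_inner smooth_on_const opW F)
  have "(\<lambda>q. L q ((F (\<kappa> q) \<bullet> b) *\<^sub>R b)) \<in> vector_fields A W"
    using tvec_field[OF c W, of "\<lambda>x. (F x \<bullet> b) *\<^sub>R b"]
    by (simp add: smooth_on_scaleR smooth_on_inner smooth_on_const opW F)
  then have Y: "(\<lambda>q. f q *\<^sub>R L q b) \<in> vector_fields A W"
    by (rule vector_fields_cong[OF _ W(1)]) (use W L_linear(2) in \<open>auto simp: f_def\<close>)
  have eq: "L q (\<Sum>b\<in>insert b B. (F (\<kappa> q) \<bullet> b) *\<^sub>R b) = ?X q + f q *\<^sub>R L q b" if "q \<in> W" for q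
  proof -
    have q: "q \<in> U" using that W by blast
    show ?thesis using insert.hyps by (simp add: L_linear[OF q] f_def add.commute)
  qed
  have all: "(\<lambda>q. L q (\<Sum>b\<in>insert b B. (F (\<kappa> q) \<bullet> b) *\<^sub>R b)) \<in> vector_fields A W"
    using tvec_field[OF c W, of "\<lambda>x. \<Sum>b\<in>insert b B. (F x \<bullet> b) *\<^sub>R b"]
      smooth_on_sum[OF opW, of "insert b B" "\<lambda>b x. (F x \<bullet> b) *\<^sub>R b"]
    by (simp only: smooth_on_scaleR smooth_on_inner smooth_on_const opW F)
  have "D p v (\<lambda>q. L q (\<Sum>b\<in>insert b B. (F (\<kappa> q) \<bullet> b) *\<^sub>R b)) = D p v (\<lambda>q. ?X q + f q *\<^sub>R L q b)"
    by (rule connection_cong[OF W(1) p v all eq])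
  also have "\<dots> = D p v ?X + D p v (\<lambda>q. f q *\<^sub>R L q b)"
    by (rule connection_rules(4)[OF W(1) p v v X Y])
  also have "D p v (\<lambda>q. f q *\<^sub>R L q b) = deriv_along A p v f *\<^sub>R L p b + f p *\<^sub>R D p v (\<lambda>q. L q b)"
    by (rule connection_rules(5)[OF W(1) p v v L_field[OF W] L_field[OF W] smooth_fun[OF W f_smooth]])
  finally have "D p v (\<lambda>q. L q (\<Sum>b\<in>insert b B. (F (\<kappa> q) \<bullet> b) *\<^sub>R b)) c
      = D p v ?X c + (deriv_along A p v f *\<^sub>R b + f p *\<^sub>R D p v (\<lambda>q. L q b) c)"
    by (simp add: component_rules pU)
  moreover have "D p v (\<lambda>q. L q b) c = christoffel (\<kappa> p) (v c) b"
    using L_eq[OF pU v] by (simp add: christoffel_at[OF pU])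
  ultimately show ?case
    using insert.hyps insert.IH by (simp add: f_deriv f_def add.commute)
qed

text \<open>Linearity of the Christoffel symbols in the second argument comes from applying \<open>connection_lift\<close> to
a constant field.\<close>

lemma christoffel_expand:
  assumes x: "x \<in> S"
  shows "christoffel x a w = (\<Sum>b\<in>Basis. (w \<bullet> b) *\<^sub>R christoffel x a b)"
proof -
  have p: "\<psi> x \<in> U" by (rule psi_in[OF x])
  show ?thesis
    using connection_lift[OF openin_U subset_refl p L_in[OF p, of a] smooth_on_const finite_Basis, of w] x
    by (simp add: euclidean_representation L_component[OF p] christoffel_def)
qed

lemma bilinear_christoffel:
  assumes x: "x \<in> S"
  shows "bilinear (christoffel x)"
proof -
  have "linear (christoffel x a)" for a
  proof (rule linearI)
    show "christoffel x a (v + w) = christoffel x a v + christoffel x a w" for v w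
      by (subst (1 2 3) christoffel_expand[OF x]) (simp add: inner_add_left scaleR_add_left sum.distrib)
    show "christoffel x a (r *\<^sub>R v) = r *\<^sub>R christoffel x a v" for r v
      by (subst (1 2) christoffel_expand[OF x]) (simp add: scaleR_sum_right)
  qed
  then show ?thesis using christoffel_linear_left[OF x] by (simp add: bilinear_def)
qed

lemma connection_coordinates:
  assumes W: "openin M W" "W \<subseteq> U" and p: "p \<in> W" and v: "v \<in> tangent_space A p"
    and Y: "Y \<in> vector_fields A W"
  shows "D p v Y c = dd (v c) (in_chart c (\<lambda>q. Y q c)) (\<kappa> p) + christoffel (\<kappa> p) (v c) (Y p c)"
proof -
  define F where "F = in_chart c (\<lambda>q. Y q c)"
  have F: "smooth_on (\<kappa> ` W) F" unfolding F_def by (rule smooth_component[OF c Y W])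
  have F_at: "F (\<kappa> q) = Y q c" if "q \<in> U" for q
    unfolding F_def by (rule in_chart_at[OF c that])
  have pU: "p \<in> U" using p W by blast
  have eq: "Y q = L q (\<Sum>b\<in>Basis. (F (\<kappa> q) \<bullet> b) *\<^sub>R b)" if "q \<in> W" for q
  proof -
    have q: "q \<in> U" using that W by blast
    show ?thesis
      using L_eq[OF q vector_field_tangent[OF Y that]] by (simp add: euclidean_representation F_at[OF q])
  qed
  have "D p v Y = D p v (\<lambda>q. L q (\<Sum>b\<in>Basis. (F (\<kappa> q) \<bullet> b) *\<^sub>R b))"
    by (rule connection_cong[OF W(1) p v Y eq])
  then have "D p v Y c = (\<Sum>b\<in>Basis. (dd (v c) F (\<kappa> p) \<bullet> b) *\<^sub>R b + (F (\<kappa> p) \<bullet> b) *\<^sub>R christoffel (\<kappa> p) (v c) b)"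
    by (simp only: connection_lift[OF W p v F finite_Basis])
  also have "\<dots> = dd (v c) F (\<kappa> p) + christoffel (\<kappa> p) (v c) (Y p c)"
    using christoffel_expand[of "\<kappa> p" "v c" "Y p c"] pU
    by (simp only: sum.distrib euclidean_representation F_at[OF pU] imageI)
  finally show ?thesis by (simp only: F_def)
qed

end

section \<open>Curvature and Bochner tensor in a chart\<close>

context almost_hermitian_chart
begin

lemma J_at:
  assumes "p \<in> U" "t \<in> tangent_space A p"
  shows "J p t c = coord_J (\<kappa> p) (t c)" "J p t = L p (coord_J (\<kappa> p) (t c))"
proof -
  show 1: "J p t c = coord_J (\<kappa> p) (t c)"
    using assms by (simp add: coord_J_def L_eq)
  show "J p t = L p (coord_J (\<kappa> p) (t c))"
    using L_eq[OF assms(1) J_rules(1)[OF U_subset[OF assms(1)] assms(2) assms(2)]] by (simp add: 1)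
qed

lemma g_at:
  assumes "p \<in> U" "s \<in> tangent_space A p" "t \<in> tangent_space A p"
  shows "g p s t = coord_g (\<kappa> p) (s c) (t c)"
  using assms by (simp add: coord_g_def L_eq)

lemma coord_hermitian:
  assumes x: "x \<in> S"
  shows "hermitian_space (coord_g x) (coord_J x)"
proof -
  define p where "p = \<psi> x"
  have p: "p \<in> U" "x = \<kappa> p" using x psi_in by (simp_all add: p_def)
  have pM: "p \<in> topspace M" by (rule U_subset[OF p(1)])
  note T = L_in[OF p(1)]
  have G: "coord_g x a b = g p (L p a) (L p b)" for a b by (simp add: coord_g_def p_def)
  have sym: "coord_g x a b = coord_g x b a" for a b
    unfolding G by (rule metric_rules(3)[OF pM T T T])
  have add: "coord_g x (a + b) d = coord_g x a d + coord_g x b d" for a b d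
    unfolding G L_linear[OF p(1)] by (rule metric_rules(1)[OF pM T T T])
  have scale: "coord_g x (r *\<^sub>R a) d = r * coord_g x a d" for r a d
    unfolding G L_linear[OF p(1)] by (rule metric_rules(2)[OF pM T T T])
  have add_right: "coord_g x d (a + b) = coord_g x d a + coord_g x d b" for a b d
    using add[of a b d] by (simp only: sym[of d])
  have scale_right: "coord_g x d (r *\<^sub>R a) = r * coord_g x d a" for r a d
    using scale[of r a d] by (simp only: sym[of d])
  have Jc: "L p (coord_J x a) = J p (L p a)" for a
    using J_at(2)[OF p(1) T] by (simp add: p)
  have comp: "coord_J x a = J p (L p a) c" for a by (simp add: coord_J_def p_def)
  show ?thesis
  proof (rule hermitian_space.intro)
    show "bilinear (coord_g x)"
      unfolding bilinear_def by (auto intro!: linearI simp: add scale add_right scale_right)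
    show "coord_g x a b = coord_g x b a" for a b by (rule sym)
    show "0 < coord_g x a a" if "a \<noteq> 0" for a
    proof -
      have "L p a \<noteq> 0" using that L_component[OF p(1), of a] by auto
      then show ?thesis unfolding G by (rule metric_rules(4)[OF pM T T T])
    qed
    show "linear (coord_J x)"
      by (rule linearI) (simp_all add: comp L_linear[OF p(1)] J_rules[OF pM T T] component_rules)
    show "coord_J x (coord_J x a) = - a" for a
      unfolding comp[of "coord_J x a"] Jc by (simp add: J_rules(4)[OF pM T T] component_rules p)
    show "coord_g x (coord_J x a) (coord_J x b) = coord_g x a b" for a b
      unfolding G Jc by (rule J_rules(5)[OF pM T T])
  qed
qed

lemma lie_bracket_coordinates:
  assumes "p \<in> U"
  shows "lie_bracket A X Y p c = dd (X p c) (in_chart c (\<lambda>q. Y q c)) (\<kappa> p)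
    - dd (Y p c) (in_chart c (\<lambda>q. X q c)) (\<kappa> p)"
  using assms c by (simp add: lie_bracket_def)

lemma coordinate_field: "x \<in> S \<Longrightarrow> dd v (in_chart c (\<lambda>q. L q w c)) x = 0"
proof -
  assume x: "x \<in> S"
  have "dd v (in_chart c (\<lambda>q. L q w c)) x = dd v (\<lambda>_. w) x"
    by (rule dd_cong[OF open_S x]) (simp add: in_chart_def psi_in)
  then show ?thesis by simp
qed

sublocale hermitian_chart S coord_g coord_J christoffel
proof (rule hermitian_chart.intro)
  show "open S" by (rule open_S)
  show "hermitian_space (coord_g x) (coord_J x)" if "x \<in> S" for x by (rule coord_hermitian[OF that])
  show "bilinear (christoffel x)" if "x \<in> S" for x by (rule bilinear_christoffel[OF that])
  have field: "(\<lambda>q. L q a) \<in> vector_fields A U" for a by (rule L_field[OF openin_U]) simp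
  show "christoffel x a b = christoffel x b a" if x: "x \<in> S" for x a b
  proof -
    note p = psi_in[OF x]
    have "D (\<psi> x) (L (\<psi> x) a) (\<lambda>q. L q b) - D (\<psi> x) (L (\<psi> x) b) (\<lambda>q. L q a)
        = lie_bracket A (\<lambda>q. L q a) (\<lambda>q. L q b) (\<psi> x)"
      by (rule torsion_free[OF openin_U p field field])
    from fun_cong[OF this, of c]
    have "christoffel x a b - christoffel x b a = lie_bracket A (\<lambda>q. L q a) (\<lambda>q. L q b) (\<psi> x) c"
      by (simp add: christoffel_def component_rules)
    also have "\<dots> = 0"
      unfolding lie_bracket_coordinates[OF p] by (simp add: coordinate_field x p)
    finally show ?thesis by simp
  qed
  show "smooth_on S (\<lambda>y. coord_g y a b)" for a b
    using metric_smooth[OF openin_U field field, of a b] c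
    by (auto simp: smooth_fun_on_def in_chart_def o_def coord_g_def)
  show "smooth_on S (\<lambda>y. coord_J y a)" for a
    using J_field[OF openin_U field, of a] c
    by (auto simp: vector_fields_def in_chart_def o_def coord_J_def)
  show "smooth_on S (\<lambda>y. christoffel y a b)" for a b
    using connection_field[OF openin_U field field, of a b] c
    by (auto simp: vector_fields_def in_chart_def o_def christoffel_def)
  then show "dd v (\<lambda>y. coord_g y a b) x
      = coord_g x (christoffel x v a) b + coord_g x a (christoffel x v b)" if x: "x \<in> S" for v a b x
  proof -
    define p where "p = \<psi> x"
    have p: "p \<in> U" "\<kappa> p = x" using x psi_in by (simp_all add: p_def)
    have G: "in_chart c (\<lambda>q. g q (L q a) (L q b)) = (\<lambda>y. coord_g y a b)"
      by (simp add: in_chart_def o_def coord_g_def)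
    have "smooth_on S (\<lambda>y. coord_g y a b)"
      using metric_smooth[OF openin_U field field, of a b] c
      by (auto simp: smooth_fun_on_def in_chart_def o_def coord_g_def)
    then have "in_chart c (\<lambda>q. g q (L q a) (L q b)) differentiable at (\<kappa> p)"
      unfolding G p(2) by (rule smooth_on_differentiable[OF _ x])
    from deriv_along_chart[OF c p(1) L_in[OF p(1), of v] this]
    have "dd v (\<lambda>y. coord_g y a b) x = deriv_along A p (L p v) (\<lambda>q. g q (L q a) (L q b))"
      by (simp add: G p)
    also have "\<dots> = g p (D p (L p v) (\<lambda>q. L q a)) (L p b) + g p (L p a) (D p (L p v) (\<lambda>q. L q b))"
      by (rule metric_connection[OF openin_U p(1) L_in[OF p(1)] field field])
    also have "\<dots> = coord_g x (christoffel x v a) b + coord_g x a (christoffel x v b)"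
      using connection_rules(1)[OF openin_U p(1) L_in[OF p(1)] L_in[OF p(1)] field field]
      by (simp add: g_at p christoffel_at[OF p(1), unfolded p(2)])
    finally show ?thesis .
  qed
qed

text \<open>In coordinates, the second derivatives of the third field cancel by Schwarz' theorem, and the
  derivatives of the first two fields are absorbed by the bracket.\<close>

lemma curvature_op_coordinates:
  assumes W: "openin M W" "W \<subseteq> U" and p: "p \<in> W"
    and X: "X \<in> vector_fields A W" and Y: "Y \<in> vector_fields A W" and Z: "Z \<in> vector_fields A W"
  shows "curvature_op A D X Y Z p \<in> tangent_space A p"
    and "curvature_op A D X Y Z p c = curv (\<kappa> p) (X p c) (Y p c) (Z p c)"
proof -
  have pU: "p \<in> U" using p W by blast
  define x where "x = \<kappa> p"
  have x: "x \<in> S" "x \<in> \<kappa> ` W" using p pU by (auto simp: x_def)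
  have opW: "open (\<kappa> ` W)" by (rule open_kappa[OF W])
  note sub = subspace_diff[OF tangent_space_subspace[OF c pU]]
  note t = vector_field_tangent[OF _ p]
  have DT: "D p v Y' \<in> tangent_space A p" if "v \<in> tangent_space A p" "Y' \<in> vector_fields A W" for v Y'
    by (rule connection_rules(1)[OF W(1) p that(1) that(1) that(2) that(2)])
  have bracket: "lie_bracket A X Y p \<in> tangent_space A p"
    unfolding torsion_free[OF W(1) p X Y, symmetric] by (intro sub DT t X Y)
  note YZ = connection_field[OF W(1) Y Z] and XZ = connection_field[OF W(1) X Z]
  show "curvature_op A D X Y Z p \<in> tangent_space A p"
    unfolding curvature_op_def by (intro sub DT t X Y Z YZ XZ bracket)
  define F where "F V = in_chart c (\<lambda>q. V q c)" for V :: "'a \<Rightarrow> ('a, 'e) tvec"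
  have smF: "smooth_on (\<kappa> ` W) (F V)" if "V \<in> vector_fields A W" for V
    unfolding F_def by (rule smooth_component[OF c that W])
  have F_at: "F V (\<kappa> q) = V q c" if "q \<in> U" for q V
    unfolding F_def by (rule in_chart_at[OF c that])
  have second: "D p (V p) (\<lambda>q. D q (Y' q) Z) c =
      dd (V p c) (dd (Y' p c) (F Z)) x + dd (dd (V p c) (F Y') x) (F Z) x
      + (dd (V p c) (\<lambda>y. christoffel y (Y' p c) (Z p c)) x
        + christoffel x (dd (V p c) (F Y') x) (Z p c) + christoffel x (Y' p c) (dd (V p c) (F Z) x))
      + christoffel x (V p c) (dd (Y' p c) (F Z) x + christoffel x (Y' p c) (Z p c))"
    if V: "V \<in> vector_fields A W" and Y': "Y' \<in> vector_fields A W" for V Y'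
  proof -
    have FD: "F (\<lambda>q. D q (Y' q) Z) y = dd (F Y' y) (F Z) y + christoffel y (F Y' y) (F Z y)"
      if y: "y \<in> \<kappa> ` W" for y
    proof -
      from y obtain q where q: "y = \<kappa> q" "q \<in> W" by blast
      then have qU: "q \<in> U" using W by blast
      show ?thesis
        unfolding q(1) F_at[OF qU]
        using connection_coordinates[OF W q(2) vector_field_tangent[OF Y' q(2)] Z] by (simp add: F_def)
    qed
    have d: "F Z differentiable at x" "F Y' differentiable at x" "dd v (F Z) differentiable at x" for v
      using smooth_on_differentiable[OF smF x(2)] smooth_on_differentiable[OF smooth_on_dd[OF smF] x(2)] Z Y'
      by blast+
    have dC: "(\<lambda>y. christoffel y a b) differentiable at x" for a b by (rule diff_C[OF x(1)])
    have SW: "y \<in> S" if "y \<in> \<kappa> ` W" for y using that W by blast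
    have lin: "linear (\<lambda>v. dd v (F Z) y)" if "y \<in> \<kappa> ` W" for y
      by (rule linear_dd[OF smooth_on_differentiable[OF smF[OF Z] that]])
    have bil: "bilinear (christoffel y)" if "y \<in> \<kappa> ` W" for y
      by (rule bilinear_christoffel[OF SW[OF that]])
    have e1: "dd v (\<lambda>y. dd (F Y' y) (F Z) y) x = dd v (dd (F Y' x) (F Z)) x + dd (dd v (F Y') x) (F Z) x" for v
      by (rule dd_apply[where B = "\<lambda>y v. dd v (F Z) y", OF opW x(2) lin d(3) d(2)])
    have e2: "dd v (\<lambda>y. christoffel y (F Y' y) (F Z y)) x = dd v (\<lambda>y. christoffel y (F Y' x) (F Z x)) x
        + christoffel x (dd v (F Y') x) (F Z x) + christoffel x (F Y' x) (dd v (F Z) x)" for v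
      by (rule dd_apply2[OF opW x(2) bil dC d(2,1)])
    have e3: "dd v (F (\<lambda>q. D q (Y' q) Z)) x = dd v (\<lambda>y. dd (F Y' y) (F Z) y + christoffel y (F Y' y) (F Z y)) x" for v
      by (rule dd_cong[OF opW x(2) FD])
    have e4: "dd v (\<lambda>y. dd (F Y' y) (F Z) y + christoffel y (F Y' y) (F Z y)) x
        = dd v (\<lambda>y. dd (F Y' y) (F Z) y) x + dd v (\<lambda>y. christoffel y (F Y' y) (F Z y)) x" for v
      by (rule dd_add[OF differentiable_apply[where B = "\<lambda>y v. dd v (F Z) y", OF opW x(2) lin d(3) d(2)]
            differentiable_apply2[OF opW x(2) bil dC d(2,1)]])
    have at: "F Y' x = Y' p c" "F Z x = Z p c" unfolding x_def by (rule F_at[OF pU])+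
    have "D p (V p) (\<lambda>q. D q (Y' q) Z) c = dd (V p c) (F (\<lambda>q. D q (Y' q) Z)) x
        + christoffel x (V p c) (D p (Y' p) Z c)"
      using connection_coordinates[OF W p t[OF V] connection_field[OF W(1) Y' Z]] by (simp only: F_def x_def)
    also have "D p (Y' p) Z c = dd (Y' p c) (F Z) x + christoffel x (Y' p c) (Z p c)"
      using connection_coordinates[OF W p t[OF Y'] Z] by (simp only: F_def x_def)
    finally show ?thesis unfolding e3 e4 e1 e2 at .
  qed
  have br: "lie_bracket A X Y p c = dd (X p c) (F Y) x - dd (Y p c) (F X) x"
    unfolding lie_bracket_coordinates[OF pU] F_def x_def ..
  have third: "D p (lie_bracket A X Y p) Z c = dd (dd (X p c) (F Y) x - dd (Y p c) (F X) x) (F Z) x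
      + christoffel x (dd (X p c) (F Y) x - dd (Y p c) (F X) x) (Z p c)"
    using connection_coordinates[OF W p bracket Z] by (simp only: F_def x_def br)
  have schwarz: "dd (X p c) (dd (Y p c) (F Z)) x = dd (Y p c) (dd (X p c) (F Z)) x"
    by (rule dd_commute[OF opW x(2) smF[OF Z]])
  have diff: "dd (v - w) (F Z) x = dd v (F Z) x - dd w (F Z) x" for v w
    by (rule linear_diff[OF linear_dd[OF smooth_on_differentiable[OF smF[OF Z] x(2)]]])
  have "curvature_op A D X Y Z p c = D p (X p) (\<lambda>q. D q (Y q) Z) c - D p (Y p) (\<lambda>q. D q (X q) Z) c
      - D p (lie_bracket A X Y p) Z c"
    by (simp only: curvature_op_def component_rules)
  also have "\<dots> = curv x (X p c) (Y p c) (Z p c)"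
    unfolding second[OF X Y] second[OF Y X] third schwarz diff
    by (simp add: curv_def C_linear[OF x(1)])
  finally show "curvature_op A D X Y Z p c = curv (\<kappa> p) (X p c) (Y p c) (Z p c)"
    by (simp only: x_def)
qed

text \<open>Constant coordinate fields witness that the choice in \<open>field_ext\<close> is from a nonempty set.\<close>

lemma field_ext:
  assumes p: "p \<in> U" and x: "x \<in> tangent_space A p"
  obtains W where "openin M W" "p \<in> W" "field_ext M A p x \<in> vector_fields A W" "field_ext M A p x p = x"
proof -
  have "(\<lambda>q. L q (x c)) p = x \<and> (\<exists>W. openin M W \<and> p \<in> W \<and> (\<lambda>q. L q (x c)) \<in> vector_fields A W)"
    using L_eq[OF p x] L_field[OF openin_U] openin_U p by blast
  from someI[of "\<lambda>X. X p = x \<and> (\<exists>W. openin M W \<and> p \<in> W \<and> X \<in> vector_fields A W)", OF this]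
  show thesis using that unfolding field_ext_def by blast
qed

lemma riemann_tensor_coordinates:
  assumes p: "p \<in> U" and T: "x \<in> tangent_space A p" "y \<in> tangent_space A p" "z \<in> tangent_space A p" "u \<in> tangent_space A p"
  shows "riemann_tensor M A g D p x y z u = coord_g (\<kappa> p) (curv (\<kappa> p) (x c) (y c) (z c)) (u c)"
proof -
  let ?X = "field_ext M A p x" and ?Y = "field_ext M A p y" and ?Z = "field_ext M A p z"
  obtain W1 where W1: "openin M W1" "p \<in> W1" "?X \<in> vector_fields A W1" "?X p = x"
    by (rule field_ext[OF p T(1)])
  obtain W2 where W2: "openin M W2" "p \<in> W2" "?Y \<in> vector_fields A W2" "?Y p = y"
    by (rule field_ext[OF p T(2)])
  obtain W3 where W3: "openin M W3" "p \<in> W3" "?Z \<in> vector_fields A W3" "?Z p = z"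
    by (rule field_ext[OF p T(3)])
  define W where "W = U \<inter> W1 \<inter> W2 \<inter> W3"
  have W: "openin M W" "W \<subseteq> U" "p \<in> W" using W1 W2 W3 openin_U p by (auto simp: W_def)
  have X: "?X \<in> vector_fields A W" by (rule vector_fields_subset[OF W1(3)]) (auto simp: W_def)
  have Y: "?Y \<in> vector_fields A W" by (rule vector_fields_subset[OF W2(3)]) (auto simp: W_def)
  have Z: "?Z \<in> vector_fields A W" by (rule vector_fields_subset[OF W3(3)]) (auto simp: W_def)
  note op = curvature_op_coordinates[OF W X Y Z]
  show ?thesis
    unfolding riemann_tensor_def g_at[OF p op(1) T(4)] op(2) W1(4) W2(4) W3(4) ..
qed

lemma nabla_endo_coordinates:
  assumes p: "p \<in> U" and T: "x \<in> tangent_space A p" "y \<in> tangent_space A p"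
  shows "nabla_endo M A D J p x y \<in> tangent_space A p"
    and "nabla_endo M A D J p x y c = nabla_J (\<kappa> p) (x c) (y c)"
proof -
  let ?Y = "field_ext M A p y"
  obtain W1 where W1: "openin M W1" "p \<in> W1" "?Y \<in> vector_fields A W1" "?Y p = y"
    by (rule field_ext[OF p T(2)])
  define W where "W = U \<inter> W1"
  have W: "openin M W" "W \<subseteq> U" "p \<in> W" using W1 openin_U p by (auto simp: W_def)
  have Y: "?Y \<in> vector_fields A W" by (rule vector_fields_subset[OF W1(3)]) (auto simp: W_def)
  have JY: "(\<lambda>q. J q (?Y q)) \<in> vector_fields A W" by (rule J_field[OF W(1) Y])
  have DT: "D p x Y' \<in> tangent_space A p" if "Y' \<in> vector_fields A W" for Y'
    by (rule connection_rules(1)[OF W(1,3) T(1) T(1) that that])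
  have nabla: "nabla_endo M A D J p x y = D p x (\<lambda>q. J q (?Y q)) - J p (D p x ?Y)"
    by (simp add: nabla_endo_def Let_def)
  show "nabla_endo M A D J p x y \<in> tangent_space A p"
    unfolding nabla
    by (intro subspace_diff[OF tangent_space_subspace[OF c p]] DT JY J_rules(1)[OF U_subset[OF p] _ T(1)] Y)
  define F where "F = in_chart c (\<lambda>q. ?Y q c)"
  have smF: "smooth_on (\<kappa> ` W) F" unfolding F_def by (rule smooth_component[OF c Y W(1,2)])
  have xW: "\<kappa> p \<in> \<kappa> ` W" "\<kappa> p \<in> S" using W p by auto
  have opW: "open (\<kappa> ` W)" by (rule open_kappa[OF W(1,2)])
  have F_at: "F (\<kappa> q) = ?Y q c" if "q \<in> U" for q
    unfolding F_def by (rule in_chart_at[OF c that])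
  have "dd v (in_chart c (\<lambda>q. J q (?Y q) c)) (\<kappa> p) = dd v (\<lambda>x. coord_J x (F x)) (\<kappa> p)" for v
  proof (rule dd_cong[OF opW xW(1)])
    fix x assume "x \<in> \<kappa> ` W"
    then obtain q where q: "x = \<kappa> q" "q \<in> W" by blast
    then have qU: "q \<in> U" using W by blast
    show "in_chart c (\<lambda>q. J q (?Y q) c) x = coord_J x (F x)"
      unfolding q(1) in_chart_at[OF c qU] F_at[OF qU] by (rule J_at(1)[OF qU vector_field_tangent[OF Y q(2)]])
  qed
  also have "dd v (\<lambda>x. coord_J x (F x)) (\<kappa> p) = dd v (\<lambda>x. coord_J x (F (\<kappa> p))) (\<kappa> p) + coord_J (\<kappa> p) (dd v F (\<kappa> p))" for v
    by (rule dd_apply[OF local.open_S xW(2) linear_J diff_J[OF xW(2)] smooth_on_differentiable[OF smF xW(1)]])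
  finally have dJ: "dd v (in_chart c (\<lambda>q. J q (?Y q) c)) (\<kappa> p) = dd v (\<lambda>x. coord_J x (y c)) (\<kappa> p) + coord_J (\<kappa> p) (dd v F (\<kappa> p))" for v
    by (simp only: F_at[OF p] W1(4))
  have "D p x (\<lambda>q. J q (?Y q)) c = dd (x c) (\<lambda>x. coord_J x (y c)) (\<kappa> p) + coord_J (\<kappa> p) (dd (x c) F (\<kappa> p))
      + christoffel (\<kappa> p) (x c) (coord_J (\<kappa> p) (y c))"
    unfolding connection_coordinates[OF W T(1) JY] dJ W1(4) J_at(1)[OF p T(2)] ..
  moreover have "J p (D p x ?Y) c = coord_J (\<kappa> p) (dd (x c) F (\<kappa> p) + christoffel (\<kappa> p) (x c) (y c))"
    unfolding J_at(1)[OF p DT[OF Y]] connection_coordinates[OF W T(1) Y] F_def W1(4) ..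
  ultimately show "nabla_endo M A D J p x y c = nabla_J (\<kappa> p) (x c) (y c)"
    unfolding nabla component_rules nabla_J_def by (simp add: linear_add[OF linear_J[OF xW(2)]])
qed

text \<open>The eigenbasis lemma for the zero form is the existence of a unitary basis.\<close>

lemma orthonormal_basis_exists:
  assumes p: "p \<in> U"
  shows "\<exists>E. orthonormal_basis A g p E"
proof -
  have x: "\<kappa> p \<in> S" using p by blast
  interpret H: hermitian_space "coord_g (\<kappa> p)" "coord_J (\<kappa> p)" by (rule coord_hermitian[OF x])
  have "bilinear (\<lambda>_ _. 0 :: real)" by (auto intro!: linearI simp: bilinear_def)
  then obtain E where E: "H.unitary_frame E" and span: "span (E \<union> coord_J (\<kappa> p) ` E) = UNIV"
    by (rule H.exists_unitary_eigenbasis) simp_all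
  define B where "B = E \<union> coord_J (\<kappa> p) ` E"
  have "finite B" using H.finite_unitary_frame(1)[OF E] by (simp add: B_def)
  moreover have "span (L p ` B) = tangent_space A p"
    using linear_span_image[OF linear_tvec[OF c p], of B] tangent_space_eq[OF c p] span by (simp add: B_def)
  moreover have "g p (L p a) (L p b) = (if L p a = L p b then 1 else 0)" if "a \<in> B" "b \<in> B" for a b
  proof -
    have "L p a = L p b \<longleftrightarrow> a = b" using L_component[OF p] by metis
    then show ?thesis
      using H.unitary_frame_orthonormal[OF E that[unfolded B_def]] p by (simp add: g_at)
  qed
  ultimately have "orthonormal_basis A g p (L p ` B)" by (simp add: orthonormal_basis_def)
  then show ?thesis by blast
qed

text \<open>The traces over \<open>some_onb\<close> are sums of curvature components only because its members are tangent
vectors.\<close>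

lemma some_onb_tangent:
  assumes p: "p \<in> U" and e: "e \<in> some_onb A g p"
  shows "e \<in> tangent_space A p"
proof -
  have "orthonormal_basis A g p (some_onb A g p)"
    unfolding some_onb_def using orthonormal_basis_exists[OF p] by (rule someI_ex)
  then show ?thesis using e span_base by (auto simp: orthonormal_basis_def)
qed

definition coord_Q :: "nat \<Rightarrow> 'e \<Rightarrow> 'e \<Rightarrow> 'e \<Rightarrow> real"
  where "coord_Q n x a b = bochner_Q n M A g D (\<psi> x) (L (\<psi> x) a) (L (\<psi> x) b)"

lemma ricci_coordinates:
  assumes p: "p \<in> U"
  shows "ricci_tensor M A g D p (L p a) (L p b)
    = (\<Sum>e\<in>some_onb A g p. coord_g (\<kappa> p) (curv (\<kappa> p) a (e c) (e c)) b)"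
  unfolding ricci_tensor_def
  by (intro sum.cong refl) (simp add: riemann_tensor_coordinates p some_onb_tangent)

text \<open>Bilinearity and symmetry of the Ricci form hold term by term in the trace, by the pair symmetry of
the curvature.\<close>

lemma coord_Q_properties:
  assumes x: "x \<in> S"
  shows "bilinear (coord_Q n x)" and "coord_Q n x a b = coord_Q n x b a"
proof -
  define p where "p = \<psi> x"
  have p: "p \<in> U" "\<kappa> p = x" using x psi_in by (simp_all add: p_def)
  define k t where "k = 1 / (2 * (real n + 2))"
    and "t = scalar_curvature M A g D p / (8 * (real n + 1) * (real n + 2))"
  have Q: "coord_Q n x a b = k * (\<Sum>e\<in>some_onb A g p. coord_g x (curv x a (e c) (e c)) b) - t * coord_g x a b" for a b
    unfolding coord_Q_def bochner_Q_def p_def[symmetric] ricci_coordinates[OF p(1)]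
    by (simp add: k_def t_def p g_at)
  note lin = G_linear[OF x] linear_add[OF curv_linear(1)[OF x]] linear_scale[OF curv_linear(1)[OF x]]
  show "bilinear (coord_Q n x)"
    unfolding bilinear_def Q
    by (auto intro!: linearI simp: lin sum.distrib sum_distrib_left[symmetric] algebra_simps)
  have "coord_g x (curv x a e e) b = coord_g x (curv x b e e) a" for e
    using G_curv_pair[OF x, of a e e b] curv_antisym[OF x, of e b a] G_curv_skew[OF x, of b e a e]
    by (simp add: G_linear[OF x])
  then show "coord_Q n x a b = coord_Q n x b a"
    unfolding Q G_sym[OF x, of a b] by simp
qed

lemma bochner_phi_coordinates:
  assumes p: "p \<in> U"
  shows "bochner_phi (g p) (J p) (bochner_Q n M A g D p) (L p a) (L p b) (L p w) (L p u)
    = bochner_phi (coord_g (\<kappa> p)) (coord_J (\<kappa> p)) (coord_Q n (\<kappa> p)) a b w u"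
proof -
  have J: "J p (L p v) = L p (coord_J (\<kappa> p) v)" for v using J_at(2)[OF p L_in[OF p]] p by simp
  show ?thesis
    unfolding bochner_phi_def coord_Q_def coord_g_def psi[OF p] J ..
qed

lemma bochner_flat:
  assumes dim: "DIM('e) > 4"
    and flat: "\<forall>q\<in>topspace M. \<forall>x\<in>tangent_space A q. \<forall>y\<in>tangent_space A q.
      \<forall>z\<in>tangent_space A q. \<forall>u\<in>tangent_space A q. bochner_tensor n M A g J D q x y z u = 0"
  shows "bochner_flat_chart S coord_g coord_J christoffel (coord_Q n)"
proof (intro bochner_flat_chart.intro bochner_flat_chart_axioms.intro)
  show "hermitian_chart S coord_g coord_J christoffel" by (rule hermitian_chart_axioms)
  show "bilinear (coord_Q n x)" if "x \<in> S" for x by (rule coord_Q_properties(1)[OF that])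
  show "coord_Q n x a b = coord_Q n x b a" if "x \<in> S" for x a b by (rule coord_Q_properties(2)[OF that])
  show "coord_g x (curv x a b w) u = bochner_phi (coord_g x) (coord_J x) (coord_Q n x) a b w u"
    if x: "x \<in> S" for x a b w u
  proof -
    define p where "p = \<psi> x"
    have p: "p \<in> U" "\<kappa> p = x" using x psi_in by (simp_all add: p_def)
    have "bochner_tensor n M A g J D p (L p a) (L p b) (L p w) (L p u) = 0"
      using flat U_subset[OF p(1)] L_in[OF p(1)] by blast
    then show ?thesis
      using riemann_tensor_coordinates[OF p(1) L_in[OF p(1)] L_in[OF p(1)] L_in[OF p(1)] L_in[OF p(1)], of a b w u]
        bochner_phi_coordinates[OF p(1), of n a b w u] p
      by (simp add: bochner_tensor_def)
  qed
  show "DIM('e) > 4" by (rule dim)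
qed

end

section \<open>Bochner flat manifolds that are not Kaehlerian at a point\<close>

theorem mainTheorem1:
  fixes M :: "'a topology"
    and A :: "('a, 'e::euclidean_space) chart set"
    and g :: "('a, 'e) metric"
    and J :: "('a, 'e) endo_field"
    and nabla :: "('a, 'e) connection"
    and n :: nat
    and p :: 'a
  assumes "n > 2"
    and "DIM('e) = 2 * n"
    and "almost_hermitian_manifold M A g J"
    and "levi_civita_connection M A g nabla"
    and "\<forall>q\<in>topspace M.
           \<forall>x\<in>tangent_space A q. \<forall>y\<in>tangent_space A q. \<forall>z\<in>tangent_space A q. \<forall>u\<in>tangent_space A q.
             bochner_tensor n M A g J nabla q x y z u = 0"
    and "p \<in> topspace M"
    and "\<not> kaehlerian_at M A nabla J p"
  shows "\<exists>U. openin M U \<and> p \<in> U \<and>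
           (\<forall>q\<in>U. \<forall>x\<in>tangent_space A q. \<forall>y\<in>tangent_space A q.
              \<forall>z\<in>tangent_space A q. \<forall>u\<in>tangent_space A q.
                riemann_tensor M A g nabla q x y z u = 0)"
proof -
  have manifold: "smooth_manifold M A"
    using assms(3) by (simp add: almost_hermitian_manifold_def)
  then have "p \<in> (\<Union>c\<in>A. fst c)" using assms(6) unfolding smooth_manifold_def by blast
  then obtain c where chart: "c \<in> A" "p \<in> fst c" by blast
  interpret almost_hermitian_chart M A g J nabla c
    by (intro almost_hermitian_chart.intro atlas.intro almost_hermitian_chart_axioms.intro manifold assms chart)
  have dim: "DIM('e) > 4" using assms(1,2) by simp
  interpret bochner_flat_chart "snd c ` fst c" coord_g coord_J christoffel "coord_Q n"
    by (rule bochner_flat[OF dim assms(5)])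
  obtain v w where vw: "v \<in> tangent_space A p" "w \<in> tangent_space A p" "nabla_endo M A nabla J p v w \<noteq> 0"
    using assms(7) by (auto simp: kaehlerian_at_def)
  note endo = nabla_endo_coordinates[OF chart(2) vw(1,2)]
  have nz: "nabla_J (snd c p) (v c) (w c) \<noteq> 0"
  proof
    assume "nabla_J (snd c p) (v c) (w c) = 0"
    then have "nabla_endo M A nabla J p v w c = 0 c" unfolding endo(2) by simp
    then have "nabla_endo M A nabla J p v w = 0"
      by (rule tangent_eqI[OF chart endo(1) subspace_0[OF tangent_space_subspace[OF chart]]])
    with vw(3) show False by simp
  qed
  define V where "V = {x \<in> snd c ` fst c. nabla_J x (v c) (w c) \<noteq> 0}"
  have "open (snd c ` fst c \<inter> (\<lambda>x. nabla_J x (v c) (w c)) -` (- {0}))"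
    by (rule continuous_open_preimage[OF continuous_nabla_J open_S open_Compl[OF closed_singleton]])
  moreover have "snd c ` fst c \<inter> (\<lambda>x. nabla_J x (v c) (w c)) -` (- {0}) = V"
    unfolding V_def by blast
  ultimately have "open V" by simp
  then have open_U: "openin M {q \<in> fst c. snd c q \<in> V}"
    by (rule is_chart_open_preimage[OF is_chart[OF chart(1)]])
  show ?thesis
  proof (intro exI conjI ballI)
    show "openin M {q \<in> fst c. snd c q \<in> V}" by (rule open_U)
    show "p \<in> {q \<in> fst c. snd c q \<in> V}" using chart nz by (simp add: V_def)
    fix q x y z u
    assume q: "q \<in> {q \<in> fst c. snd c q \<in> V}"
      and T: "x \<in> tangent_space A q" "y \<in> tangent_space A q" "z \<in> tangent_space A q" "u \<in> tangent_space A q"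
    have qc: "q \<in> fst c" and qV: "snd c q \<in> snd c ` fst c" "nabla_J (snd c q) (v c) (w c) \<noteq> 0"
      using q by (auto simp: V_def)
    have "curv (snd c q) (x c) (y c) (z c) = 0"
      using flat_or_kaehler_point[OF qV(1)] qV(2) by blast
    then show "riemann_tensor M A g nabla q x y z u = 0"
      by (simp add: riemann_tensor_coordinates[OF qc T] G_linear[OF qV(1)])
  qed
qed

end
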